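(* The closure of a sheet in a semisimple Lie algebra is in general not a union of sheets: there exist a semisimple Lie algebra $\mathfrak{g}$ over an algebraically closed field of characteristic zero and a sheet $S$ of $\mathfrak{g}$, for the adjoint action of the adjoint group $G$ of $\mathfrak{g}$, such that the Zariski closure $\overline{S}$ is not a union of sheets of $\mathfrak{g}$.
   Context: For $m\in\mathbb{N}$ let $\mathfrak{g}_{(m)}=\{x\in\mathfrak{g}:\dim G\cdot x=m\}$. A sheet of $\mathfrak{g}$ is an irreducible component of some $\mathfrak{g}_{(m)}$. *)

theory Defs
  imports
    "HOL-Analysis.Abstract_Topology"
    "HOL-Algebra.Bij"
    "HOL-Algebra.Generated_Groups"
    "HOL-Computational_Algebra.Polynomial"
    "HOL-Library.Extended_Nat"
    "HOL-Library.Function_Algebras"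
begin

section \<open>Irreducibility and dimension in a topological space\<close>

definition irreducible_in :: "'a topology \<Rightarrow> 'a set \<Rightarrow> bool" where
  "irreducible_in X S \<longleftrightarrow> S \<subseteq> topspace X \<and> S \<noteq> {} \<and>
     (\<forall>C D. closedin X C \<and> closedin X D \<and> S \<subseteq> C \<union> D \<longrightarrow> S \<subseteq> C \<or> S \<subseteq> D)"

definition irreducible_component_of :: "'a topology \<Rightarrow> 'a set \<Rightarrow> 'a set \<Rightarrow> bool" where
  "irreducible_component_of X A S \<longleftrightarrow> S \<subseteq> A \<and> irreducible_in X S \<and>
     (\<forall>T. T \<subseteq> A \<and> irreducible_in X T \<and> S \<subseteq> T \<longrightarrow> T = S)"

text \<open>The Krull dimension. It is only meaningful for nonempty spaces: the empty space gets
  dimension 0 here.\<close>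

definition krull_dim :: "'a topology \<Rightarrow> enat" where
  "krull_dim X = (SUP n \<in> {n. \<exists>Z :: nat \<Rightarrow> 'a set.
      (\<forall>i\<le>n. closedin X (Z i) \<and> irreducible_in X (Z i)) \<and> (\<forall>i<n. Z i \<subset> Z (Suc i))}. enat n)"


section \<open>Lie algebras\<close>

text \<open>A finite-dimensional Lie algebra whose underlying space is a subspace \<open>L\<close> of some ambient
  vector space. The ambient space plays no role beyond hosting \<open>L\<close>, and the values of the
  bracket outside \<open>L\<close> are irrelevant.\<close>

locale lie_algebra = vector_space scale
  for scale :: "'k::field_char_0 \<Rightarrow> 'a::ab_group_add \<Rightarrow> 'a" (infixr \<open>*s\<close> 75) +
  fixes L :: "'a set" and br :: "'a \<Rightarrow> 'a \<Rightarrow> 'a"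
  assumes subspace_L: "subspace L"
    and finite_dim_L: "\<exists>B. finite B \<and> span B = L"
    and br_closed: "x \<in> L \<Longrightarrow> y \<in> L \<Longrightarrow> br x y \<in> L"
    and br_add_left: "x \<in> L \<Longrightarrow> y \<in> L \<Longrightarrow> z \<in> L \<Longrightarrow> br (x + y) z = br x z + br y z"
    and br_add_right: "x \<in> L \<Longrightarrow> y \<in> L \<Longrightarrow> z \<in> L \<Longrightarrow> br x (y + z) = br x y + br x z"
    and br_scale_left: "x \<in> L \<Longrightarrow> y \<in> L \<Longrightarrow> br (c *s x) y = c *s br x y"
    and br_scale_right: "x \<in> L \<Longrightarrow> y \<in> L \<Longrightarrow> br x (c *s y) = c *s br x y"
    and br_self: "x \<in> L \<Longrightarrow> br x x = 0"
    and jacobi: "x \<in> L \<Longrightarrow> y \<in> L \<Longrightarrow> z \<in> L \<Longrightarrow>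
      br x (br y z) + br y (br z x) + br z (br x y) = 0"
begin

definition lie_ideal :: "'a set \<Rightarrow> bool" where
  "lie_ideal I \<longleftrightarrow> subspace I \<and> I \<subseteq> L \<and> (\<forall>x\<in>L. \<forall>y\<in>I. br x y \<in> I)"

definition derived :: "'a set \<Rightarrow> 'a set" where
  "derived I = span {br x y |x y. x \<in> I \<and> y \<in> I}"

definition solvable :: "'a set \<Rightarrow> bool" where
  "solvable I \<longleftrightarrow> (\<exists>n. (derived ^^ n) I = {0})"

definition semisimple :: bool where
  "semisimple \<longleftrightarrow> (\<forall>I. lie_ideal I \<and> solvable I \<longrightarrow> I = {0})"


subsection \<open>The Zariski topology\<close>

text \<open>Polynomial functions without coordinates: the algebra of functions generated by the
  constants and the linear functionals. Only their restrictions to \<open>L\<close> are used, and every linear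
  functional on \<open>L\<close> extends to the ambient space.\<close>

inductive_set poly_funs :: "('a \<Rightarrow> 'k) set" where
  const: "(\<lambda>_. c) \<in> poly_funs"
| functional: "Vector_Spaces.linear scale (*) f \<Longrightarrow> f \<in> poly_funs"
| add: "f \<in> poly_funs \<Longrightarrow> g \<in> poly_funs \<Longrightarrow> (\<lambda>x. f x + g x) \<in> poly_funs"
| mult: "f \<in> poly_funs \<Longrightarrow> g \<in> poly_funs \<Longrightarrow> (\<lambda>x. f x * g x) \<in> poly_funs"

definition zero_locus :: "('a \<Rightarrow> 'k) set \<Rightarrow> 'a set" where
  "zero_locus P = {x \<in> L. \<forall>p\<in>P. p x = 0}"

definition zariski :: "'a topology" where
  "zariski = topology (\<lambda>U. \<exists>P \<subseteq> poly_funs. U = L - zero_locus P)"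

lemma zero_locus_Un:
  "zero_locus P \<union> zero_locus Q = zero_locus {(\<lambda>x. p x * q x) |p q. p \<in> P \<and> q \<in> Q}"
  (is "_ = zero_locus ?R")
proof (intro equalityI subsetI)
  fix x
  assume x: "x \<in> zero_locus P \<union> zero_locus Q"
  have "r x = 0" if "r \<in> ?R" for r
  proof -
    from that obtain p q where r: "r = (\<lambda>x. p x * q x)" and "p \<in> P" "q \<in> Q"
      by (elim CollectE exE conjE)
    then have "p x = 0 \<or> q x = 0"
      using x unfolding zero_locus_def by blast
    then show "r x = 0"
      unfolding r mult_eq_0_iff .
  qed
  moreover have "x \<in> L"
    using x unfolding zero_locus_def by blast
  ultimately show "x \<in> zero_locus ?R"
    unfolding zero_locus_def by (intro CollectI conjI ballI)
next
  fix x
  assume x: "x \<in> zero_locus ?R"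
  then have "x \<in> L"
    unfolding zero_locus_def by (elim CollectE conjE)
  have *: "p x = 0 \<or> q x = 0" if "p \<in> P" "q \<in> Q" for p q
  proof -
    have "(\<lambda>x. p x * q x) \<in> ?R"
      using that by (intro CollectI exI[of _ p] exI[of _ q] conjI refl)
    moreover have "\<forall>r\<in>?R. r x = 0"
      using x unfolding zero_locus_def mem_Collect_eq by (rule conjunct2)
    ultimately have "p x * q x = 0"
      by (rule bspec[rotated])
    then show ?thesis
      by (simp only: mult_eq_0_iff)
  qed
  show "x \<in> zero_locus P \<union> zero_locus Q"
  proof (cases "\<forall>p\<in>P. p x = 0")
    case True
    with \<open>x \<in> L\<close> show ?thesis
      unfolding zero_locus_def by (intro UnI1 CollectI conjI)
  next
    case False
    then obtain p where "p \<in> P" "p x \<noteq> 0"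
      by meson
    then have "\<forall>q\<in>Q. q x = 0"
      using * by blast
    with \<open>x \<in> L\<close> show ?thesis
      unfolding zero_locus_def by (intro UnI2 CollectI conjI)
  qed
qed

lemma openin_zariski: "openin zariski U \<longleftrightarrow> (\<exists>P \<subseteq> poly_funs. U = L - zero_locus P)"
proof -
  have "istopology (\<lambda>U. \<exists>P \<subseteq> poly_funs. U = L - zero_locus P)"
    unfolding istopology_def
  proof (intro conjI allI impI)
    fix U V
    assume "\<exists>P \<subseteq> poly_funs. U = L - zero_locus P" "\<exists>P \<subseteq> poly_funs. V = L - zero_locus P"
    then obtain P Q where PQ: "P \<subseteq> poly_funs" "U = L - zero_locus P"
      "Q \<subseteq> poly_funs" "V = L - zero_locus Q"
      by blast
    have "{(\<lambda>x. p x * q x) |p q. p \<in> P \<and> q \<in> Q} \<subseteq> poly_funs"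
      using PQ(1,3) by (auto intro!: poly_funs.mult)
    moreover have "U \<inter> V = L - zero_locus {(\<lambda>x. p x * q x) |p q. p \<in> P \<and> q \<in> Q}"
      unfolding zero_locus_Un[symmetric] using PQ by blast
    ultimately show "\<exists>P \<subseteq> poly_funs. U \<inter> V = L - zero_locus P"
      by blast
  next
    fix \<U>
    assume "\<forall>U\<in>\<U>. \<exists>P \<subseteq> poly_funs. U = L - zero_locus P"
    then obtain F where F: "\<forall>U\<in>\<U>. F U \<subseteq> poly_funs \<and> U = L - zero_locus (F U)"
      by metis
    have sub: "(\<Union>U\<in>\<U>. F U) \<subseteq> poly_funs"
      by (rule UN_least) (rule F[THEN bspec, THEN conjunct1])
    have "(\<Union>U\<in>\<U>. U) = (\<Union>U\<in>\<U>. L - zero_locus (F U))"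
      by (rule SUP_cong[OF refl]) (rule F[THEN bspec, THEN conjunct2])
    moreover have "(\<Union>U\<in>\<U>. L - zero_locus (F U)) = L - zero_locus (\<Union>U\<in>\<U>. F U)"
      unfolding zero_locus_def by blast
    ultimately have "\<Union>\<U> = L - zero_locus (\<Union>U\<in>\<U>. F U)"
      by simp
    then show "\<exists>P \<subseteq> poly_funs. \<Union>\<U> = L - zero_locus P"
      using sub by blast
  qed
  from topology_inverse'[OF this] show ?thesis
    unfolding zariski_def by (rule fun_cong)
qed

lemma topspace_zariski: "topspace zariski = L"
proof -
  have "openin zariski L"
    unfolding openin_zariski
    by (intro exI[of _ "{\<lambda>_. 1}"]) (auto simp: zero_locus_def intro: poly_funs.const)
  moreover have "U \<subseteq> L" if "openin zariski U" for U
    using that by (auto simp: openin_zariski)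
  ultimately show ?thesis
    unfolding topspace_def by blast
qed

lemma closedin_zariski: "closedin zariski C \<longleftrightarrow> (\<exists>P \<subseteq> poly_funs. C = zero_locus P)"
proof -
  have sub: "zero_locus P \<subseteq> L" for P
    by (auto simp: zero_locus_def)
  have "C \<subseteq> L \<and> L - C = L - zero_locus P \<longleftrightarrow> C = zero_locus P" for P
    using sub[of P] by blast
  then show ?thesis
    unfolding closedin_def topspace_zariski openin_zariski by metis
qed


subsection \<open>The adjoint group\<close>

definition ad_nilpotent :: "'a \<Rightarrow> bool" where
  "ad_nilpotent x \<longleftrightarrow> (\<exists>n. \<forall>y\<in>L. (br x ^^ n) y = 0)"

text \<open>For ad-nilpotent \<open>x\<close> the exponential series of \<open>ad x\<close> has finitely many nonzero terms at
  every vector, so it can be summed over exactly these.\<close>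

definition exp_ad :: "'a \<Rightarrow> 'a \<Rightarrow> 'a" where
  "exp_ad x = (\<lambda>y\<in>L. \<Sum>i | (br x ^^ i) y \<noteq> 0. inverse (fact i) *s ((br x ^^ i) y))"

text \<open>Over an algebraically closed field, the elementary automorphisms of a semisimple Lie algebra
  form the identity component of its automorphism group, that is, its adjoint group.\<close>

definition adjoint_group :: "('a \<Rightarrow> 'a) set" where
  "adjoint_group = generate (BijGroup L) {exp_ad x |x. x \<in> L \<and> ad_nilpotent x}"

definition adjoint_orbit :: "'a \<Rightarrow> 'a set" where
  "adjoint_orbit x = {g x |g. g \<in> adjoint_group}"


subsection \<open>Sheets\<close>

definition orbit_dim_stratum :: "nat \<Rightarrow> 'a set" where
  "orbit_dim_stratum m =
     {x \<in> L. krull_dim (subtopology zariski (adjoint_orbit x)) = enat m}"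

definition sheet :: "'a set \<Rightarrow> bool" where
  "sheet S \<longleftrightarrow> (\<exists>m. irreducible_component_of zariski (orbit_dim_stratum m) S)"

definition union_of_sheets :: "'a set \<Rightarrow> bool" where
  "union_of_sheets A \<longleftrightarrow> (\<exists>\<S>. (\<forall>S\<in>\<S>. sheet S) \<and> A = \<Union>\<S>)"

end

locale semisimple_lie_algebra = lie_algebra +
  assumes semisimple: semisimple

text \<open>Infinite matrices: a vector space that contains a copy of every finite-dimensional one.\<close>

definition matrix_scale :: "'k::field \<Rightarrow> (nat \<Rightarrow> nat \<Rightarrow> 'k) \<Rightarrow> nat \<Rightarrow> nat \<Rightarrow> 'k" where
  "matrix_scale c A = (\<lambda>i j. c * A i j)"

lemma vector_space_matrix_scale: "vector_space matrix_scale"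
  by unfold_locales (auto simp: matrix_scale_def fun_eq_iff algebra_simps)

end

theory Submission
  imports Defs "HOL-Analysis.Determinants"
begin

text \<open>
  The example is \<open>sl\<^sub>4\<close>. Let \<open>gamma a\<close> be \<open>diag(a, a, -a, -a)\<close> with an additional entry 1 in the upper
  right corner, and let \<open>S\<close> be a sheet that contains \<open>gamma a\<close> for all \<open>a \<noteq> 0\<close>. These matrices have
  orbits of dimension 8, and every traceless matrix with an orbit of dimension 8 has a scalar square.
  Having a scalar square is a closed condition, so it persists on the closure of \<open>S\<close>. When \<open>a\<close> tends
  to 0, \<open>gamma a\<close> degenerates to a nilpotent matrix unit \<open>gamma 0\<close>, which lies in the closure of \<open>S\<close>.
  On the other hand, the orbits of dimension 6 are those of the traceless matrices
  \<open>v w\<^sup>T + s\<close> with \<open>v, w \<noteq> 0\<close>. They form one irreducible set, which is therefore the only sheet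
  through \<open>gamma 0\<close>. This sheet also contains \<open>diag(-1, -1, -1, 3)/4\<close>, whose square is not scalar,
  so it is not contained in the closure of \<open>S\<close>.

  What has to be proved is the dimension statement, \<open>orbit_dim_classification\<close>: a traceless \<open>X\<close> is
  zero, or of the form \<open>v w\<^sup>T + s\<close> with an orbit of dimension 6, or has a scalar square and an orbit
  of dimension at least 8, or has an orbit of dimension at least 9. The last case is that of a
  vector \<open>v\<close> with \<open>v, X v, X\<^sup>2 v\<close> independent; without such a vector \<open>X\<close> is annihilated by a
  quadratic polynomial (\<open>quadratic_if_no_cyclic\<close>), and the two possible shapes of such an \<open>X\<close> are
  \<open>quadratic_dichotomy\<close>.

  Krull dimension is bounded from above by the number of parameters of a polynomial map that
  covers a nonempty open part of the orbit (\<open>krull_dim_le_parameters\<close>). Polynomials that separate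
  the members of a chain of closed irreducible sets are algebraically independent, whereas more
  than \<open>r\<close> polynomials in \<open>r\<close> parameters are dependent, by counting monomials. It is bounded from
  below by explicit chains (\<open>family_orbit_dim\<close>): conjugating an irreducible subset of the orbit by
  a one-parameter unipotent group yields an irreducible set, and its closure is strictly larger as
  soon as some matrix entry that was constant before is no longer constant.
\<close>


section \<open>Algebras of polynomial functions\<close>

text \<open>Polynomial functions on \<open>L\<close>, on matrices, on parameter spaces and on the line all arise from
  different generators \<open>G\<close>, so that pulling a polynomial back along a polynomial map is always an
  instance of \<open>alg_subst\<close>.\<close>

inductive_set alg :: "('x \<Rightarrow> 'k::comm_ring_1) set \<Rightarrow> ('x \<Rightarrow> 'k) set" for G where
  const: "(\<lambda>_. c) \<in> alg G"
| gen: "f \<in> G \<Longrightarrow> f \<in> alg G"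
| add: "f \<in> alg G \<Longrightarrow> g \<in> alg G \<Longrightarrow> (\<lambda>x. f x + g x) \<in> alg G"
| mult: "f \<in> alg G \<Longrightarrow> g \<in> alg G \<Longrightarrow> (\<lambda>x. f x * g x) \<in> alg G"

lemma alg_subst:
  assumes "p \<in> alg G" and "\<And>g. g \<in> G \<Longrightarrow> (\<lambda>x. g (h x)) \<in> alg G'"
  shows "(\<lambda>x. p (h x)) \<in> alg G'"
  using assms(1) by induction (auto intro: alg.intros assms(2))

lemma alg_uminus: "f \<in> alg G \<Longrightarrow> (\<lambda>x. - f x) \<in> alg G"
  using alg.mult[OF alg.const[of "-1"], of f G] by simp

lemma alg_diff: "f \<in> alg G \<Longrightarrow> g \<in> alg G \<Longrightarrow> (\<lambda>x. f x - g x) \<in> alg G"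
  using alg.add[OF _ alg_uminus, of f G g] by simp

lemma alg_sum: "(\<And>i. i \<in> I \<Longrightarrow> f i \<in> alg G) \<Longrightarrow> (\<lambda>x. \<Sum>i\<in>I. f i x) \<in> alg G"
  by (induction I rule: infinite_finite_induct) (auto intro: alg.intros)

lemma alg_prod: "(\<And>i. i \<in> I \<Longrightarrow> f i \<in> alg G) \<Longrightarrow> (\<lambda>x. \<Prod>i\<in>I. f i x) \<in> alg G"
  by (induction I rule: infinite_finite_induct) (auto intro: alg.intros)

lemma alg_power: "f \<in> alg G \<Longrightarrow> (\<lambda>x. f x ^ n) \<in> alg G"
  by (induction n) (auto intro: alg.intros)

lemmas alg_intros = alg.const alg.add alg.mult alg_uminus alg_diff alg_sum alg_prod alg_power

lemma alg_ident_poly: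
  assumes "f \<in> alg {\<lambda>t. t}"
  obtains p where "f = poly p"
proof -
  have "\<exists>p. f = poly p" using assms
  proof induction
    case (const c)
    show ?case by (rule exI[of _ "[:c:]"]) auto
  next
    case (gen f)
    then show ?case by (intro exI[of _ "[:0, 1:]"]) auto
  next
    case (add f g)
    then obtain p q where "f = poly p" "g = poly q" by blast
    then show ?case by (intro exI[of _ "p + q"]) auto
  next
    case (mult f g)
    then obtain p q where "f = poly p" "g = poly q" by blast
    then show ?case by (intro exI[of _ "p * q"]) auto
  qed
  then show thesis using that by blast
qed

lemma alg_ident_mult_eq_0:
  fixes f g :: "'k::field_char_0 \<Rightarrow> 'k"
  assumes "f \<in> alg {\<lambda>t. t}" "g \<in> alg {\<lambda>t. t}" and "\<And>t. f t * g t = 0"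
  shows "(\<forall>t. f t = 0) \<or> (\<forall>t. g t = 0)"
proof -
  obtain p q where pq: "f = poly p" "g = poly q"
    using assms(1,2) alg_ident_poly by metis
  then have "poly (p * q) = poly 0"
    using assms(3) by (auto simp: fun_eq_iff)
  then have "p * q = 0" using poly_eq_poly_eq_iff by blast
  then show ?thesis using pq by auto
qed

lemma alg_ident_nonzero_mult:
  fixes f g :: "'k::field_char_0 \<Rightarrow> 'k"
  assumes "f \<in> alg {\<lambda>t. t}" "g \<in> alg {\<lambda>t. t}" and "f a \<noteq> 0" "g b \<noteq> 0"
  shows "\<exists>t. f t * g t \<noteq> 0"
  using alg_ident_mult_eq_0[OF assms(1,2)] assms(3,4) by blast


section \<open>Counting monomials\<close>

definition monom_fun :: "'i set \<Rightarrow> ('i \<Rightarrow> nat) \<Rightarrow> ('i \<Rightarrow> 'k::comm_ring_1) \<Rightarrow> 'k" where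
  "monom_fun I a = (\<lambda>t. \<Prod>i\<in>I. t i ^ a i)"

definition box :: "'i set \<Rightarrow> nat \<Rightarrow> ('i \<Rightarrow> nat) set" where
  "box I e = (\<Pi>\<^sub>E i\<in>I. {..e})"

lemma finite_box: "finite I \<Longrightarrow> finite (box I e)"
  unfolding box_def by (intro finite_PiE) auto

lemma card_box: "finite I \<Longrightarrow> card (box I e) = (e + 1) ^ card I"
  unfolding box_def by (simp add: card_PiE)

lemma box_mono: "e \<le> e' \<Longrightarrow> box I e \<subseteq> box I e'"
  unfolding box_def by (intro PiE_mono) auto

interpretation fun_vs: vector_space "\<lambda>(c::'k::field) (f::'x \<Rightarrow> 'k). (\<lambda>x. c * f x)"
  by unfold_locales (auto simp: fun_eq_iff algebra_simps)

lemma monom_fun_mult: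
  "finite I \<Longrightarrow> (\<lambda>t. monom_fun I a t * monom_fun I b t) = monom_fun I (restrict (\<lambda>i. a i + b i) I)"
  unfolding monom_fun_def
  by (auto simp: fun_eq_iff power_add simp flip: prod.distrib intro!: prod.cong)

abbreviation low_degree :: "'i set \<Rightarrow> nat \<Rightarrow> (('i \<Rightarrow> 'k::field) \<Rightarrow> 'k) set" where
  "low_degree I e \<equiv> fun_vs.span (monom_fun I ` box I e)"

lemma low_degree_mono: "e \<le> e' \<Longrightarrow> low_degree I e \<subseteq> low_degree I e'"
  by (intro fun_vs.span_mono image_mono box_mono)

lemma subspace_mult_closed:
  "fun_vs.subspace V \<Longrightarrow> fun_vs.subspace {f. (\<lambda>t. f t * g t) \<in> V}"
  unfolding fun_vs.subspace_def
  by (auto simp: zero_fun_def plus_fun_def distrib_right mult.assoc)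

lemma low_degree_mult:
  assumes I: "finite I" and f: "f \<in> low_degree I d" and g: "g \<in> low_degree I e"
  shows "(\<lambda>t. f t * g t) \<in> low_degree I (d + e)"
proof -
  have *: "(\<lambda>t. monom_fun I a t * monom_fun I b t) \<in> low_degree I (d + e)"
    if "a \<in> box I d" "b \<in> box I e" for a b
  proof -
    have "restrict (\<lambda>i. a i + b i) I \<in> box I (d + e)"
      using that unfolding box_def by (auto simp: PiE_iff intro!: add_mono)
    then show ?thesis
      unfolding monom_fun_mult[OF I] by (intro fun_vs.span_base imageI)
  qed
  have half: "low_degree I e \<subseteq> {g. (\<lambda>t. g t * monom_fun I a t) \<in> low_degree I (d + e)}"
    if "a \<in> box I d" for a
    using *[OF that]
    by (intro fun_vs.span_minimal subspace_mult_closed fun_vs.subspace_span) (auto simp: mult.commute)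
  have "(\<lambda>t. monom_fun I a t * g t) \<in> low_degree I (d + e)" if "a \<in> box I d" for a
    using subsetD[OF half[OF that] g] by (simp add: mult.commute)
  then have "low_degree I d \<subseteq> {f. (\<lambda>t. f t * g t) \<in> low_degree I (d + e)}"
    by (intro fun_vs.span_minimal subspace_mult_closed fun_vs.subspace_span) auto
  then show ?thesis using f by blast
qed

lemma monom_fun_0: "monom_fun I (\<lambda>i\<in>I. 0) = (\<lambda>_. 1)"
  by (auto simp: monom_fun_def fun_eq_iff)

lemma low_degree_const: "(\<lambda>_. c) \<in> low_degree I e"
proof -
  have "(\<lambda>i\<in>I. 0) \<in> box I e" by (auto simp: box_def)
  then have "(\<lambda>x. c * monom_fun I (\<lambda>i\<in>I. 0) x) \<in> low_degree I e"
    by (intro fun_vs.span_scale fun_vs.span_base imageI)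
  then show ?thesis unfolding monom_fun_0 by simp
qed

lemma low_degree_power:
  assumes "finite I" "f \<in> low_degree I e"
  shows "(\<lambda>t. f t ^ n) \<in> low_degree I (n * e)"
proof (induction n)
  case 0
  then show ?case by (simp add: low_degree_const)
next
  case (Suc n)
  then show ?case using low_degree_mult[OF assms(1,2) Suc] by simp
qed

lemma alg_coords_low_degree:
  fixes f :: "('i \<Rightarrow> 'k::field) \<Rightarrow> 'k"
  assumes "finite I" "f \<in> alg ((\<lambda>i t. t i) ` I)"
  shows "\<exists>e. f \<in> low_degree I e"
  using assms(2)
proof induction
  case (const c)
  then show ?case using low_degree_const by blast
next
  case (gen f)
  then obtain i where i: "i \<in> I" "f = (\<lambda>t. t i)" by blast
  have "(\<lambda>j\<in>I. if j = i then 1 else 0) \<in> box I 1" by (auto simp: box_def)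
  moreover have "f = monom_fun I (\<lambda>j\<in>I. if j = i then 1 else 0)"
  proof
    fix t :: "'i \<Rightarrow> 'k"
    have "monom_fun I (\<lambda>j\<in>I. if j = i then 1 else 0) t = (\<Prod>j\<in>I. if j = i then t j else 1)"
      unfolding monom_fun_def by (intro prod.cong) auto
    also have "\<dots> = t i" using i(1) assms(1) by simp
    finally show "f t = monom_fun I (\<lambda>j\<in>I. if j = i then 1 else 0) t" by (simp add: i(2))
  qed
  ultimately show ?case by (auto intro: fun_vs.span_base)
next
  case (add f g)
  then obtain d e where "f \<in> low_degree I d" "g \<in> low_degree I e" by blast
  then have "f \<in> low_degree I (max d e)" "g \<in> low_degree I (max d e)"
    using low_degree_mono[of d "max d e" I] low_degree_mono[of e "max d e" I] by auto
  from fun_vs.span_add[OF this] show ?case unfolding plus_fun_def by blast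
next
  case (mult f g)
  then show ?case using low_degree_mult[OF assms(1)] by blast
qed

definition power_prod :: "('x \<Rightarrow> 'k::comm_ring_1) list \<Rightarrow> nat list \<Rightarrow> 'x \<Rightarrow> 'k" where
  "power_prod fs a x = (\<Prod>i<length fs. (fs ! i) x ^ (a ! i))"

definition exponents :: "nat \<Rightarrow> nat \<Rightarrow> nat list set" where
  "exponents n d = {a. length a = n \<and> set a \<subseteq> {..<d}}"

lemma card_exponents: "card (exponents n d) = d ^ n"
  unfolding exponents_def using card_lists_length_eq[of "{..<d}" n] by (simp add: conj_commute)

lemma finite_exponents: "finite (exponents n d)"
  unfolding exponents_def using finite_lists_length_eq[of "{..<d}" n] by (simp add: conj_commute)

lemma low_degree_prod:
  assumes "finite I" "finite J" "\<And>j. j \<in> J \<Longrightarrow> f j \<in> low_degree I (e j)"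
  shows "(\<lambda>t. \<Prod>j\<in>J. f j t) \<in> low_degree I (\<Sum>j\<in>J. e j)"
  using assms(2,3)
proof (induction J)
  case empty
  then show ?case by (simp add: low_degree_const)
next
  case (insert j J)
  then show ?case using low_degree_mult[OF assms(1), of "f j" "e j" "\<lambda>t. \<Prod>j\<in>J. f j t"] by simp
qed

lemma sum_fun_apply: "(\<Sum>v\<in>S. h v) t = (\<Sum>v\<in>S. h v t)"
  by (induction S rule: infinite_finite_induct) auto

text \<open>The \<open>d ^ n\<close> products of powers with exponents below \<open>d\<close> live in a space of
  dimension \<open>O(d ^ card I)\<close>, so for large \<open>d\<close> they cannot be independent if \<open>n > card I\<close>.\<close>

lemma algebraic_relation:
  fixes fs :: "(('i \<Rightarrow> 'k::field) \<Rightarrow> 'k) list"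
  assumes I: "finite I" and fs: "\<And>f. f \<in> set fs \<Longrightarrow> f \<in> alg ((\<lambda>i t. t i) ` I)"
    and n: "card I < length fs"
  obtains d c where "\<exists>a\<in>exponents (length fs) d. c a \<noteq> 0"
    and "\<And>t. (\<Sum>a\<in>exponents (length fs) d. c a * power_prod fs a t) = 0"
proof -
  let ?n = "length fs"
  have "\<forall>f\<in>set fs. \<exists>e. f \<in> low_degree I e"
    using alg_coords_low_degree[OF I fs] by blast
  then obtain e0 where e0: "\<And>f. f \<in> set fs \<Longrightarrow> f \<in> low_degree I (e0 f)" by metis
  define e where "e = (\<Sum>f\<in>set fs. e0 f)"
  have e: "f \<in> low_degree I e" if "f \<in> set fs" for f
    using e0[OF that] low_degree_mono[of "e0 f" e I] that member_le_sum[of f "set fs" e0]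
    unfolding e_def by auto
  \<comment> \<open>large enough for \<open>(n d e + 1)^card I \<le> (n e + 1)^card I * d^card I < d^n\<close>\<close>
  define d where "d = (?n * e + 1) ^ card I + 1"
  let ?E = "exponents ?n d" and ?D = "?n * (d * e)"
  have deg: "power_prod fs a \<in> low_degree I ?D" if a: "a \<in> ?E" for a
  proof -
    have "(\<lambda>t. \<Prod>i<?n. (fs ! i) t ^ (a ! i)) \<in> low_degree I (\<Sum>i<?n. a ! i * e)"
      using e by (intro low_degree_prod low_degree_power I) auto
    moreover have "(\<Sum>i<?n. a ! i * e) \<le> (\<Sum>i<?n. d * e)"
      using a by (intro sum_mono mult_right_mono) (auto simp: exponents_def subset_iff less_imp_le)
    ultimately show ?thesis
      using low_degree_mono[of _ ?D I] unfolding power_prod_def by auto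
  qed
  have few: "card (box I ?D) < card ?E"
  proof -
    have "?D + 1 \<le> (?n * e + 1) * d" by (simp add: d_def algebra_simps)
    then have "(?D + 1) ^ card I \<le> ((?n * e + 1) * d) ^ card I" by (rule power_mono) simp
    also have "\<dots> = (?n * e + 1) ^ card I * d ^ card I" by (rule power_mult_distrib)
    also have "\<dots> < d * d ^ card I" by (intro mult_strict_right_mono) (auto simp: d_def)
    also have "\<dots> \<le> d ^ ?n" using n power_increasing[of "Suc (card I)" ?n d] by (simp add: d_def)
    finally show ?thesis by (simp add: card_box[OF I] card_exponents)
  qed
  have fin: "finite ?E" by (rule finite_exponents)
  show thesis
  proof (cases "inj_on (power_prod fs) ?E")
    case False
    then obtain a b where ab: "a \<in> ?E" "b \<in> ?E" "a \<noteq> b" "power_prod fs a = power_prod fs b"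
      unfolding inj_on_def by blast
    define c where "c = (\<lambda>x. if x = a then 1 else if x = b then -1 else (0::'k))"
    have "(\<Sum>x\<in>?E. c x * power_prod fs x t) = 0" for t
    proof -
      have "(\<Sum>x\<in>?E. c x * power_prod fs x t) = (\<Sum>x\<in>{a, b}. c x * power_prod fs x t)"
        using fin ab by (intro sum.mono_neutral_right) (auto simp: c_def)
      then show ?thesis using ab by (simp add: c_def)
    qed
    moreover have "\<exists>x\<in>?E. c x \<noteq> 0" using ab by (auto simp: c_def intro!: bexI[of _ a])
    ultimately show thesis using that by blast
  next
    case True
    let ?S = "power_prod fs ` ?E"
    have "fun_vs.dependent ?S"
    proof (rule ccontr)
      assume "fun_vs.independent ?S"
      then have "card ?S \<le> card (monom_fun I ` box I ?D :: (('i \<Rightarrow> 'k) \<Rightarrow> 'k) set)"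
        using fun_vs.independent_span_bound[of "monom_fun I ` box I ?D" ?S] deg finite_box[OF I]
        by blast
      also have "\<dots> \<le> card (box I ?D)" by (intro card_image_le finite_box I)
      finally show False using few card_image[OF True] by simp
    qed
    then obtain u f where u: "f \<in> ?S" "u f \<noteq> 0" "(\<Sum>v\<in>?S. (\<lambda>x. u v * v x)) = 0"
      using fun_vs.dependent_finite[of ?S] fin by auto
    have "(\<Sum>a\<in>?E. u (power_prod fs a) * power_prod fs a t) = 0" for t
    proof -
      have "(\<Sum>a\<in>?E. u (power_prod fs a) * power_prod fs a t) = (\<Sum>v\<in>?S. u v * v t)"
        by (simp add: sum.reindex[OF True])
      also have "\<dots> = (\<Sum>v\<in>?S. (\<lambda>x. u v * v x)) t"
        by (simp add: sum_fun_apply)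
      finally show ?thesis using u(3) by (simp add: zero_fun_def)
    qed
    then show thesis using that[of d "\<lambda>a. u (power_prod fs a)"] u(1,2) by blast
  qed
qed


section \<open>Irreducible sets and Krull dimension\<close>

lemma irreducible_in_split:
  assumes "irreducible_in X S" "closedin X C" "closedin X D" "S \<subseteq> C \<union> D"
  shows "S \<subseteq> C \<or> S \<subseteq> D"
  using assms unfolding irreducible_in_def by simp

lemma irreducible_in_subtopology:
  assumes "S \<subseteq> V" "V \<subseteq> topspace X"
  shows "irreducible_in (subtopology X V) S \<longleftrightarrow> irreducible_in X S"
proof
  assume *: "irreducible_in (subtopology X V) S"
  show "irreducible_in X S"
    unfolding irreducible_in_def
  proof (intro conjI allI impI)
    show "S \<subseteq> topspace X" "S \<noteq> {}" using * assms unfolding irreducible_in_def by auto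
  next
    fix C D assume CD: "closedin X C \<and> closedin X D \<and> S \<subseteq> C \<union> D"
    then have "closedin (subtopology X V) (V \<inter> C)" "closedin (subtopology X V) (V \<inter> D)"
      by (auto simp: closedin_subtopology)
    moreover have "S \<subseteq> V \<inter> C \<union> V \<inter> D" using CD assms(1) by blast
    ultimately have "S \<subseteq> V \<inter> C \<or> S \<subseteq> V \<inter> D" by (rule irreducible_in_split[OF *])
    then show "S \<subseteq> C \<or> S \<subseteq> D" by blast
  qed
next
  assume *: "irreducible_in X S"
  show "irreducible_in (subtopology X V) S"
    unfolding irreducible_in_def
  proof (intro conjI allI impI)
    show "S \<subseteq> topspace (subtopology X V)" "S \<noteq> {}"
      using * assms unfolding irreducible_in_def by auto
  next
    fix C D
    assume CD: "closedin (subtopology X V) C \<and> closedin (subtopology X V) D \<and> S \<subseteq> C \<union> D"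
    then obtain C' D' where C': "closedin X C'" "C = C' \<inter> V" and D': "closedin X D'" "D = D' \<inter> V"
      unfolding closedin_subtopology by auto
    have "S \<subseteq> C' \<union> D'" using CD C'(2) D'(2) by blast
    then have "S \<subseteq> C' \<or> S \<subseteq> D'" by (rule irreducible_in_split[OF * C'(1) D'(1)])
    then show "S \<subseteq> C \<or> S \<subseteq> D" using assms(1) C'(2) D'(2) by blast
  qed
qed

lemma irreducible_in_between:
  assumes "irreducible_in X W" "W \<subseteq> S" "S \<subseteq> X closure_of W"
  shows "irreducible_in X S"
  unfolding irreducible_in_def
proof (intro conjI allI impI)
  show "S \<subseteq> topspace X" using assms(3) closure_of_subset_topspace by fastforce
  have "W \<noteq> {}" using assms(1) unfolding irreducible_in_def by simp
  then show "S \<noteq> {}" using assms(2) by blast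
next
  fix C D assume CD: "closedin X C \<and> closedin X D \<and> S \<subseteq> C \<union> D"
  then have "W \<subseteq> C \<union> D" using assms(2) by blast
  then have "W \<subseteq> C \<or> W \<subseteq> D" using irreducible_in_split[OF assms(1)] CD by simp
  then have "X closure_of W \<subseteq> C \<or> X closure_of W \<subseteq> D"
    using CD closure_of_minimal[of W C X] closure_of_minimal[of W D X] by blast
  then show "S \<subseteq> C \<or> S \<subseteq> D" using assms(3) by blast
qed

text \<open>Zorn's lemma applies because the union of a chain of irreducible sets is irreducible: if it
  were covered properly by two closed sets, so would be some member of the chain.\<close>

lemma irreducible_in_subset_component:
  assumes "irreducible_in X T" "T \<subseteq> A"
  obtains S where "irreducible_component_of X A S" "T \<subseteq> S"
proof -
  let ?F = "{S. T \<subseteq> S \<and> S \<subseteq> A \<and> irreducible_in X S}"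
  have "\<exists>S\<in>?F. \<forall>S'\<in>?F. S \<subseteq> S' \<longrightarrow> S' = S"
  proof (rule subset_Zorn_nonempty)
    show "?F \<noteq> {}" using assms by blast
  next
    fix \<C> assume ne: "\<C> \<noteq> {}" and ch: "subset.chain ?F \<C>"
    have F: "T \<subseteq> S" "S \<subseteq> A" "irreducible_in X S" if "S \<in> \<C>" for S
      using ch that unfolding subset_chain_def by auto
    obtain S0 where S0: "S0 \<in> \<C>" using ne by blast
    have "irreducible_in X (\<Union>\<C>)"
      unfolding irreducible_in_def
    proof (intro conjI allI impI)
      show "\<Union>\<C> \<subseteq> topspace X" using F(3) by (intro Union_least) (simp add: irreducible_in_def)
      have "S0 \<noteq> {}" using F(3)[OF S0] by (simp add: irreducible_in_def)
      then show "\<Union>\<C> \<noteq> {}" using S0 by blast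
    next
      fix C D assume CD: "closedin X C \<and> closedin X D \<and> \<Union>\<C> \<subseteq> C \<union> D"
      show "\<Union>\<C> \<subseteq> C \<or> \<Union>\<C> \<subseteq> D"
      proof (rule ccontr)
        assume "\<not> ?thesis"
        then obtain S S' where S: "S \<in> \<C>" "\<not> S \<subseteq> C" "S' \<in> \<C>" "\<not> S' \<subseteq> D" by blast
        then have "S \<subseteq> S' \<or> S' \<subseteq> S" using ch unfolding subset_chain_def by blast
        then obtain M where "M \<in> \<C>" "\<not> M \<subseteq> C" "\<not> M \<subseteq> D" using S by blast
        moreover from this have "M \<subseteq> C \<union> D" using CD by blast
        ultimately show False using irreducible_in_split[OF F(3), of M C D] CD by simp
      qed
    qed
    moreover have "T \<subseteq> \<Union>\<C>" using F(1)[OF S0] S0 by blast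
    moreover have "\<Union>\<C> \<subseteq> A" using F(2) by (rule Union_least)
    ultimately show "\<Union>\<C> \<in> ?F" by blast
  qed
  then obtain S where S: "S \<in> ?F" "\<forall>S'\<in>?F. S \<subseteq> S' \<longrightarrow> S' = S" by (rule bexE)
  have "S' = S" if "S' \<subseteq> A" "irreducible_in X S'" "S \<subseteq> S'" for S'
  proof -
    have "S' \<in> ?F" using that S(1) by blast
    then show ?thesis using S(2) that(3) by blast
  qed
  then have "irreducible_component_of X A S"
    unfolding irreducible_component_of_def using S(1) by simp
  then show thesis using that S(1) by blast
qed

context lie_algebra
begin

lemma poly_funs_eq_alg: "poly_funs = alg {f. Vector_Spaces.linear scale (*) f}"
proof
  show "poly_funs \<subseteq> alg {f. Vector_Spaces.linear scale (*) f}"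
  proof
    fix p assume "p \<in> poly_funs"
    then show "p \<in> alg {f. Vector_Spaces.linear scale (*) f}"
      by induction (auto intro: alg.intros)
  qed
  show "alg {f. Vector_Spaces.linear scale (*) f} \<subseteq> poly_funs"
  proof
    fix p assume "p \<in> alg {f. Vector_Spaces.linear scale (*) f}"
    then show "p \<in> poly_funs"
      by induction (auto intro: poly_funs.intros)
  qed
qed

lemmas poly_intros = alg_intros[where G = "{f. Vector_Spaces.linear scale (*) f}",
    folded poly_funs_eq_alg]

text \<open>The vanishing ideal of an irreducible set is prime. This turns irreducibility into a statement
  about two single polynomials, which is the form used in all later arguments.\<close>

lemma irreducible_zariski_iff:
  "irreducible_in zariski S \<longleftrightarrow> S \<subseteq> L \<and> S \<noteq> {} \<and>
     (\<forall>p\<in>poly_funs. \<forall>q\<in>poly_funs. (\<forall>x\<in>S. p x * q x = 0) \<longrightarrow> (\<forall>x\<in>S. p x = 0) \<or> (\<forall>x\<in>S. q x = 0))"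
  (is "_ \<longleftrightarrow> _ \<and> _ \<and> ?P")
proof -
  have 1: "?P" if S: "irreducible_in zariski S"
  proof (intro ballI impI)
    fix p q assume pq: "p \<in> poly_funs" "q \<in> poly_funs" "\<forall>x\<in>S. p x * q x = 0"
    have "closedin zariski (zero_locus {p})" "closedin zariski (zero_locus {q})"
      unfolding closedin_zariski using pq by blast+
    moreover have "S \<subseteq> zero_locus {p} \<union> zero_locus {q}"
      using pq(3) S unfolding zero_locus_def irreducible_in_def topspace_zariski by auto
    ultimately have "S \<subseteq> zero_locus {p} \<or> S \<subseteq> zero_locus {q}"
      by (rule irreducible_in_split[OF S])
    then show "(\<forall>x\<in>S. p x = 0) \<or> (\<forall>x\<in>S. q x = 0)" unfolding zero_locus_def by blast
  qed
  have 2: "S \<subseteq> C \<or> S \<subseteq> D"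
    if P: "?P" and SL: "S \<subseteq> L" and CD: "closedin zariski C" "closedin zariski D" "S \<subseteq> C \<union> D" for C D
  proof (rule ccontr)
    obtain P Q where PQ: "P \<subseteq> poly_funs" "Q \<subseteq> poly_funs" "C = zero_locus P" "D = zero_locus Q"
      using CD unfolding closedin_zariski by blast
    assume "\<not> ?thesis"
    then obtain x y where xy: "x \<in> S" "x \<notin> C" "y \<in> S" "y \<notin> D" by blast
    obtain p where p: "p \<in> P" "p x \<noteq> 0"
      using xy(1,2) SL unfolding PQ(3) zero_locus_def by blast
    obtain q where q: "q \<in> Q" "q y \<noteq> 0"
      using xy(3,4) SL unfolding PQ(4) zero_locus_def by blast
    have "\<forall>z\<in>S. p z * q z = 0"
    proof
      fix z assume "z \<in> S"
      then have "z \<in> C \<or> z \<in> D" using CD(3) by blast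
      then show "p z * q z = 0" using p(1) q(1) unfolding PQ zero_locus_def by auto
    qed
    moreover have "p \<in> poly_funs" "q \<in> poly_funs" using p q PQ by auto
    ultimately have "(\<forall>z\<in>S. p z = 0) \<or> (\<forall>z\<in>S. q z = 0)" using P by simp
    then show False using p q xy by blast
  qed
  show ?thesis
  proof
    assume "irreducible_in zariski S"
    then show "S \<subseteq> L \<and> S \<noteq> {} \<and> ?P"
      using 1 by (simp add: irreducible_in_def topspace_zariski)
  next
    assume "S \<subseteq> L \<and> S \<noteq> {} \<and> ?P"
    then show "irreducible_in zariski S"
      unfolding irreducible_in_def topspace_zariski using 2 by simp
  qed
qed

lemma irreducible_mult_nonzero:
  assumes "irreducible_in zariski S" "p \<in> poly_funs" "q \<in> poly_funs"
    and "x \<in> S" "p x \<noteq> 0" "y \<in> S" "q y \<noteq> 0"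
  shows "\<exists>z\<in>S. p z \<noteq> 0 \<and> q z \<noteq> 0"
proof (rule ccontr)
  assume "\<not> ?thesis"
  then have "\<forall>z\<in>S. p z * q z = 0" by auto
  then have "(\<forall>z\<in>S. p z = 0) \<or> (\<forall>z\<in>S. q z = 0)"
    using assms(1-3) unfolding irreducible_zariski_iff by simp
  then show False using assms(4-7) by blast
qed

lemma closure_of_vanish:
  assumes "p \<in> poly_funs" "\<And>x. x \<in> W \<Longrightarrow> p x = 0" "W \<subseteq> L" "x \<in> zariski closure_of W"
  shows "p x = 0"
proof -
  have "zariski closure_of W \<subseteq> zero_locus {p}"
    using assms(1-3) by (intro closure_of_minimal) (auto simp: zero_locus_def closedin_zariski)
  then show ?thesis using assms(4) unfolding zero_locus_def by blast
qed

lemma in_closure_ofI: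
  assumes "x \<in> L" "W \<subseteq> L"
    and "\<And>p. p \<in> poly_funs \<Longrightarrow> (\<And>y. y \<in> W \<Longrightarrow> p y = 0) \<Longrightarrow> p x = 0"
  shows "x \<in> zariski closure_of W"
  unfolding in_closure_of topspace_zariski
proof (intro conjI allI impI)
  show "x \<in> L" by fact
next
  fix T assume T: "x \<in> T \<and> openin zariski T"
  then obtain P where P: "P \<subseteq> poly_funs" "T = L - zero_locus P"
    unfolding openin_zariski by blast
  then obtain p where p: "p \<in> P" "p x \<noteq> 0" using T unfolding zero_locus_def by blast
  then obtain y where "y \<in> W" "p y \<noteq> 0" using assms(3)[of p] P(1) by blast
  then show "\<exists>y. y \<in> W \<and> y \<in> T" using assms(2) p(1) P unfolding zero_locus_def by blast
qed

text \<open>If two polynomials violate primality on \<open>S\<close>, then already two points of \<open>S\<close>, one where each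
  polynomial is nonzero, witness it.\<close>

lemma irreducible_if_pairs:
  assumes "S \<subseteq> L" "S \<noteq> {}"
    and "\<And>x y. x \<in> S \<Longrightarrow> y \<in> S \<Longrightarrow> \<exists>T\<subseteq>S. irreducible_in zariski T \<and> x \<in> T \<and> y \<in> T"
  shows "irreducible_in zariski S"
  unfolding irreducible_zariski_iff
proof (intro conjI assms(1,2) ballI impI)
  fix p q assume pq: "p \<in> poly_funs" "q \<in> poly_funs" "\<forall>x\<in>S. p x * q x = 0"
  show "(\<forall>x\<in>S. p x = 0) \<or> (\<forall>x\<in>S. q x = 0)"
  proof (rule ccontr)
    assume "\<not> ?thesis"
    then obtain x y where xy: "x \<in> S" "p x \<noteq> 0" "y \<in> S" "q y \<noteq> 0" by blast
    then obtain T where T: "T \<subseteq> S" "irreducible_in zariski T" "x \<in> T" "y \<in> T"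
      using assms(3) by blast
    with irreducible_mult_nonzero[OF T(2) pq(1,2) T(3) xy(2) T(4) xy(4)] pq(3)
    show False by fastforce
  qed
qed

text \<open>Suppose that \<open>p\<close> and \<open>q\<close> do not vanish at \<open>h t y\<close> and \<open>h t' y'\<close>. Since \<open>W\<close> is irreducible, \<open>y\<close>
  and \<open>y'\<close> can be replaced by a common \<open>z\<close>, and then \<open>t\<close> and \<open>t'\<close> by a common \<open>s\<close>, because
  polynomials in one variable form an integral domain.\<close>

lemma irreducible_sweep:
  assumes W: "irreducible_in zariski W"
    and hL: "\<And>t y. y \<in> L \<Longrightarrow> h t y \<in> L"
    and cont: "\<And>t p. p \<in> poly_funs \<Longrightarrow> \<exists>q\<in>poly_funs. \<forall>y\<in>L. p (h t y) = q y"
    and poly: "\<And>p y. p \<in> poly_funs \<Longrightarrow> y \<in> L \<Longrightarrow> (\<lambda>t. p (h t y)) \<in> alg {\<lambda>t. t}"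
  shows "irreducible_in zariski {h t y |t y. y \<in> W}"
  unfolding irreducible_zariski_iff
proof (intro conjI ballI impI)
  have WL: "W \<subseteq> L" "W \<noteq> {}" using W unfolding irreducible_zariski_iff by auto
  then show "{h t y |t y. y \<in> W} \<subseteq> L" "{h t y |t y. y \<in> W} \<noteq> {}" using hL by auto
  fix p q
  assume pq: "p \<in> poly_funs" "q \<in> poly_funs" and 0: "\<forall>x\<in>{h t y |t y. y \<in> W}. p x * q x = 0"
  show "(\<forall>x\<in>{h t y |t y. y \<in> W}. p x = 0) \<or> (\<forall>x\<in>{h t y |t y. y \<in> W}. q x = 0)"
  proof (rule ccontr)
    assume "\<not> ?thesis"
    then obtain t y t' y' where ty: "y \<in> W" "p (h t y) \<noteq> 0" "y' \<in> W" "q (h t' y') \<noteq> 0" by blast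
    obtain p' where p': "p' \<in> poly_funs" "\<forall>y\<in>L. p (h t y) = p' y"
      using cont[OF pq(1), of t] by (rule bexE)
    obtain q' where q': "q' \<in> poly_funs" "\<forall>y\<in>L. q (h t' y) = q' y"
      using cont[OF pq(2), of t'] by (rule bexE)
    have yL: "y \<in> L" "y' \<in> L" using ty(1,3) WL(1) by auto
    have "p' y \<noteq> 0" "q' y' \<noteq> 0"
      using p'(2)[rule_format, OF yL(1)] q'(2)[rule_format, OF yL(2)] ty by simp_all
    from irreducible_mult_nonzero[OF W p'(1) q'(1) ty(1) this(1) ty(3) this(2)]
    obtain z where z: "z \<in> W" "p' z \<noteq> 0 \<and> q' z \<noteq> 0" by (rule bexE)
    have zL: "z \<in> L" using z(1) WL(1) by blast
    have nz: "p (h t z) \<noteq> 0" "q (h t' z) \<noteq> 0"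
      using z(2) p'(2)[rule_format, OF zL] q'(2)[rule_format, OF zL] by simp_all
    obtain s where s: "p (h s z) * q (h s z) \<noteq> 0"
      using alg_ident_nonzero_mult[OF poly[OF pq(1) zL] poly[OF pq(2) zL] nz] by (rule exE)
    have "h s z \<in> {h t y |t y. y \<in> W}" using z(1) by blast
    with 0 have "p (h s z) * q (h s z) = 0" by (rule bspec)
    then show False using s by contradiction
  qed
qed

lemma irreducible_singleton: "x \<in> L \<Longrightarrow> irreducible_in zariski {x}"
  unfolding irreducible_zariski_iff by auto


subsection \<open>Upper bounds\<close>

lemma power_prod_snoc:
  assumes "length a = length fs"
  shows "power_prod (fs @ [f]) (a @ [k]) x = power_prod fs a x * f x ^ k"
  unfolding power_prod_def using assms by (auto simp: nth_append intro!: prod.cong)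

lemma exponents_snoc:
  assumes "b \<in> exponents (Suc n) d"
  shows "b = butlast b @ [last b]" "butlast b \<in> exponents n d" "last b < d"
proof -
  have "b \<noteq> []" using assms by (auto simp: exponents_def)
  then show "b = butlast b @ [last b]" by simp
  show "last b < d" using last_in_set[OF \<open>b \<noteq> []\<close>] assms unfolding exponents_def by blast
  show "butlast b \<in> exponents n d"
    using assms by (auto simp: exponents_def dest: in_set_butlastD)
qed

lemma sum_exponents_Suc:
  "(\<Sum>a\<in>exponents (Suc n) d. g a) = (\<Sum>k<d. \<Sum>a\<in>exponents n d. g (a @ [k]))"
proof -
  have "bij_betw (\<lambda>(k, a). a @ [k]) ({..<d} \<times> exponents n d) (exponents (Suc n) d)"
  proof (rule bij_betwI')
    fix b assume "b \<in> exponents (Suc n) d"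
    then have "b = butlast b @ [last b]" "butlast b \<in> exponents n d" "last b \<in> {..<d}"
      using exponents_snoc by auto
    then show "\<exists>x\<in>{..<d} \<times> exponents n d. b = (case x of (k, a) \<Rightarrow> a @ [k])"
      by (intro bexI[of _ "(last b, butlast b)"]) auto
  qed (auto simp: exponents_def)
  from sum.reindex_bij_betw[OF this, of g] show ?thesis
    by (simp add: sum.cartesian_product split_def)
qed

lemma power_prod_poly: "set fs \<subseteq> poly_funs \<Longrightarrow> power_prod fs a \<in> poly_funs"
  unfolding power_prod_def[abs_def] by (intro poly_intros) auto

text \<open>Separating functions of a chain are algebraically independent on its top member. Order a
  relation by powers of the last function \<open>f\<close>. On the irreducible top member the lowest power of
  \<open>f\<close> can be cancelled; restricting to the next member, where \<open>f\<close> vanishes, leaves the lowest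
  coefficient, a relation between the other functions.\<close>

lemma chain_independent:
  assumes "\<And>i. i \<le> length fs \<Longrightarrow> irreducible_in zariski (Z i)"
    and "\<And>i. i < length fs \<Longrightarrow> Z i \<subseteq> Z (Suc i)"
    and "set fs \<subseteq> poly_funs"
    and "\<And>i x. i < length fs \<Longrightarrow> x \<in> Z i \<Longrightarrow> (fs ! i) x = 0"
    and "\<And>i. i < length fs \<Longrightarrow> \<exists>x\<in>Z (Suc i). (fs ! i) x \<noteq> 0"
    and "\<And>x. x \<in> Z (length fs) \<Longrightarrow> (\<Sum>a\<in>exponents (length fs) d. c a * power_prod fs a x) = 0"
    and "a \<in> exponents (length fs) d"
  shows "c a = 0"
  using assms
proof (induction fs arbitrary: c a rule: rev_induct)
  case Nil
  obtain x where "x \<in> Z 0" using Nil(1)[of 0] unfolding irreducible_in_def by auto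
  moreover have "exponents 0 d = {[]}" by (auto simp: exponents_def)
  ultimately show ?case using Nil(6)[of x] Nil(7) by (simp add: power_prod_def)
next
  case (snoc f fs)
  let ?n = "length fs"
  have irr: "irreducible_in zariski (Z (Suc ?n))" using snoc.prems(1) by simp
  have sub: "Z ?n \<subseteq> Z (Suc ?n)" using snoc.prems(2)[of ?n] by simp
  have f0: "f x = 0" if "x \<in> Z ?n" for x using snoc.prems(4)[of ?n x] that by simp
  obtain y where y: "y \<in> Z (Suc ?n)" "f y \<noteq> 0" using snoc.prems(5)[of ?n] by auto
  have fs: "f \<in> poly_funs" "set fs \<subseteq> poly_funs" using snoc.prems(3) by auto
  have IH: "c' a = 0"
    if "\<And>x. x \<in> Z ?n \<Longrightarrow> (\<Sum>a\<in>exponents ?n d. c' a * power_prod fs a x) = 0" "a \<in> exponents ?n d" for c' a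
  proof (rule snoc.IH[of c' a])
    fix i assume i: "i < length fs"
    show "x \<in> Z i \<Longrightarrow> (fs ! i) x = 0" for x using snoc.prems(4)[of i x] i by (simp add: nth_append)
    show "\<exists>x\<in>Z (Suc i). (fs ! i) x \<noteq> 0" using snoc.prems(5)[of i] i by (simp add: nth_append)
  qed (use that snoc.prems(1,2) fs in auto)
  define G where "G = (\<lambda>k x. \<Sum>a\<in>exponents ?n d. c (a @ [k]) * power_prod fs a x)"
  have G: "G k \<in> poly_funs" for k
    unfolding G_def by (intro poly_intros power_prod_poly fs)
  have total: "(\<Sum>k<d. f x ^ k * G k x) = 0" if "x \<in> Z (Suc ?n)" for x
  proof -
    have "(\<Sum>k<d. f x ^ k * G k x)
      = (\<Sum>k<d. \<Sum>a\<in>exponents ?n d. c (a @ [k]) * power_prod (fs @ [f]) (a @ [k]) x)"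
      unfolding G_def sum_distrib_left
      by (intro sum.cong) (auto simp: exponents_def power_prod_snoc)
    also have "\<dots> = 0" using snoc.prems(6)[of x] that by (simp add: sum_exponents_Suc)
    finally show ?thesis .
  qed
  have "\<forall>a\<in>exponents ?n d. c (a @ [k]) = 0" if "k < d" for k
    using that
  proof (induction k rule: less_induct)
    case (less k)
    have low: "G j = (\<lambda>_. 0)" if "j < k" for j
      using less that unfolding G_def by (auto simp: fun_eq_iff intro!: sum.neutral)
    define R where "R = (\<lambda>x. \<Sum>j\<in>{k..<d}. f x ^ (j - k) * G j x)"
    have R: "R \<in> poly_funs" unfolding R_def by (intro poly_intros fs G)
    have prod0: "f x ^ k * R x = 0" if "x \<in> Z (Suc ?n)" for x
    proof -
      have "f x ^ k * R x = (\<Sum>j\<in>{k..<d}. f x ^ j * G j x)"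
        unfolding R_def sum_distrib_left
        by (intro sum.cong) (auto simp: power_add[symmetric] mult.assoc[symmetric])
      also have "\<dots> = (\<Sum>j<d. f x ^ j * G j x)"
        by (intro sum.mono_neutral_left) (auto simp: low)
      finally show ?thesis using total[OF that] by simp
    qed
    have fk: "(\<lambda>x. f x ^ k) \<in> poly_funs" by (intro poly_intros fs)
    have fky: "f y ^ k \<noteq> 0" using y(2) by simp
    have R0: "R x = 0" if "x \<in> Z ?n" for x
    proof (rule ccontr)
      assume "R x \<noteq> 0"
      moreover have "x \<in> Z (Suc ?n)" using that sub by blast
      ultimately obtain z where "z \<in> Z (Suc ?n)" "f z ^ k \<noteq> 0 \<and> R z \<noteq> 0"
        using irreducible_mult_nonzero[OF irr fk R y(1) fky] by blast
      then show False using prod0[of z] by simp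
    qed
    have "G k x = 0" if "x \<in> Z ?n" for x
    proof -
      have "R x = (\<Sum>j\<in>{k}. f x ^ (j - k) * G j x)"
        unfolding R_def using less.prems f0[OF that]
        by (intro sum.mono_neutral_right) (auto simp: power_0_left)
      then show ?thesis using R0[OF that] by simp
    qed
    then show ?case using IH[of "\<lambda>a. c (a @ [k])"] unfolding G_def by blast
  qed
  moreover have "a = butlast a @ [last a]" "butlast a \<in> exponents ?n d" "last a < d"
    using snoc.prems(7) exponents_snoc[of a ?n d] by auto
  ultimately show ?case by metis
qed

lemma closedin_sub_separate:
  assumes "closedin (subtopology zariski V) Z" "V \<subseteq> L" "y \<in> V" "y \<notin> Z"
  shows "\<exists>p\<in>poly_funs. (\<forall>x\<in>Z. p x = 0) \<and> p y \<noteq> 0"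
proof -
  obtain C where C: "closedin zariski C" "Z = C \<inter> V"
    using assms(1) unfolding closedin_subtopology by blast
  then obtain P where "P \<subseteq> poly_funs" "C = zero_locus P" unfolding closedin_zariski by blast
  then show ?thesis using assms(2-4) C(2) unfolding zero_locus_def by blast
qed

text \<open>Every relation between pulled back functions holds on the image of \<open>\<phi>\<close>, hence on the part of
  \<open>V\<close> where \<open>\<delta> \<noteq> 0\<close>, hence on \<open>V\<close> by irreducibility. A chain longer than the number of parameters
  would therefore contradict \<open>chain_independent\<close>.\<close>

lemma krull_dim_le_parameters:
  assumes V: "irreducible_in zariski V" and I: "finite I"
    and poly: "\<And>p. p \<in> poly_funs \<Longrightarrow> (\<lambda>t. p (\<phi> t)) \<in> alg ((\<lambda>i t. t i) ` I)"
    and dom: "\<delta> \<in> poly_funs" "x0 \<in> V" "\<delta> x0 \<noteq> 0"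
      "\<And>y. y \<in> V \<Longrightarrow> \<delta> y \<noteq> 0 \<Longrightarrow> y \<in> range \<phi>"
  shows "krull_dim (subtopology zariski V) \<le> enat (card I)"
  unfolding krull_dim_def
proof (rule SUP_least)
  let ?X = "subtopology zariski V"
  have VL: "V \<subseteq> L" using V unfolding irreducible_zariski_iff by blast
  fix n assume "n \<in> {n. \<exists>Z :: nat \<Rightarrow> 'a set.
      (\<forall>i\<le>n. closedin ?X (Z i) \<and> irreducible_in ?X (Z i)) \<and> (\<forall>i<n. Z i \<subset> Z (Suc i))}"
  then obtain Z :: "nat \<Rightarrow> 'a set"
    where Z: "\<And>i. i \<le> n \<Longrightarrow> closedin ?X (Z i)" "\<And>i. i \<le> n \<Longrightarrow> irreducible_in ?X (Z i)"
      "\<And>i. i < n \<Longrightarrow> Z i \<subset> Z (Suc i)"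
    by auto
  have ZV: "Z i \<subseteq> V" if "i \<le> n" for i
    using closedin_subset[OF Z(1)[OF that]] by simp
  have irr: "irreducible_in zariski (Z i)" if "i \<le> n" for i
    using Z(2)[OF that] irreducible_in_subtopology[OF ZV[OF that], of zariski] VL
    by (simp add: topspace_zariski)
  have "\<exists>p\<in>poly_funs. (\<forall>x\<in>Z i. p x = 0) \<and> (\<exists>y\<in>Z (Suc i). p y \<noteq> 0)" if i: "i < n" for i
  proof -
    obtain y where y: "y \<in> Z (Suc i)" "y \<notin> Z i" using Z(3)[OF i] by blast
    have "y \<in> V" using ZV[of "Suc i"] y(1) i by auto
    from closedin_sub_separate[OF Z(1)[OF less_imp_le[OF i]] VL this y(2)] y(1) show ?thesis
      by blast
  qed
  then obtain F where F: "\<And>i. i < n \<Longrightarrow> F i \<in> poly_funs" "\<And>i x. i < n \<Longrightarrow> x \<in> Z i \<Longrightarrow> F i x = 0"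
    "\<And>i. i < n \<Longrightarrow> \<exists>y\<in>Z (Suc i). F i y \<noteq> 0"
    by metis
  define fs where "fs = map F [0..<n]"
  have fs: "length fs = n" "\<And>i. i < n \<Longrightarrow> fs ! i = F i" "set fs \<subseteq> poly_funs"
    unfolding fs_def using F(1) by auto
  show "enat n \<le> enat (card I)"
  proof (rule ccontr)
    assume "\<not> ?thesis"
    then have n: "card I < length (map (\<lambda>f t. f (\<phi> t)) fs)" by (simp add: fs)
    have "f \<in> alg ((\<lambda>i t. t i) ` I)" if "f \<in> set (map (\<lambda>f t. f (\<phi> t)) fs)" for f
      using that fs(3) poly by auto
    from algebraic_relation[OF I this n] obtain d c
      where dc: "\<exists>a\<in>exponents n d. c a \<noteq> 0"
        "\<And>t. (\<Sum>a\<in>exponents n d. c a * power_prod (map (\<lambda>f t. f (\<phi> t)) fs) a t) = 0"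
      by (auto simp: fs(1))
    have comp: "power_prod (map (\<lambda>f t. f (\<phi> t)) fs) a t = power_prod fs a (\<phi> t)" for a t
      unfolding power_prod_def by simp
    define R where "R = (\<lambda>x. \<Sum>a\<in>exponents n d. c a * power_prod fs a x)"
    have R: "R \<in> poly_funs" unfolding R_def by (intro poly_intros power_prod_poly fs)
    have "R x * \<delta> x = 0" if x: "x \<in> V" for x
    proof (cases "\<delta> x = 0")
      case False
      then obtain t where "x = \<phi> t" using dom(4)[OF x] by blast
      then show ?thesis using dc(2)[of t] unfolding R_def comp by simp
    qed simp
    then have "(\<forall>x\<in>V. R x = 0) \<or> (\<forall>x\<in>V. \<delta> x = 0)"
      using V R dom(1) unfolding irreducible_zariski_iff by simp
    then have R0: "\<forall>x\<in>V. R x = 0" using dom(2,3) by blast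
    have "c a = 0" if "a \<in> exponents n d" for a
    proof (rule chain_independent[of fs Z c d a])
      show "(\<Sum>a\<in>exponents (length fs) d. c a * power_prod fs a x) = 0" if "x \<in> Z (length fs)" for x
        using R0 that ZV[of n] unfolding R_def fs(1) by blast
      show "irreducible_in zariski (Z i)" if "i \<le> length fs" for i
        using irr that unfolding fs(1) .
      show "Z i \<subseteq> Z (Suc i)" if "i < length fs" for i
        using Z(3)[of i] that unfolding fs(1) by blast
      show "set fs \<subseteq> poly_funs" by (rule fs(3))
      show "(fs ! i) x = 0" if "i < length fs" "x \<in> Z i" for i x
        using F(2)[of i x] that fs(2)[of i] unfolding fs(1) by simp
      show "\<exists>x\<in>Z (Suc i). (fs ! i) x \<noteq> 0" if "i < length fs" for i
        using F(3)[of i] that fs(2)[of i] unfolding fs(1) by simp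
      show "a \<in> exponents (length fs) d" using that unfolding fs(1) .
    qed
    then show False using dc(1) by blast
  qed
qed


subsection \<open>Lower bounds\<close>

text \<open>The top of the chain is the relative closure of \<open>W\<close>, so that chains can be prolonged by
  enlarging \<open>W\<close> without ever computing a closure.\<close>

definition chain_below :: "'a set \<Rightarrow> nat \<Rightarrow> 'a set \<Rightarrow> bool" where
  "chain_below V n W \<longleftrightarrow> (\<exists>Z.
     (\<forall>i\<le>n. closedin (subtopology zariski V) (Z i) \<and> irreducible_in (subtopology zariski V) (Z i)) \<and>
     (\<forall>i<n. Z i \<subset> Z (Suc i)) \<and> Z n = V \<inter> zariski closure_of W)"

lemma chain_below_krull_dim:
  assumes "chain_below V n W"
  shows "enat n \<le> krull_dim (subtopology zariski V)"
proof -
  let ?X = "subtopology zariski V"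
  let ?N = "{n. \<exists>Z :: nat \<Rightarrow> 'a set.
      (\<forall>i\<le>n. closedin ?X (Z i) \<and> irreducible_in ?X (Z i)) \<and> (\<forall>i<n. Z i \<subset> Z (Suc i))}"
  obtain Z where "\<forall>i\<le>n. closedin ?X (Z i) \<and> irreducible_in ?X (Z i)" "\<forall>i<n. Z i \<subset> Z (Suc i)"
    using assms unfolding chain_below_def by (elim exE conjE)
  then have "n \<in> ?N" by (intro CollectI exI[of _ Z] conjI)
  then show ?thesis unfolding krull_dim_def by (rule SUP_upper)
qed

lemma closure_in_sub:
  assumes "irreducible_in zariski W" "W \<subseteq> V" "V \<subseteq> L"
  shows "closedin (subtopology zariski V) (V \<inter> zariski closure_of W)"
    and "irreducible_in (subtopology zariski V) (V \<inter> zariski closure_of W)"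
proof -
  show "closedin (subtopology zariski V) (V \<inter> zariski closure_of W)"
    unfolding closedin_subtopology using closedin_closure_of by blast
  have "W \<subseteq> zariski closure_of W"
    using assms topspace_zariski by (intro closure_of_subset) auto
  then have "irreducible_in zariski (V \<inter> zariski closure_of W)"
    using assms by (intro irreducible_in_between[OF assms(1)]) auto
  then show "irreducible_in (subtopology zariski V) (V \<inter> zariski closure_of W)"
    using irreducible_in_subtopology[of _ V zariski] assms(3) topspace_zariski by auto
qed

lemma chain_below_0:
  assumes "irreducible_in zariski W" "W \<subseteq> V" "V \<subseteq> L"
  shows "chain_below V 0 W"
  unfolding chain_below_def
  by (intro exI[of _ "\<lambda>_. V \<inter> zariski closure_of W"] conjI allI impI closure_in_sub[OF assms] refl)
    simp

lemma chain_below_Suc: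
  assumes "chain_below V n W" "W \<subseteq> W'" and W': "irreducible_in zariski W'" "W' \<subseteq> V" "V \<subseteq> L"
    and p: "p \<in> poly_funs" "\<And>x. x \<in> W \<Longrightarrow> p x = 0" and y: "y \<in> W'" "p y \<noteq> 0"
  shows "chain_below V (Suc n) W'"
proof -
  obtain Z where Z: "\<forall>i\<le>n. closedin (subtopology zariski V) (Z i) \<and> irreducible_in (subtopology zariski V) (Z i)"
    "\<forall>i<n. Z i \<subset> Z (Suc i)" "Z n = V \<inter> zariski closure_of W"
    using assms(1) unfolding chain_below_def by (elim exE conjE)
  let ?Z = "Z(Suc n := V \<inter> zariski closure_of W')"
  have "W' \<subseteq> zariski closure_of W'"
    using W'(2,3) by (intro closure_of_subset) (simp add: topspace_zariski)
  then have "y \<in> V \<inter> zariski closure_of W'"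
    using W'(2) y(1) by blast
  moreover have "y \<notin> zariski closure_of W"
  proof
    assume *: "y \<in> zariski closure_of W"
    have "W \<subseteq> L" using assms(2) W'(2,3) by (meson subset_trans)
    from closure_of_vanish[OF p(1) p(2) this *] y(2) show False by simp
  qed
  moreover have "zariski closure_of W \<subseteq> zariski closure_of W'"
    by (intro closure_of_mono assms(2))
  ultimately have "Z n \<subset> V \<inter> zariski closure_of W'" unfolding Z(3) by blast
  then have "?Z i \<subset> ?Z (Suc i)" if "i < Suc n" for i
    using Z(2)[rule_format, of i] that less_Suc_eq[of i n] by simp
  moreover have "closedin (subtopology zariski V) (?Z i)" "irreducible_in (subtopology zariski V) (?Z i)"
    if "i \<le> Suc n" for i
    using Z(1) closure_in_sub[OF W'] that by (cases "i = Suc n"; simp)+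
  ultimately show ?thesis
    unfolding chain_below_def by (intro exI[of _ ?Z] conjI allI impI) simp_all
qed

end


section \<open>Orbits of the adjoint group\<close>

lemma sum_square_triangle:
  fixes g :: "nat \<Rightarrow> nat \<Rightarrow> 'a::comm_monoid_add"
  assumes "\<And>i j. K \<le> i + j \<Longrightarrow> g i j = 0"
  shows "(\<Sum>i<K. \<Sum>j<K. g i j) = (\<Sum>k<K. \<Sum>i\<le>k. g i (k - i))"
proof -
  have "(\<Sum>i<K. \<Sum>j<K. g i j) = (\<Sum>(i, j)\<in>{..<K} \<times> {..<K}. g i j)"
    by (rule sum.cartesian_product)
  also have "\<dots> = (\<Sum>(i, j)\<in>{(i, j). i + j < K}. g i j)"
    using assms by (intro sum.mono_neutral_right) (auto, meson not_less)
  also have "\<dots> = (\<Sum>k<K. \<Sum>i\<le>k. g i (k - i))" by (rule sum.triangle_reindex)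
  finally show ?thesis .
qed

lemma sum_inverse_fact_alternating:
  "(\<Sum>i\<le>k. (-1) ^ i * inverse (fact i) * inverse (fact (k - i)) :: 'k::field_char_0) = (if k = 0 then 1 else 0)"
proof (cases "k = 0")
  case False
  have "(\<Sum>i\<le>k. (-1) ^ i * inverse (fact i) * inverse (fact (k - i)) :: 'k)
    = (\<Sum>i\<le>k. inverse (fact k) * ((-1) ^ i * of_nat (k choose i)))"
    by (intro sum.cong) (auto simp: binomial_fact field_simps)
  also have "\<dots> = 0" using choose_alternating_sum[of k, where 'a = 'k] False
    by (simp flip: sum_distrib_left)
  finally show ?thesis using False by simp
qed simp

context lie_algebra
begin

abbreviation nilpotents :: "'a set" where
  "nilpotents \<equiv> {x \<in> L. ad_nilpotent x}"

lemma L_zero: "0 \<in> L" using subspace_0[OF subspace_L] .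
lemma L_scale: "x \<in> L \<Longrightarrow> scale c x \<in> L" using subspace_scale[OF subspace_L] .
lemma L_add: "x \<in> L \<Longrightarrow> y \<in> L \<Longrightarrow> x + y \<in> L" using subspace_add[OF subspace_L] .
lemma L_sum: "(\<And>i. i \<in> I \<Longrightarrow> f i \<in> L) \<Longrightarrow> (\<Sum>i\<in>I. f i) \<in> L"
  using subspace_sum[OF subspace_L] .

lemma br_zero_right: "x \<in> L \<Longrightarrow> br x 0 = 0"
  using br_scale_right[of x x 0] by simp

lemma br_pow_closed: "x \<in> L \<Longrightarrow> y \<in> L \<Longrightarrow> (br x ^^ i) y \<in> L"
  by (induction i) (auto intro: br_closed)

lemma br_pow_add:
  "x \<in> L \<Longrightarrow> y \<in> L \<Longrightarrow> z \<in> L \<Longrightarrow> (br x ^^ i) (y + z) = (br x ^^ i) y + (br x ^^ i) z"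
  by (induction i) (auto simp: br_add_right br_pow_closed)

lemma br_pow_scale:
  "x \<in> L \<Longrightarrow> y \<in> L \<Longrightarrow> (br x ^^ i) (scale c y) = scale c ((br x ^^ i) y)"
  by (induction i) (auto simp: br_scale_right br_pow_closed)

lemma br_pow_zero: "x \<in> L \<Longrightarrow> (br x ^^ i) 0 = 0"
  by (induction i) (auto simp: br_zero_right)

lemma br_pow_sum:
  "x \<in> L \<Longrightarrow> (\<And>j. j \<in> J \<Longrightarrow> f j \<in> L) \<Longrightarrow> (br x ^^ i) (\<Sum>j\<in>J. f j) = (\<Sum>j\<in>J. (br x ^^ i) (f j))"
  by (induction J rule: infinite_finite_induct) (auto simp: br_pow_zero br_pow_add L_sum)

lemma br_scale_pow:
  "x \<in> L \<Longrightarrow> y \<in> L \<Longrightarrow> (br (scale t x) ^^ i) y = scale (t ^ i) ((br x ^^ i) y)"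
  by (induction i) (auto simp: br_scale_left br_scale_right br_pow_closed L_scale)

lemma br_pow_ge:
  assumes "x \<in> L" "y \<in> L" "\<forall>z\<in>L. (br x ^^ K) z = 0" "K \<le> i"
  shows "(br x ^^ i) y = 0"
proof -
  have "(br x ^^ i) y = (br x ^^ (i - K)) ((br x ^^ K) y)"
    using assms(4) by (metis comp_apply funpow_add le_add_diff_inverse2)
  then show ?thesis using assms br_pow_zero by simp
qed

lemma exp_ad_sum:
  assumes "x \<in> L" "y \<in> L" "\<forall>z\<in>L. (br x ^^ K) z = 0"
  shows "exp_ad x y = (\<Sum>i<K. scale (inverse (fact i)) ((br x ^^ i) y))"
  unfolding exp_ad_def using assms br_pow_ge[OF assms]
  by (auto intro!: sum.mono_neutral_left simp: not_less[symmetric])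

lemma nilpotents_scale:
  assumes "n \<in> nilpotents"
  shows "scale t n \<in> nilpotents"
proof -
  have n: "n \<in> L" using assms by simp
  obtain K where "\<forall>y\<in>L. (br n ^^ K) y = 0" using assms by (auto simp: ad_nilpotent_def)
  then have "\<forall>y\<in>L. (br (scale t n) ^^ K) y = 0" by (simp add: br_scale_pow n)
  then show ?thesis using L_scale[OF n] unfolding ad_nilpotent_def by blast
qed

lemma exp_ad_scale_sum:
  assumes "x \<in> L" "y \<in> L" "\<forall>z\<in>L. (br x ^^ K) z = 0"
  shows "exp_ad (scale t x) y = (\<Sum>i<K. scale (t ^ i * inverse (fact i)) ((br x ^^ i) y))"
proof -
  have "\<forall>z\<in>L. (br (scale t x) ^^ K) z = 0" using assms by (simp add: br_scale_pow)
  from exp_ad_sum[OF L_scale[OF assms(1)] assms(2) this] show ?thesis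
    using assms(1,2) by (simp add: br_scale_pow mult.commute)
qed

lemma exp_ad_closed:
  assumes "x \<in> nilpotents" "y \<in> L"
  shows "exp_ad x y \<in> L"
proof -
  obtain K where "\<forall>z\<in>L. (br x ^^ K) z = 0" using assms(1) by (auto simp: ad_nilpotent_def)
  then show ?thesis using assms by (auto simp: exp_ad_sum intro!: L_sum L_scale br_pow_closed)
qed

lemma exp_ad_zero: "y \<in> L \<Longrightarrow> exp_ad (scale 0 x) y = y"
proof -
  assume y: "y \<in> L"
  have "(br 0 ^^ 1) z = 0" if "z \<in> L" for z using br_scale_left[OF that that, of 0] by simp
  then show ?thesis using exp_ad_sum[OF L_zero y, of 1] by simp
qed

text \<open>The Cauchy product of the two exponential series, whose terms of positive degree cancel by the
  alternating sum of binomial coefficients.\<close>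

lemma exp_ad_inverse:
  assumes "x \<in> nilpotents" "y \<in> L"
  shows "exp_ad (scale (-1) x) (exp_ad x y) = y"
proof -
  obtain K where K: "\<forall>z\<in>L. (br x ^^ K) z = 0" using assms(1) by (auto simp: ad_nilpotent_def)
  have x: "x \<in> L" using assms(1) by simp
  have K': "\<forall>z\<in>L. (br x ^^ Suc K) z = 0" using K br_zero_right[OF x] by simp
  let ?c = "\<lambda>i j. (-1) ^ i * inverse (fact i) * inverse (fact j) :: 'k"
  have "exp_ad (scale (-1) x) (exp_ad x y)
      = (\<Sum>i<Suc K. \<Sum>j<Suc K. scale (?c i j) ((br x ^^ (i + j)) y))"
    unfolding exp_ad_scale_sum[OF x exp_ad_closed[OF assms] K']
    unfolding exp_ad_sum[OF x assms(2) K']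
    using x assms(2)
    by (simp only: br_pow_sum L_scale br_pow_closed br_pow_scale scale_sum_right scale_scale funpow_add o_apply)
  also have "\<dots> = (\<Sum>k<Suc K. \<Sum>i\<le>k. scale (?c i (k - i)) ((br x ^^ (i + (k - i))) y))"
    using br_pow_ge[OF x assms(2) K'] by (intro sum_square_triangle) simp
  also have "\<dots> = (\<Sum>k<Suc K. scale (if k = 0 then 1 else 0) ((br x ^^ k) y))"
    by (intro sum.cong) (auto simp: sum_inverse_fact_alternating[symmetric] scale_sum_left)
  also have "\<dots> = (\<Sum>k\<in>{0}. scale (if k = 0 then 1 else 0) ((br x ^^ k) y))"
    by (intro sum.mono_neutral_right) auto
  also have "\<dots> = y" by simp
  finally show ?thesis .
qed

lemma exp_ad_Bij:
  assumes "x \<in> nilpotents"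
  shows "exp_ad x \<in> Bij L"
proof -
  have m: "scale (-1) x \<in> nilpotents" using nilpotents_scale[OF assms] .
  have "exp_ad x (exp_ad (scale (-1) x) y) = y" if "y \<in> L" for y
    using exp_ad_inverse[OF m that] assms by simp
  then have "bij_betw (exp_ad x) L L"
    using exp_ad_inverse[OF assms] exp_ad_closed[OF assms] exp_ad_closed[OF m]
    by (intro bij_betw_byWitness[where f' = "exp_ad (scale (-1) x)"]) auto
  then show ?thesis unfolding Bij_def exp_ad_def by auto
qed

lemma adjoint_group_Bij:
  assumes "g \<in> adjoint_group"
  shows "g \<in> Bij L"
proof -
  have "{exp_ad x |x. x \<in> L \<and> ad_nilpotent x} \<subseteq> carrier (BijGroup L)"
    using exp_ad_Bij by (auto simp: BijGroup_def)
  from group.generate_incl[OF group_BijGroup this] assms show ?thesis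
    unfolding adjoint_group_def by (auto simp: BijGroup_def)
qed

text \<open>The inverse of a generator is again a generator, so orbits are reached by compositions of
  exponentials alone.\<close>

lemma adjoint_group_foldr:
  assumes "g \<in> adjoint_group"
  shows "\<exists>ns. set ns \<subseteq> nilpotents \<and> (\<forall>x\<in>L. g x = foldr exp_ad ns x)"
  using assms unfolding adjoint_group_def
proof (induction rule: generate.induct)
  case one
  then show ?case by (intro exI[of _ "[]"]) (simp add: BijGroup_def)
next
  case (incl h)
  then obtain n where "h = exp_ad n" "n \<in> nilpotents" by blast
  then show ?case by (intro exI[of _ "[n]"]) simp
next
  case (inv h)
  then obtain n where n: "h = exp_ad n" "n \<in> nilpotents" by blast
  have m: "scale (-1) n \<in> nilpotents" using nilpotents_scale[OF n(2)] .
  have "inv_into L (exp_ad n) x = exp_ad (scale (-1) n) x" if "x \<in> L" for x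
  proof (rule inv_into_f_eq)
    show "inj_on (exp_ad n) L" using exp_ad_Bij[OF n(2)] by (simp add: Bij_def bij_betw_def)
    show "exp_ad (scale (-1) n) x \<in> L" using exp_ad_closed[OF m that] .
    show "exp_ad n (exp_ad (scale (-1) n) x) = x" using exp_ad_inverse[OF m that] n(2) by simp
  qed
  then show ?case using m n by (intro exI[of _ "[scale (-1) n]"]) (simp add: inv_BijGroup exp_ad_Bij)
next
  case (eng h1 h2)
  then obtain ns1 ns2 where
    1: "set ns1 \<subseteq> nilpotents" "\<forall>x\<in>L. h1 x = foldr exp_ad ns1 x" and
    2: "set ns2 \<subseteq> nilpotents" "\<forall>x\<in>L. h2 x = foldr exp_ad ns2 x" by blast
  have in_L: "foldr exp_ad ns x \<in> L" if "x \<in> L" "set ns \<subseteq> nilpotents" for ns x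
    using that by (induction ns) (auto intro: exp_ad_closed)
  have "(h1 \<otimes>\<^bsub>BijGroup L\<^esub> h2) x = foldr exp_ad (ns1 @ ns2) x" if "x \<in> L" for x
  proof -
    have "h1 \<in> Bij L" "h2 \<in> Bij L"
      using adjoint_group_Bij eng.hyps unfolding adjoint_group_def by simp_all
    then show ?thesis using 1 2 that in_L by (simp add: BijGroup_def compose_def)
  qed
  then show ?case using 1 2 by (intro exI[of _ "ns1 @ ns2"]) simp
qed

lemma orbit_refl:
  assumes "x \<in> L"
  shows "x \<in> adjoint_orbit x"
proof -
  have "(\<lambda>x\<in>L. x) \<in> adjoint_group"
    using generate.one[of "BijGroup L"] unfolding adjoint_group_def by (simp add: BijGroup_def)
  then show ?thesis
    unfolding adjoint_orbit_def using assms by (intro CollectI exI[of _ "\<lambda>x\<in>L. x"]) simp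
qed

lemma orbit_step:
  assumes "x \<in> L" "y \<in> adjoint_orbit x" "n \<in> nilpotents"
  shows "exp_ad n y \<in> adjoint_orbit x"
proof -
  obtain g where g: "g \<in> adjoint_group" "y = g x" using assms(2) unfolding adjoint_orbit_def by blast
  have e: "exp_ad n \<in> adjoint_group"
    using assms(3) unfolding adjoint_group_def by (intro generate.incl) blast
  have 1: "exp_ad n \<otimes>\<^bsub>BijGroup L\<^esub> g \<in> adjoint_group"
    using g(1) e unfolding adjoint_group_def by (intro generate.eng)
  have 2: "(exp_ad n \<otimes>\<^bsub>BijGroup L\<^esub> g) x = exp_ad n y"
    using adjoint_group_Bij[OF g(1)] adjoint_group_Bij[OF e] assms(1) g(2)
    by (simp add: BijGroup_def compose_def)
  show ?thesis
    unfolding adjoint_orbit_def 2[symmetric] using 1 by blast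
qed

lemma orbit_foldr:
  assumes "x \<in> L" "y \<in> adjoint_orbit x"
  obtains ns where "set ns \<subseteq> nilpotents" "y = foldr exp_ad ns x"
  using assms adjoint_group_foldr unfolding adjoint_orbit_def by blast

lemma foldr_exp_ad_closed:
  "x \<in> L \<Longrightarrow> set ns \<subseteq> nilpotents \<Longrightarrow> foldr exp_ad ns x \<in> L"
  by (induction ns) (auto intro: exp_ad_closed)

lemma orbit_subset: "x \<in> L \<Longrightarrow> adjoint_orbit x \<subseteq> L"
  by (metis foldr_exp_ad_closed orbit_foldr subsetI)

text \<open>The polynomial functions are generated by functionals of the ambient space, while the
  exponentials are linear only on \<open>L\<close>. Extending functionals from \<open>L\<close> makes the exponentials
  continuous for the Zariski topology.\<close>

lemma linear_extend:
  assumes add: "\<And>x y. x \<in> L \<Longrightarrow> y \<in> L \<Longrightarrow> f (x + y) = f x + f y"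
    and scale: "\<And>c x. x \<in> L \<Longrightarrow> f (scale c x) = c * f x"
  shows "\<exists>g. Vector_Spaces.linear scale (*) g \<and> (\<forall>x\<in>L. g x = f x)"
proof -
  interpret vp: vector_space_pair scale "(*) :: 'k \<Rightarrow> 'k \<Rightarrow> 'k"
    by unfold_locales (auto simp: algebra_simps)
  obtain B where B: "independent B" "B \<subseteq> L" "L \<subseteq> span B" using basis_exists[of L] by metis
  obtain g where g: "Vector_Spaces.linear scale (*) g" "\<forall>x\<in>B. g x = f x"
    using vp.linear_independent_extend[OF B(1)] by blast
  interpret g: Vector_Spaces.linear scale "(*)" g by (rule g(1))
  have "subspace {x \<in> L. g x = f x}"
    unfolding subspace_def using L_zero scale[OF L_zero, of 0]
    by (auto simp: g.zero g.add g.scale add scale L_add L_scale)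
  then have "span B \<subseteq> {x \<in> L. g x = f x}" using g(2) B(2) by (intro span_minimal) auto
  then show ?thesis using g(1) B(3) by blast
qed

lemma poly_exp_ad:
  assumes n: "n \<in> nilpotents" and p: "p \<in> poly_funs"
  shows "\<exists>q\<in>poly_funs. \<forall>y\<in>L. p (exp_ad n y) = q y"
  using p
proof induction
  case (const c)
  then show ?case by (intro bexI[of _ "\<lambda>_. c"] poly_funs.const) simp
next
  case (functional f)
  interpret f: Vector_Spaces.linear scale "(*)" f by (rule functional)
  obtain K where K: "\<forall>z\<in>L. (br n ^^ K) z = 0" using n by (auto simp: ad_nilpotent_def)
  have nL: "n \<in> L" using n by simp
  have "\<exists>g. Vector_Spaces.linear scale (*) g \<and> (\<forall>y\<in>L. g y = f (exp_ad n y))"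
    by (rule linear_extend)
       (simp_all add: exp_ad_sum[OF nL _ K] L_add L_scale nL br_pow_add br_pow_scale f.sum f.scale f.add
         distrib_left sum.distrib sum_distrib_left ac_simps)
  then show ?case using poly_funs.functional by metis
next
  case (add p q)
  then obtain p' q' where "p' \<in> poly_funs" "\<forall>y\<in>L. p (exp_ad n y) = p' y"
    "q' \<in> poly_funs" "\<forall>y\<in>L. q (exp_ad n y) = q' y" by auto
  then show ?case by (intro bexI[of _ "\<lambda>x. p' x + q' x"] poly_funs.add) auto
next
  case (mult p q)
  then obtain p' q' where "p' \<in> poly_funs" "\<forall>y\<in>L. p (exp_ad n y) = p' y"
    "q' \<in> poly_funs" "\<forall>y\<in>L. q (exp_ad n y) = q' y" by auto
  then show ?case by (intro bexI[of _ "\<lambda>x. p' x * q' x"] poly_funs.mult) auto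
qed

lemma poly_exp_ad_param:
  assumes n: "n \<in> nilpotents" and y: "y \<in> L" and p: "p \<in> poly_funs"
  shows "(\<lambda>t. p (exp_ad (scale t n) y)) \<in> alg {\<lambda>t. t}"
  using p
proof induction
  case (functional f)
  interpret f: Vector_Spaces.linear scale "(*)" f by (rule functional)
  obtain K where K: "\<forall>z\<in>L. (br n ^^ K) z = 0" using n by (auto simp: ad_nilpotent_def)
  have nL: "n \<in> L" using n by simp
  have id: "(\<lambda>t::'k. t) \<in> alg {\<lambda>t. t}" by (rule alg.gen) simp
  show ?case
    unfolding exp_ad_scale_sum[OF nL y K] f.sum f.scale
    by (intro alg_intros id)
qed (auto intro: alg_intros)

lemma irreducible_exp_ad_sweep:
  assumes "irreducible_in zariski W" "n \<in> nilpotents"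
  shows "irreducible_in zariski {exp_ad (scale t n) y |t y. y \<in> W}"
  using assms(1) exp_ad_closed[OF nilpotents_scale[OF assms(2)]]
    poly_exp_ad[OF nilpotents_scale[OF assms(2)]] poly_exp_ad_param[OF assms(2)]
  by (rule irreducible_sweep)

text \<open>Replacing each exponential in a composition by its one-parameter group connects the point
  reached by the composition with \<open>x\<close> inside an irreducible subset of the orbit.\<close>

primrec sweep :: "'a list \<Rightarrow> 'a \<Rightarrow> 'a set" where
  "sweep [] x = {x}"
| "sweep (n # ns) x = {exp_ad (scale t n) y |t y. y \<in> sweep ns x}"

lemma sweep_irreducible:
  "x \<in> L \<Longrightarrow> set ns \<subseteq> nilpotents \<Longrightarrow> irreducible_in zariski (sweep ns x)"
  by (induction ns) (auto intro: irreducible_exp_ad_sweep irreducible_singleton simp del: mem_Collect_eq)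

lemma sweep_subset_orbit:
  "x \<in> L \<Longrightarrow> set ns \<subseteq> nilpotents \<Longrightarrow> sweep ns x \<subseteq> adjoint_orbit x"
  by (induction ns) (auto intro!: orbit_refl orbit_step nilpotents_scale)

lemma foldr_in_sweep: "foldr exp_ad ns x \<in> sweep ns x"
proof (induction ns)
  case (Cons n ns)
  then have "exp_ad (scale 1 n) (foldr exp_ad ns x) \<in> sweep (n # ns) x" unfolding sweep.simps by blast
  then show ?case by simp
qed simp

lemma sweep_append_right:
  "x \<in> L \<Longrightarrow> set ns \<subseteq> nilpotents \<Longrightarrow> set ms \<subseteq> nilpotents \<Longrightarrow> sweep ms x \<subseteq> sweep (ns @ ms) x"
proof (induction ns)
  case (Cons n ns)
  then have IH: "sweep ms x \<subseteq> sweep (ns @ ms) x" by simp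
  have "y \<in> sweep (n # ns @ ms) x" if "y \<in> sweep ms x" for y
  proof -
    have "y \<in> L" using sweep_subset_orbit[of x ms] orbit_subset[of x] Cons.prems that by blast
    then have "y = exp_ad (scale 0 n) y" using exp_ad_zero by simp
    then show ?thesis using IH that unfolding sweep.simps by blast
  qed
  then show ?case unfolding append_Cons by blast
qed simp

lemma sweep_append_left:
  "x \<in> L \<Longrightarrow> set ns \<subseteq> nilpotents \<Longrightarrow> set ms \<subseteq> nilpotents \<Longrightarrow> sweep ns x \<subseteq> sweep (ns @ ms) x"
proof (induction ns)
  case Nil
  then show ?case using sweep_append_right[of x ms "[]"] by simp
next
  case (Cons n ns)
  then have "sweep ns x \<subseteq> sweep (ns @ ms) x" by simp
  then show ?case by auto
qed

text \<open>Points reached by \<open>ns\<close> and by \<open>ms\<close> both lie in the sweep along \<open>ns @ ms\<close>: set the parameters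
  of the other list to 0.\<close>

lemma orbit_irreducible:
  assumes x: "x \<in> L"
  shows "irreducible_in zariski (adjoint_orbit x)"
proof (rule irreducible_if_pairs[OF orbit_subset[OF x]])
  show "adjoint_orbit x \<noteq> {}" using orbit_refl[OF x] by blast
  fix y z assume yz: "y \<in> adjoint_orbit x" "z \<in> adjoint_orbit x"
  obtain ns where ns: "set ns \<subseteq> nilpotents" "y = foldr exp_ad ns x" using orbit_foldr[OF x yz(1)] .
  obtain ms where ms: "set ms \<subseteq> nilpotents" "z = foldr exp_ad ms x" using orbit_foldr[OF x yz(2)] .
  have set: "set (ns @ ms) \<subseteq> nilpotents" using ns(1) ms(1) by simp
  have "y \<in> sweep (ns @ ms) x" "z \<in> sweep (ns @ ms) x"
    using foldr_in_sweep[of ns x] foldr_in_sweep[of ms x] ns(2) ms(2)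
      sweep_append_left[OF x ns(1) ms(1)] sweep_append_right[OF x ns(1) ms(1)] by auto
  then show "\<exists>T\<subseteq>adjoint_orbit x. irreducible_in zariski T \<and> y \<in> T \<and> z \<in> T"
    using sweep_irreducible[OF x set] sweep_subset_orbit[OF x set] by (intro exI[of _ "sweep (ns @ ms) x"] conjI)
qed

text \<open>The step of all lower bounds: a polynomial that vanishes on \<open>W\<close> but not on the sweep of \<open>W\<close>
  increases the dimension by one.\<close>

lemma chain_below_sweep:
  assumes x: "x \<in> L" and c: "chain_below (adjoint_orbit x) r W"
    and W: "irreducible_in zariski W" "W \<subseteq> adjoint_orbit x"
    and n: "n \<in> nilpotents" and p: "p \<in> poly_funs" "\<And>y. y \<in> W \<Longrightarrow> p y = 0"
    and y: "y \<in> W" "p (exp_ad (scale t n) y) \<noteq> 0"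
  shows "chain_below (adjoint_orbit x) (Suc r) {exp_ad (scale t n) y |t y. y \<in> W}"
proof (rule chain_below_Suc[OF c _ irreducible_exp_ad_sweep[OF W(1) n] _ orbit_subset[OF x] p])
  show "W \<subseteq> {exp_ad (scale t n) y |t y. y \<in> W}"
  proof
    fix y assume "y \<in> W"
    moreover from this have "y \<in> L" using W(2) orbit_subset[OF x] by blast
    then have "y = exp_ad (scale 0 n) y" using exp_ad_zero by simp
    ultimately show "y \<in> {exp_ad (scale t n) y |t y. y \<in> W}" by blast
  qed
  show "{exp_ad (scale t n) y |t y. y \<in> W} \<subseteq> adjoint_orbit x"
    using orbit_step[OF x _ nilpotents_scale[OF n]] W(2) by blast
  show "exp_ad (scale t n) y \<in> {exp_ad (scale t n) y |t y. y \<in> W}" using y(1) by blast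
  show "p (exp_ad (scale t n) y) \<noteq> 0" by (rule y(2))
qed

end


section \<open>The Lie algebra of traceless matrices\<close>

definition smat :: "'k::comm_ring_1 \<Rightarrow> 'k^4^4 \<Rightarrow> 'k^4^4" where
  "smat c M = (\<chi> i j. c * M $ i $ j)"

lemma smat_nth [simp]: "smat c M $ i $ j = c * M $ i $ j"
  by (simp add: smat_def)

lemma smat_simps:
  "smat c (A + B) = smat c A + smat c B" "smat (a + b) A = smat a A + smat b A"
  "smat c (A - B) = smat c A - smat c B" "smat a (smat b A) = smat (a * b) A"
  "smat 1 A = A" "smat 0 A = 0" "smat c 0 = 0" "smat c (- A) = - smat c A"
  by (simp_all add: vec_eq_iff algebra_simps)

lemma mul_nth: "(A ** B) $ i $ j = (\<Sum>k\<in>UNIV. A $ i $ k * B $ k $ j)"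
  by (simp add: matrix_matrix_mult_def)

lemma mul_smat: "smat c A ** B = smat c (A ** B)" "A ** smat c B = smat c (A ** B)"
  by (simp_all add: vec_eq_iff mul_nth sum_distrib_left ac_simps)

lemma mul_diff:
  fixes A B C :: "'k::comm_ring_1^4^4"
  shows "A ** (B - C) = A ** B - A ** C" "(B - C) ** A = B ** A - C ** A"
  by (simp_all add: vec_eq_iff mul_nth algebra_simps sum_subtractf)

lemma mul_minus:
  fixes A B :: "'k::comm_ring_1^4^4"
  shows "A ** (- B) = - (A ** B)" "(- A) ** B = - (A ** B)"
  by (simp_all add: vec_eq_iff mul_nth sum_negf)

lemma mul_zero [simp]:
  fixes A :: "'k::comm_ring_1^4^4"
  shows "A ** 0 = 0" "0 ** A = 0"
  by (simp_all add: vec_eq_iff mul_nth)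

lemma mul_add:
  fixes A B C :: "'k::comm_ring_1^4^4"
  shows "A ** (B + C) = A ** B + A ** C" "(B + C) ** A = B ** A + C ** A"
  by (simp_all add: vec_eq_iff mul_nth algebra_simps sum.distrib)

lemmas mul_simps = mul_add mul_diff mul_minus mul_smat matrix_mul_assoc

lemma trace_smat: "trace (smat c A) = c * trace A"
  by (simp add: trace_def sum_distrib_left)

lemma trace_one: "trace (mat 1 :: 'k::comm_ring_1^4^4) = 4"
  by (simp add: trace_def mat_def)

definition comm :: "'k::comm_ring_1^4^4 \<Rightarrow> 'k^4^4 \<Rightarrow> 'k^4^4" where
  "comm A B = A ** B - B ** A"

lemma comm_simps:
  "comm A (B + C) = comm A B + comm A C" "comm (A + B) C = comm A C + comm B C"
  "comm A (B - C) = comm A B - comm A C" "comm (A - B) C = comm A C - comm B C"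
  "comm (smat c A) B = smat c (comm A B)" "comm A (smat c B) = smat c (comm A B)"
  "comm A (mat 1) = 0" "comm (mat 1) A = 0" "comm A 0 = 0"
  by (simp_all add: comm_def mul_simps smat_simps algebra_simps)

lemma trace_comm: "trace (comm A B) = 0"
  by (simp add: comm_def trace_sub trace_mul_sym[of A B])

lemma comm_self: "comm A A = 0"
  by (simp add: comm_def)

lemma comm_jacobi: "comm A (comm B C) + comm B (comm C A) + comm C (comm A B) = 0"
  by (simp add: comm_def mul_simps algebra_simps)

text \<open>Matrices are handled as \<open>'k^4^4\<close>, where determinants, inverses and linear algebra are at hand,
  and are transported to infinite matrices along the bijection of the index type with
  \<open>{0, 1, 2, 3}\<close> in which the index 4, which equals 0 in its type, comes last.\<close>

definition index :: "4 \<Rightarrow> nat" where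
  "index i = (if i = 1 then 0 else if i = 2 then 1 else if i = 3 then 2 else 3)"

definition unindex :: "nat \<Rightarrow> 4" where
  "unindex n = (if n = 0 then 1 else if n = 1 then 2 else if n = 2 then 3 else 4)"

lemma index_less: "index i < 4" and unindex_index: "unindex (index i) = i"
  using exhaust_4[of i] by (auto simp: index_def unindex_def)

definition emb :: "'k::comm_ring_1^4^4 \<Rightarrow> nat \<Rightarrow> nat \<Rightarrow> 'k" where
  "emb M = (\<lambda>a b. if a < 4 \<and> b < 4 then M $ unindex a $ unindex b else 0)"

definition proj :: "(nat \<Rightarrow> nat \<Rightarrow> 'k::comm_ring_1) \<Rightarrow> 'k^4^4" where
  "proj A = (\<chi> i j. A (index i) (index j))"

lemma proj_emb [simp]: "proj (emb M) = M"
  by (simp add: proj_def emb_def vec_eq_iff index_less unindex_index)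

lemma emb_inject [simp]: "emb M = emb N \<longleftrightarrow> M = N"
  by (metis proj_emb)

lemma emb_add: "emb (M + N) = emb M + emb N"
  and emb_zero: "emb 0 = 0"
  by (auto simp: emb_def fun_eq_iff)

lemma emb_smat: "emb (smat c M) = matrix_scale c (emb M)"
  by (auto simp: emb_def fun_eq_iff matrix_scale_def)

lemma emb_sum: "emb (\<Sum>i\<in>I. f i) = (\<Sum>i\<in>I. emb (f i))"
  by (induction I rule: infinite_finite_induct) (simp_all add: emb_zero emb_add)

definition unit_mat :: "4 \<Rightarrow> 4 \<Rightarrow> 'k::comm_ring_1^4^4" where
  "unit_mat i j = (\<chi> k l. if k = i \<and> l = j then 1 else 0)"

lemma unit_mat_nth: "unit_mat i j $ k $ l = (if k = i \<and> l = j then 1 else 0)"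
  by (simp add: unit_mat_def)

lemma mat_sum_unit: "M = (\<Sum>i\<in>UNIV. \<Sum>j\<in>UNIV. smat (M $ i $ j) (unit_mat i j))"
  by (simp add: vec_eq_iff forall_4 sum_4 unit_mat_nth)

lemma mul_unit_mat:
  "(A ** unit_mat i j) $ k $ l = (if l = j then A $ k $ i else 0)"
  "(unit_mat i j ** A) $ k $ l = (if k = i then A $ j $ l else 0)"
  by (cases "l = j"; cases "k = i"; simp add: mul_nth unit_mat_nth if_distrib[of "\<lambda>x. x * _"] if_distrib[of "\<lambda>x. _ * x"] cong: if_cong)+

definition sl4 :: "(nat \<Rightarrow> nat \<Rightarrow> 'k::comm_ring_1) set" where
  "sl4 = emb ` {M. trace M = 0}"

definition brk :: "(nat \<Rightarrow> nat \<Rightarrow> 'k::comm_ring_1) \<Rightarrow> (nat \<Rightarrow> nat \<Rightarrow> 'k) \<Rightarrow> nat \<Rightarrow> nat \<Rightarrow> 'k" where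
  "brk A B = emb (comm (proj A) (proj B))"

lemma emb_in_sl4 [simp]: "emb M \<in> sl4 \<longleftrightarrow> trace M = 0"
  unfolding sl4_def by auto

lemma brk_emb: "brk (emb A) (emb B) = emb (comm A B)"
  by (simp add: brk_def)

lemma sl4_cases:
  assumes "x \<in> sl4"
  obtains M where "x = emb M" "trace M = 0"
  using assms unfolding sl4_def by blast

lemma lie_algebra_sl4: "lie_algebra (matrix_scale :: 'k::field_char_0 \<Rightarrow> _) sl4 brk"
proof -
  interpret V: vector_space "matrix_scale :: 'k \<Rightarrow> _" by (rule vector_space_matrix_scale)
  have sub: "V.subspace sl4"
    unfolding V.subspace_def
    by (auto elim!: sl4_cases simp: emb_add[symmetric] emb_smat[symmetric] emb_zero[symmetric]
        trace_add trace_smat simp del: emb_inject)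
       (simp add: trace_def)
  let ?U = "(\<lambda>(i, j). emb (unit_mat i j :: 'k^4^4)) ` UNIV"
  show ?thesis
  proof
    show "V.subspace sl4" by (rule sub)
    have "\<exists>B\<subseteq>sl4. finite B \<and> V.span B = sl4"
    proof -
      obtain B where B: "B \<subseteq> sl4" "V.independent B" "sl4 \<subseteq> V.span B"
        using V.basis_exists[of sl4] by metis
      have "emb M \<in> V.span ?U" for M :: "'k^4^4"
        by (subst mat_sum_unit, unfold emb_sum emb_smat,
            rule V.span_sum, rule V.span_sum, rule V.span_scale, rule V.span_base) auto
      then have "B \<subseteq> V.span ?U" using B(1) by (auto elim!: sl4_cases)
      then have "finite B" using V.independent_span_bound[of ?U B] B(2) by simp
      moreover have "V.span B = sl4" using B V.span_minimal[OF B(1) sub] by blast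
      ultimately show ?thesis using B(1) by blast
    qed
    then show "\<exists>B. finite B \<and> V.span B = sl4" by blast
  qed (auto elim!: sl4_cases simp: brk_emb emb_add[symmetric] emb_smat[symmetric] emb_zero[symmetric]
        trace_comm comm_simps comm_self comm_jacobi)
qed

interpretation sl4: lie_algebra "matrix_scale :: 'k::field_char_0 \<Rightarrow> _" sl4 brk
  by (rule lie_algebra_sl4)

abbreviation entries :: "('k::comm_ring_1^4^4 \<Rightarrow> 'k) set" where
  "entries \<equiv> {f. \<exists>i j. f = (\<lambda>M. M $ i $ j)}"

lemma entry_alg: "(\<lambda>M. M $ i $ j) \<in> alg entries"
  by (rule alg.gen) blast

lemma poly_emb:
  assumes "p \<in> sl4.poly_funs"
  shows "(\<lambda>M. p (emb M)) \<in> alg entries"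
  using assms
proof induction
  case (functional f)
  interpret f: Vector_Spaces.linear matrix_scale "(*)" f by (rule functional)
  have eq: "(\<lambda>M. f (emb M)) = (\<lambda>M. \<Sum>i\<in>UNIV. \<Sum>j\<in>UNIV. M $ i $ j * f (emb (unit_mat i j)))"
    by (rule ext, subst mat_sum_unit) (simp add: emb_sum emb_smat f.sum f.scale)
  show ?case unfolding eq by (intro alg_intros entry_alg)
qed (auto intro: alg_intros)

lemma poly_proj:
  assumes "q \<in> alg entries"
  shows "(\<lambda>A. q (proj A)) \<in> sl4.poly_funs"
  using assms
proof induction
  case (gen f)
  then obtain i j where f: "f = (\<lambda>M. M $ i $ j)" by (elim CollectE exE)
  have lin: "Vector_Spaces.linear matrix_scale (*) (\<lambda>A. A (index i) (index j) :: 'a)"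
    unfolding Vector_Spaces.linear_iff
    using vector_space_matrix_scale vector_space_over_itself.vector_space_axioms
    by (simp add: matrix_scale_def)
  have "(\<lambda>A. f (proj A)) = (\<lambda>A. A (index i) (index j))" by (simp add: f proj_def)
  then show ?case using sl4.poly_funs.functional[OF lin] by simp
qed (auto intro: sl4.poly_intros)


subsection \<open>Semisimplicity\<close>

context lie_algebra
begin

lemma br_swap: "x \<in> L \<Longrightarrow> y \<in> L \<Longrightarrow> br x y = - br y x"
proof -
  assume xy: "x \<in> L" "y \<in> L"
  then have "br (x + y) (x + y) = (br x x + br x y) + (br y x + br y y)"
    by (simp add: br_add_left br_add_right L_add ac_simps)
  then have "br (x + y) (x + y) = br x y + br y x" unfolding br_self[OF xy(1)] br_self[OF xy(2)] by simp
  moreover have "br (x + y) (x + y) = 0" using br_self L_add xy by blast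
  ultimately show ?thesis by (metis eq_neg_iff_add_eq_0)
qed

lemma lie_ideal_derived:
  assumes I: "lie_ideal I"
  shows "lie_ideal (derived I)"
proof -
  have sub: "subspace I" "I \<subseteq> L" and abs: "\<And>x y. x \<in> L \<Longrightarrow> y \<in> I \<Longrightarrow> br x y \<in> I"
    using I unfolding lie_ideal_def by auto
  let ?G = "{br x y |x y. x \<in> I \<and> y \<in> I}"
  have GL: "?G \<subseteq> L" using sub(2) br_closed by blast
  have DL: "derived I \<subseteq> L" unfolding derived_def using GL subspace_L by (rule span_minimal)
  have "br x y \<in> derived I" if x: "x \<in> L" and y: "y \<in> derived I" for x y
  proof -
    have "?G \<subseteq> {y \<in> L. br x y \<in> derived I}"
    proof clarify
      fix a b assume ab: "a \<in> I" "b \<in> I"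
      then have abL: "a \<in> L" "b \<in> L" using sub(2) by auto
      have neg: "- z \<in> I" if "z \<in> I" for z using subspace_neg[OF sub(1) that] .
      have "br b x \<in> I" using neg[OF abs[OF x ab(2)]] br_swap[OF abL(2) x] by simp
      moreover have "br x a \<in> I" by (rule abs[OF x ab(1)])
      ultimately have "br a (br b x) \<in> ?G" "br b (br x a) \<in> ?G" using ab by blast+
      then have "br a (br b x) \<in> derived I" "br b (br x a) \<in> derived I"
        unfolding derived_def by (auto intro: span_base)
      then have "- br a (br b x) - br b (br x a) \<in> derived I"
        unfolding derived_def by (intro span_diff span_neg)
      moreover have "br x (br a b) = - br a (br b x) - br b (br x a)"
        using jacobi[OF x abL] by (simp add: algebra_simps eq_neg_iff_add_eq_0)
      ultimately show "br a b \<in> L \<and> br x (br a b) \<in> derived I"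
        using br_closed[OF abL] by simp
    qed
    moreover have "subspace {y \<in> L. br x y \<in> derived I}"
      unfolding subspace_def derived_def
      using x by (auto simp: br_zero_right br_add_right br_scale_right L_zero L_add L_scale
          span_zero span_add span_scale)
    ultimately have "derived I \<subseteq> {y \<in> L. br x y \<in> derived I}"
      unfolding derived_def by (rule span_minimal)
    then show ?thesis using y by blast
  qed
  then show ?thesis using DL unfolding lie_ideal_def derived_def by (simp add: subspace_span)
qed

text \<open>The last nonzero term of the derived series of a solvable ideal is an abelian ideal.\<close>

lemma semisimple_if_no_abelian_ideal:
  assumes "\<And>J. lie_ideal J \<Longrightarrow> (\<And>x y. x \<in> J \<Longrightarrow> y \<in> J \<Longrightarrow> br x y = 0) \<Longrightarrow> J \<subseteq> {0}"
  shows semisimple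
  unfolding semisimple_def
proof clarify
  fix I assume I: "lie_ideal I" and sol: "solvable I"
  have zero: "{0} \<subseteq> J" if "lie_ideal J" for J
    using that subspace_0 unfolding lie_ideal_def by auto
  have ideals: "lie_ideal ((derived ^^ n) I)" for n
    by (induction n) (auto intro: I lie_ideal_derived)
  have "I = {0}" if "(derived ^^ n) I = {0}" for n
    using that
  proof (induction n)
    case (Suc n)
    have "br x y = 0" if "x \<in> (derived ^^ n) I" "y \<in> (derived ^^ n) I" for x y
    proof -
      have "br x y \<in> derived ((derived ^^ n) I)"
        using that unfolding derived_def[of "(derived ^^ n) I"] by (intro span_base) blast
      then show ?thesis using Suc.prems by simp
    qed
    then have "(derived ^^ n) I \<subseteq> {0}" by (rule assms[OF ideals])
    then show ?case using Suc.IH zero[OF ideals] by blast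
  qed simp
  then show "I = {0}" using sol unfolding solvable_def by blast
qed

end

text \<open>An element \<open>X\<close> of an abelian ideal satisfies \<open>[X, [X, Y]] = 0\<close> for all \<open>Y\<close>. With matrix units
  for \<open>Y\<close>, the entries of this equation give \<open>2 X\<^sub>k\<^sub>i\<^sup>2 = 0\<close> for \<open>k \<noteq> i\<close> and
  \<open>(X\<^sub>i\<^sub>i - X\<^sub>j\<^sub>j)\<^sup>2 = 0\<close>, so \<open>X\<close> is scalar, and zero because its trace is.\<close>

lemma double_comm_zero:
  fixes X :: "'k::field_char_0^4^4"
  assumes tr: "trace X = 0" and X: "\<And>Y. trace Y = 0 \<Longrightarrow> comm X (comm X Y) = 0"
  shows "X = 0"
proof -
  have all: "comm X (comm X Y) = 0" for Y
  proof -
    \<comment> \<open>scalars commute with everything, so the trace of \<open>Y\<close> does not matter\<close>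
    let ?Y = "Y - smat (trace Y / 4) (mat 1)"
    have "comm X (comm X ?Y) = 0" by (rule X) (simp add: trace_sub trace_smat trace_one)
    then show ?thesis by (simp add: comm_simps smat_simps)
  qed
  have e: "(if j = l then (X ** X) $ k $ i else 0) - 2 * (X $ k $ i * X $ j $ l)
    + (if k = i then (X ** X) $ j $ l else 0) = 0" for i j k l
  proof -
    have "comm X (comm X (unit_mat i j))
      = X ** X ** unit_mat i j - smat 2 (X ** unit_mat i j ** X) + unit_mat i j ** (X ** X)"
      by (simp add: comm_def mul_simps vec_eq_iff)
    then have "(X ** X ** unit_mat i j - smat 2 (X ** unit_mat i j ** X) + unit_mat i j ** (X ** X)) $ k $ l = 0"
      using all by simp
    moreover have "(X ** unit_mat i j ** X) $ k $ l = X $ k $ i * X $ j $ l"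
    proof -
      have "(X ** unit_mat i j ** X) $ k $ l = (\<Sum>m\<in>UNIV. (if m = j then X $ k $ i else 0) * X $ m $ l)"
        by (subst mul_nth) (simp add: mul_unit_mat)
      then show ?thesis by (simp add: if_distrib[of "\<lambda>x. x * _"] cong: if_cong)
    qed
    ultimately show ?thesis by (simp add: mul_unit_mat eq_commute[of l j])
  qed
  have off: "X $ k $ i = 0" if "k \<noteq> i" for k i
  proof (rule ccontr)
    assume "X $ k $ i \<noteq> 0"
    then have "X $ k $ i = 0" using e[where i = i and j = k and k = k and l = i] that by simp
    then show False using \<open>X $ k $ i \<noteq> 0\<close> by blast
  qed
  have "(X ** X) $ i $ i = X $ i $ i * X $ i $ i" for i
  proof -
    have "(X ** X) $ i $ i = (\<Sum>k\<in>UNIV. if k = i then X $ i $ i * X $ i $ i else 0)"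
      unfolding mul_nth using off by (intro sum.cong) auto
    then show ?thesis by simp
  qed
  then have "(X $ i $ i - X $ j $ j)\<^sup>2 = 0" for i j
    using e[where i = i and k = i and j = j and l = j] by (simp add: power2_eq_square algebra_simps)
  then have eq: "X $ i $ i = X $ j $ j" for i j by simp
  have "trace X = 4 * X $ i $ i" for i
    unfolding trace_def sum_4 using eq[of 1 i] eq[of 2 i] eq[of 3 i] eq[of 4 i] by simp
  then have "X $ i $ i = 0" for i using tr by simp
  then show ?thesis using off by (auto simp: vec_eq_iff) metis
qed

lemma semisimple_sl4: "semisimple_lie_algebra (matrix_scale :: 'k::field_char_0 \<Rightarrow> _) sl4 brk"
proof (intro semisimple_lie_algebra.intro lie_algebra_sl4 semisimple_lie_algebra_axioms.intro
    sl4.semisimple_if_no_abelian_ideal subsetI)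
  fix J and x :: "nat \<Rightarrow> nat \<Rightarrow> 'k"
  assume J: "sl4.lie_ideal J" and ab: "\<And>x y. x \<in> J \<Longrightarrow> y \<in> J \<Longrightarrow> brk x y = 0" and x: "x \<in> J"
  have "x \<in> sl4" using J x unfolding sl4.lie_ideal_def by blast
  then obtain X where X: "x = emb X" "trace X = 0" by (rule sl4_cases)
  have "comm X (comm X Y) = 0" if Y: "trace Y = 0" for Y
  proof -
    have "brk (emb Y) x \<in> J" using J x Y unfolding sl4.lie_ideal_def by simp
    from ab[OF x this] have "emb (comm X (comm Y X)) = emb 0"
      unfolding X(1) brk_emb emb_zero .
    then have "comm X (comm Y X) = 0" unfolding emb_inject .
    moreover have "comm X Y = smat (-1) (comm Y X)" by (simp add: comm_def vec_eq_iff)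
    ultimately show ?thesis by (simp add: comm_simps smat_simps)
  qed
  then have "X = 0" by (rule double_comm_zero[OF X(2)])
  then show "x \<in> {0}" using X(1) emb_zero by simp
qed


section \<open>The adjoint action on traceless matrices is conjugation\<close>

lemma alg_ident_self: "(\<lambda>t. t) \<in> alg {\<lambda>t. t}"
  by (rule alg.gen) simp

lemma alg_det:
  fixes A :: "'x \<Rightarrow> 'k::comm_ring_1^4^4"
  assumes "\<And>i j. (\<lambda>x. A x $ i $ j) \<in> alg G"
  shows "(\<lambda>x. det (A x)) \<in> alg G"
  unfolding det_def by (intro alg_intros assms)

lemma det_smat: "det (smat c A) = c ^ 4 * det A"
  by (simp add: det_def prod.distrib sum_distrib_left mult.left_commute)

text \<open>If \<open>det (N - t)\<close> had no root it would be a nonzero constant \<open>c\<close>, and then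
  \<open>det (1 - s N) = c s\<^sup>4\<close> would vanish at \<open>s = 0\<close>.\<close>

lemma eigenvalue_exists:
  fixes N :: "'k::{alg_closed_field, field_char_0}^4^4"
  shows "\<exists>l. det (N - smat l (mat 1)) = 0"
proof (rule ccontr)
  assume no: "\<not> ?thesis"
  have entry: "(\<lambda>t. (N - smat t (mat 1)) $ i $ j) \<in> alg {\<lambda>t. t}" for i j
    by (simp, intro alg_intros alg_ident_self)
  obtain p where p: "(\<lambda>t. det (N - smat t (mat 1))) = poly p"
    using alg_ident_poly[OF alg_det[OF entry]] by blast
  have "degree p = 0"
    using alg_closed_imp_poly_has_root[of p] no fun_cong[OF p] by fastforce
  then obtain c where c: "p = [:c:]" by (meson degree_eq_zeroE)
  then have c_det: "det (N - smat t (mat 1)) = c" for t using fun_cong[OF p, of t] by simp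
  have entry': "(\<lambda>s. (mat 1 - smat s N) $ i $ j) \<in> alg {\<lambda>t. t}" for i j
    by (simp, intro alg_intros alg_ident_self)
  have "(\<lambda>s. det (mat 1 - smat s N) - c * s ^ 4) \<in> alg {\<lambda>t. t}"
    by (intro alg_intros alg_det entry' alg_ident_self)
  moreover have "(det (mat 1 - smat s N) - c * s ^ 4) * s = 0" for s
  proof (cases "s = 0")
    case False
    then have "mat 1 - smat s N = smat (- s) (N - smat (inverse s) (mat 1))"
      by (simp add: vec_eq_iff algebra_simps)
    then show ?thesis using c_det[of "inverse s"] by (simp add: det_smat)
  qed simp
  ultimately have "det (mat 1 - smat 0 N) - c * 0 ^ 4 = 0"
    using alg_ident_mult_eq_0[OF _ alg_ident_self, of "\<lambda>s. det (mat 1 - smat s N) - c * s ^ 4"]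
    by (meson zero_neq_one)
  then show False by (simp add: smat_simps)
qed

lemma singular_kernel:
  fixes A :: "'k::field^4^4"
  assumes "det A = 0"
  obtains v where "v \<noteq> 0" "A *v v = 0"
proof -
  have "\<not> (\<exists>B. B ** A = mat 1)" using assms invertible_det_nz invertible_left_inverse by metis
  then show thesis using matrix_left_invertible_ker that by metis
qed

definition outer :: "'k::comm_ring_1^4 \<Rightarrow> 'k^4 \<Rightarrow> 'k^4^4" where
  "outer v w = (\<chi> i j. v $ i * w $ j)"

lemma outer_nth [simp]: "outer v w $ i $ j = v $ i * w $ j"
  by (simp add: outer_def)

lemma mul_outer:
  "A ** outer v w = outer (A *v v) w" "outer v w ** A = outer v (transpose A *v w)"
  by (simp_all add: vec_eq_iff mul_nth matrix_vector_mult_def transpose_def sum_distrib_left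
      sum_distrib_right ac_simps)

lemma outer_zero: "outer v 0 = 0" "outer 0 w = 0"
  by (simp_all add: vec_eq_iff)

lemma outer_eq_0: "outer v w = 0 \<Longrightarrow> w \<noteq> 0 \<Longrightarrow> v = (0 :: 'k::idom^4)"
  by (auto simp: vec_eq_iff)

definition mpow :: "'k::comm_ring_1^4^4 \<Rightarrow> nat \<Rightarrow> 'k^4^4" where
  "mpow m k = ((**) m ^^ k) (mat 1)"

lemma mpow_simps: "mpow m 0 = mat 1" "mpow m (Suc k) = m ** mpow m k"
  by (simp_all add: mpow_def)

lemma pascal_sum:
  fixes f :: "nat \<Rightarrow> nat \<Rightarrow> 'k::comm_ring_1"
  shows "(\<Sum>j\<le>k. of_nat (k choose j) * (f (Suc j) (k - j) + f j (Suc (k - j))))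
    = (\<Sum>j\<le>Suc k. of_nat (Suc k choose j) * f j (Suc k - j))"
proof -
  have "(\<Sum>j\<le>k. of_nat (k choose j) * f j (Suc (k - j)))
      = (\<Sum>j\<le>Suc k. of_nat (k choose j) * f j (Suc k - j))"
    by (simp add: Suc_diff_le binomial_eq_0)
  also have "\<dots> = f 0 (Suc k) + (\<Sum>j\<le>k. of_nat (k choose Suc j) * f (Suc j) (k - j))"
    by (subst sum.atMost_Suc_shift) simp
  finally show ?thesis
    by (subst sum.atMost_Suc_shift) (simp add: algebra_simps sum.distrib)
qed

lemma pascal_sum_mat:
  fixes f :: "nat \<Rightarrow> nat \<Rightarrow> 'k::comm_ring_1^4^4"
  shows "(\<Sum>j\<le>k. smat (of_nat (k choose j)) (f (Suc j) (k - j) + f j (Suc (k - j))))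
    = (\<Sum>j\<le>Suc k. smat (of_nat (Suc k choose j)) (f j (Suc k - j)))"
  using pascal_sum[of k "\<lambda>i j. f i j $ _ $ _"] by (simp add: vec_eq_iff)

lemma mul_sum:
  fixes A :: "'k::comm_ring_1^4^4"
  shows "A ** (\<Sum>i\<in>I. f i) = (\<Sum>i\<in>I. A ** f i)" "(\<Sum>i\<in>I. f i) ** A = (\<Sum>i\<in>I. f i ** A)"
  by (induction I rule: infinite_finite_induct) (simp_all add: mul_add)

lemma smat_sum: "smat c (\<Sum>i\<in>I. f i) = (\<Sum>i\<in>I. smat c (f i))"
  by (induction I rule: infinite_finite_induct) (simp_all add: smat_simps)

text \<open>Left multiplication by \<open>m\<close> is the sum of the commuting operators \<open>comm m\<close> and
  right multiplication by \<open>m\<close>, so this is the binomial theorem.\<close>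

lemma mpow_mul:
  fixes m M :: "'k::comm_ring_1^4^4"
  shows "mpow m k ** M = (\<Sum>j\<le>k. smat (of_nat (k choose j)) ((comm m ^^ j) M ** mpow m (k - j)))"
proof (induction k)
  case 0
  then show ?case by (simp add: mpow_simps smat_simps)
next
  case (Suc k)
  have step: "m ** (C ** P) = comm m C ** P + C ** (m ** P)" for C P :: "'k^4^4"
    by (simp add: comm_def mul_simps algebra_simps)
  have "mpow m (Suc k) ** M = m ** (mpow m k ** M)" by (simp add: mpow_simps matrix_mul_assoc)
  also have "\<dots> = (\<Sum>j\<le>k. smat (of_nat (k choose j))
      ((comm m ^^ Suc j) M ** mpow m (k - j) + (comm m ^^ j) M ** mpow m (Suc (k - j))))"
    unfolding Suc.IH mul_sum by (simp add: mul_smat step mpow_simps)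
  also have "\<dots> = (\<Sum>j\<le>Suc k. smat (of_nat (Suc k choose j)) ((comm m ^^ j) M ** mpow m (Suc k - j)))"
    by (rule pascal_sum_mat)
  finally show ?case .
qed

lemma comm_pow_zero: "(comm m ^^ j) 0 = 0"
  by (induction j) (auto simp: comm_simps)

lemma comm_pow_ge:
  assumes "(comm m ^^ K) M = 0" "K \<le> j"
  shows "(comm m ^^ j) M = 0"
proof -
  have "(comm m ^^ j) M = (comm m ^^ (j - K)) ((comm m ^^ K) M)"
    using funpow_add[of "j - K" K "comm m"] assms(2) by simp
  then show ?thesis by (simp add: assms(1) comm_pow_zero)
qed

lemma mpow_ge: "mpow m K = 0 \<Longrightarrow> K \<le> j \<Longrightarrow> mpow m j = 0"
  by (induction j) (auto simp: mpow_simps le_Suc_eq)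

text \<open>Dividing the binomial theorem by \<open>k!\<close> and summing over \<open>k\<close>: with \<open>E = exp m\<close>, conjugation by \<open>E\<close>
  is \<open>exp (ad m)\<close>. The series can be cut off at \<open>K + K\<close>, because in total degree \<open>K + K\<close>
  or more one of the two factors of each term of the product is zero.\<close>

lemma exp_intertwines:
  fixes m M :: "'k::field_char_0^4^4"
  assumes m: "mpow m K = 0" and M: "(comm m ^^ K) M = 0"
  defines "E \<equiv> \<Sum>l<K + K. smat (inverse (fact l)) (mpow m l)"
  shows "E ** M = (\<Sum>j<K + K. smat (inverse (fact j)) ((comm m ^^ j) M)) ** E"
proof -
  have "E ** M = (\<Sum>k<K + K. \<Sum>j\<le>k. smat (inverse (fact k) * of_nat (k choose j)) ((comm m ^^ j) M ** mpow m (k - j)))"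
    unfolding E_def mul_sum mul_smat mpow_mul smat_sum smat_simps ..
  also have "\<dots> = (\<Sum>k<K + K. \<Sum>j\<le>k. smat (inverse (fact j) * inverse (fact (k - j))) ((comm m ^^ j) M ** mpow m (k - j)))"
    by (intro sum.cong refl) (auto simp: binomial_fact field_simps)
  also have "\<dots> = (\<Sum>j<K + K. \<Sum>l<K + K. smat (inverse (fact j) * inverse (fact l)) ((comm m ^^ j) M ** mpow m l))"
  proof (rule sum_square_triangle[symmetric])
    fix i j assume "K + K \<le> i + j"
    then have "K \<le> i \<or> K \<le> j" by linarith
    then show "smat (inverse (fact i) * inverse (fact j)) ((comm m ^^ i) M ** mpow m j) = 0"
      using comm_pow_ge[OF M, of i] mpow_ge[OF m, of j] by (auto simp: smat_simps)
  qed
  also have "\<dots> = (\<Sum>j<K + K. smat (inverse (fact j)) ((comm m ^^ j) M)) ** E"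
    unfolding mul_sum(2)[of _ _ E] unfolding E_def mul_sum(1)
    by (simp add: mul_smat smat_simps mult.commute)
  finally show ?thesis .
qed

lemma comm_pow_emb: "(brk (emb N) ^^ i) (emb M) = emb ((comm N ^^ i) M)"
  by (induction i) (simp_all add: brk_emb)

text \<open>An ad-nilpotent matrix \<open>N\<close> is scalar plus nilpotent. Let \<open>l\<close> be an eigenvalue, \<open>m = N - l\<close> and
  \<open>w\<close> a left eigenvector, so \<open>w\<^sup>T m = 0\<close>. Then \<open>(ad m)\<^sup>j (u w\<^sup>T) = (m\<^sup>j u) w\<^sup>T\<close> for every \<open>u\<close>, so that
  nilpotency of \<open>ad m\<close> forces that of \<open>m\<close>.\<close>

lemma nilpotent_shift:
  fixes N :: "'k::{alg_closed_field, field_char_0}^4^4"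
  assumes N: "\<And>M. trace M = 0 \<Longrightarrow> (comm N ^^ K) M = 0"
  obtains l v where "mpow (N - smat l (mat 1)) (Suc K) = 0" "v \<noteq> 0" "(N - smat l (mat 1)) *v v = 0"
    "\<And>M. (comm (N - smat l (mat 1)) ^^ Suc K) M = 0"
proof -
  obtain l where l: "det (N - smat l (mat 1)) = 0" using eigenvalue_exists by blast
  define m where "m = N - smat l (mat 1)"
  obtain v where v: "v \<noteq> 0" "m *v v = 0" using singular_kernel l unfolding m_def by metis
  obtain w where w: "w \<noteq> 0" "transpose m *v w = 0"
    using singular_kernel[of "transpose m"] l unfolding m_def[symmetric] by (metis det_transpose)
  have comm_m: "comm m = comm N" by (auto simp: fun_eq_iff m_def comm_simps smat_simps)
  have comm0: "(comm m ^^ Suc K) M = 0" for M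
  proof -
    let ?M = "M - smat (trace M / 4) (mat 1)"
    have tr: "trace ?M = 0" by (simp add: trace_sub trace_smat trace_one)
    have "comm m ?M = comm m M" by (simp add: comm_simps smat_simps)
    then have "(comm m ^^ Suc K) M = (comm m ^^ Suc K) ?M" by (simp add: funpow_swap1)
    also have "\<dots> = comm m ((comm m ^^ K) ?M)" by simp
    also have "\<dots> = 0" unfolding comm_m N[OF tr] by (simp add: comm_simps)
    finally show ?thesis .
  qed
  have "(comm m ^^ j) (outer u w) = mpow m j ** outer u w" for j u
  proof (induction j)
    case 0 show ?case by (simp add: mpow_simps)
  next
    case (Suc j)
    have "mpow m j ** outer u w ** m = 0"
      unfolding mul_outer w(2) by (simp add: outer_zero)
    then show ?case using Suc by (simp add: mpow_simps comm_def matrix_mul_assoc)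
  qed
  then have "outer (mpow m (Suc K) *v u) w = 0" for u
    using comm0[of "outer u w"] by (simp add: mul_outer del: funpow.simps)
  then have "mpow m (Suc K) *v u = 0" for u using outer_eq_0 w(1) by blast
  then have "mpow m (Suc K) = 0" by (metis matrix_eq matrix_vector_mult_0)
  then show thesis using that v comm0 unfolding m_def by blast
qed

lemma matrix_inverse_if_injective:
  fixes E :: "'k::field^4^4"
  assumes "\<And>v. E *v v = 0 \<Longrightarrow> v = 0"
  obtains F where "E ** F = mat 1" "F ** E = mat 1"
  using assms matrix_left_invertible_ker[of E] matrix_left_right_inverse by metis

text \<open>By \<open>nilpotent_shift\<close> and \<open>exp_intertwines\<close> it remains to invert \<open>E\<close>. If \<open>E u = 0\<close> with \<open>u \<noteq> 0\<close>, then
  \<open>E A u = T A (E u) = 0\<close> for all \<open>A\<close>, so \<open>E = 0\<close>; but \<open>E\<close> fixes the kernel of \<open>m\<close>.\<close>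

lemma exp_ad_conj:
  fixes n :: "nat \<Rightarrow> nat \<Rightarrow> 'k::{alg_closed_field, field_char_0}"
  assumes "n \<in> sl4.nilpotents"
  obtains G H where "G ** H = mat 1" "H ** G = mat 1"
    "\<And>M. trace M = 0 \<Longrightarrow> sl4.exp_ad n (emb M) = emb (G ** M ** H)"
proof -
  obtain N where N: "n = emb N" "trace N = 0" using assms by (auto elim: sl4_cases)
  obtain K where "\<forall>z\<in>sl4. (brk n ^^ K) z = 0" using assms unfolding sl4.ad_nilpotent_def by blast
  then have K: "(comm N ^^ K) M = 0" if "trace M = 0" for M
    using that unfolding N(1) by (metis comm_pow_emb emb_in_sl4 emb_inject emb_zero)
  obtain l v where m: "mpow (N - smat l (mat 1)) (Suc K) = 0" and v: "v \<noteq> 0" "(N - smat l (mat 1)) *v v = 0"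
    and c: "\<And>M. (comm (N - smat l (mat 1)) ^^ Suc K) M = 0"
    using nilpotent_shift[OF K] by blast
  define m where "m = N - smat l (mat 1)"
  note m = m[folded m_def] and v = v[folded m_def] and c = c[folded m_def]
  define E where "E = (\<Sum>l<Suc K + Suc K. smat (inverse (fact l)) (mpow m l))"
  define T where "T M = (\<Sum>j<Suc K + Suc K. smat (inverse (fact j)) ((comm m ^^ j) M))" for M
  have ET: "E ** M = T M ** E" for M
    unfolding E_def T_def by (rule exp_intertwines[OF m c])
  have smat_vec: "smat a A *v u = a *s (A *v u)" for a and A :: "'k^4^4" and u
    by (simp add: vec_eq_iff matrix_vector_mult_def sum_distrib_left mult.assoc)
  have sum_vec: "(\<Sum>l\<in>I. f l) *v u = (\<Sum>l\<in>I. f l *v u)" for I and f :: "nat \<Rightarrow> 'k^4^4" and u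
    by (induction I rule: infinite_finite_induct) (simp_all add: matrix_vector_mult_add_rdistrib)
  have "mpow m j *v v = (if j = 0 then v else 0)" for j
    by (induction j) (auto simp: mpow_simps matrix_vector_mul_assoc[symmetric] v(2))
  then have "E *v v = (\<Sum>l<Suc K + Suc K. if l = 0 then v else 0)"
    unfolding E_def sum_vec smat_vec by (intro sum.cong) auto
  then have Ev: "E *v v = v" by simp
  have inj: "u = 0" if u: "E *v u = 0" for u
  proof (rule ccontr)
    assume "u \<noteq> 0"
    then obtain i where i: "u $ i \<noteq> 0" by (auto simp: vec_eq_iff)
    define A where "A = outer v (axis i (inverse (u $ i)))"
    have "A *v u = v"
      using i by (simp add: A_def vec_eq_iff matrix_vector_mult_def axis_def if_distrib[of "\<lambda>x. x * _"]
          if_distrib[of "\<lambda>x. _ * x"] cong: if_cong)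
    then have "E *v v = (E ** A) *v u" by (simp add: matrix_vector_mul_assoc[symmetric])
    also have "\<dots> = 0" unfolding ET by (simp add: matrix_vector_mul_assoc[symmetric] u)
    finally show False using Ev v(1) by simp
  qed
  obtain F where F: "E ** F = mat 1" "F ** E = mat 1" using matrix_inverse_if_injective[OF inj] .
  have "sl4.exp_ad n (emb M) = emb (E ** M ** F)" if M: "trace M = 0" for M
  proof -
    have comm_m: "comm m = comm N" by (auto simp: fun_eq_iff m_def comm_simps smat_simps)
    have z: "\<forall>z\<in>sl4. (brk (emb N) ^^ (Suc K + Suc K)) z = 0"
    proof
      fix z :: "nat \<Rightarrow> nat \<Rightarrow> 'k" assume "z \<in> sl4"
      then obtain Z where Z: "z = emb Z" by (rule sl4_cases)
      have "(comm N ^^ (Suc K + Suc K)) Z = 0"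
        using comm_pow_ge[OF c, of "Suc K + Suc K" Z] unfolding comm_m by (simp del: funpow.simps)
      then show "(brk (emb N) ^^ (Suc K + Suc K)) z = 0" unfolding Z comm_pow_emb by (simp only: emb_zero)
    qed
    have "sl4.exp_ad n (emb M) = emb (T M)"
      using sl4.exp_ad_sum[of "emb N" "emb M", OF _ _ z] N M
      unfolding T_def comm_m comm_pow_emb emb_sum emb_smat by simp
    also have "T M = T M ** E ** F" by (simp add: matrix_mul_assoc[symmetric] F)
    also have "\<dots> = E ** M ** F" by (simp add: ET)
    finally show ?thesis .
  qed
  then show thesis using that F by blast
qed

lemma trace_conj:
  fixes G :: "'k::comm_ring_1^4^4"
  assumes "H ** G = mat 1"
  shows "trace (G ** M ** H) = trace M"
  by (metis assms matrix_mul_assoc matrix_mul_lid trace_mul_sym)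

lemma orbit_conj:
  fixes M :: "'k::{alg_closed_field, field_char_0}^4^4"
  assumes M: "trace M = 0" and y: "y \<in> sl4.adjoint_orbit (emb M)"
  obtains G H where "G ** H = mat 1" "H ** G = mat 1" "y = emb (G ** M ** H)"
proof -
  have eM: "emb M \<in> sl4" using M by simp
  obtain ns where ns: "set ns \<subseteq> sl4.nilpotents" "y = foldr sl4.exp_ad ns (emb M)"
    using sl4.orbit_foldr[OF eM y] .
  have "\<exists>G H. G ** H = mat 1 \<and> H ** G = mat 1 \<and> foldr sl4.exp_ad ns (emb M) = emb (G ** M ** H)"
    using ns(1)
  proof (induction ns)
    case Nil
    show ?case by (intro exI[of _ "mat 1"]) simp
  next
    case (Cons n ns)
    then obtain G H where 1: "G ** H = mat 1" "H ** G = mat 1"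
      "foldr sl4.exp_ad ns (emb M) = emb (G ** M ** H)" by auto
    obtain G' H' where 2: "G' ** H' = mat 1" "H' ** G' = mat 1"
      "\<And>M. trace M = 0 \<Longrightarrow> sl4.exp_ad n (emb M) = emb (G' ** M ** H')"
      using exp_ad_conj[of n] Cons.prems by auto
    have "foldr sl4.exp_ad (n # ns) (emb M) = emb (G' ** (G ** M ** H) ** H')"
      using 1(3) 2(3)[of "G ** M ** H"] trace_conj[OF 1(2), of M] M by simp
    then have "foldr sl4.exp_ad (n # ns) (emb M) = emb ((G' ** G) ** M ** (H ** H'))"
      by (simp add: matrix_mul_assoc)
    moreover have "(G' ** G) ** (H ** H') = mat 1" "(H ** H') ** (G' ** G) = mat 1"
      by (metis 1(1,2) 2(1,2) matrix_mul_assoc matrix_mul_rid)+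
    ultimately show ?case by blast
  qed
  then show thesis using that ns(2) by blast
qed

text \<open>The one-parameter groups used for the lower bounds: for \<open>N\<^sup>2 = 0\<close> the exponential of \<open>ad N\<close> is
  quadratic in \<open>N\<close> and equals conjugation by \<open>1 + N\<close>, whose inverse is \<open>1 - N\<close>.\<close>

lemma square_zero_nilpotent:
  fixes N :: "'k::field_char_0^4^4"
  assumes "N ** N = 0" "trace N = 0"
  shows "emb N \<in> sl4.nilpotents"
    and "trace M = 0 \<Longrightarrow> sl4.exp_ad (emb N) (emb M) = emb ((mat 1 + N) ** M ** (mat 1 - N))"
proof -
  have 2: "comm N (comm N M) = smat (-2) (N ** M ** N)" for M
  proof -
    have "comm N (comm N M) = N ** N ** M - N ** M ** N - (N ** M ** N - M ** (N ** N))"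
      by (simp add: comm_def mul_simps algebra_simps)
    then show ?thesis using assms(1) by (simp add: vec_eq_iff)
  qed
  have 3: "comm N (comm N (comm N M)) = 0" for M
  proof -
    have "comm N (N ** M ** N) = N ** N ** M ** N - N ** M ** (N ** N)"
      by (simp add: comm_def mul_simps algebra_simps)
    then show ?thesis unfolding 2[of M] using assms(1) by (simp add: comm_simps smat_simps)
  qed
  have z: "\<forall>z\<in>sl4. (brk (emb N) ^^ 3) z = 0"
    by (auto elim!: sl4_cases simp: eval_nat_numeral brk_emb 3 emb_zero)
  then show "emb N \<in> sl4.nilpotents" using assms(2) unfolding sl4.ad_nilpotent_def by auto
  assume M: "trace M = 0"
  have "{..<(3::nat)} = {0, 1, 2}" by auto
  then have "sl4.exp_ad (emb N) (emb M) = emb (M + comm N M + smat (1/2) (comm N (comm N M)))"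
    using sl4.exp_ad_sum[of "emb N" "emb M", OF _ _ z] M assms(2)
    by (simp add: brk_emb emb_add emb_smat eval_nat_numeral add.assoc sl4.scale_one del: plus_fun_apply)
  also have "M + comm N M + smat (1/2) (comm N (comm N M)) = (mat 1 + N) ** M ** (mat 1 - N)"
    unfolding 2 by (simp add: comm_def mul_simps smat_simps) (simp add: vec_eq_iff)
  finally show "sl4.exp_ad (emb N) (emb M) = emb ((mat 1 + N) ** M ** (mat 1 - N))" .
qed


section \<open>Lower bounds for orbit dimensions\<close>

definition shear :: "4 \<Rightarrow> 4 \<Rightarrow> 'k::comm_ring_1 \<Rightarrow> 'k^4^4 \<Rightarrow> 'k^4^4" where
  "shear a b t M = (mat 1 + smat t (unit_mat a b)) ** M ** (mat 1 - smat t (unit_mat a b))"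

lemma unit_mul_mul_unit: "(unit_mat a b ** (M ** unit_mat a b)) $ i $ j = (if i = a \<and> j = b then M $ b $ a else 0)"
  by (simp add: mul_unit_mat)

lemma shear_nth:
  "shear a b t M $ i $ j = M $ i $ j + (if i = a then t * M $ b $ j else 0)
    - (if j = b then t * M $ i $ a else 0) - (if i = a \<and> j = b then t * t * M $ b $ a else 0)"
proof -
  have "shear a b t M = M + smat t (unit_mat a b ** M) - smat t (M ** unit_mat a b)
      - smat (t * t) (unit_mat a b ** (M ** unit_mat a b))"
    by (simp add: shear_def mul_simps smat_simps algebra_simps)
  then show ?thesis by (simp add: unit_mul_mul_unit mul_unit_mat)
qed

lemma shear_zero [simp]: "shear a b 0 M = M"
  by (simp add: shear_def smat_simps)

abbreviation orbit_dim :: "'k::{alg_closed_field, field_char_0}^4^4 \<Rightarrow> enat" where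
  "orbit_dim M \<equiv> krull_dim (subtopology sl4.zariski (sl4.adjoint_orbit (emb M)))"

text \<open>Each step conjugates the family by all elementary matrices \<open>1 + t E\<^sub>a\<^sub>b\<close>. The \<open>(i, j)\<close> entry is
  constant on the family before the step but not after it, so its dimension increases.\<close>

inductive family :: "'k::comm_ring_1^4^4 \<Rightarrow> nat \<Rightarrow> ('k^4^4) set \<Rightarrow> bool" for X where
  zero: "family X 0 {X}"
| Suc: "family X r V \<Longrightarrow> a \<noteq> b \<Longrightarrow> (\<And>M. M \<in> V \<Longrightarrow> M $ i $ j = c) \<Longrightarrow> M0 \<in> V \<Longrightarrow>
    shear a b t M0 $ i $ j \<noteq> c \<Longrightarrow> family X (Suc r) {shear a b t M |t M. M \<in> V}"

lemma trace_unit_mat: "a \<noteq> b \<Longrightarrow> trace (unit_mat a b) = 0"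
  by (auto simp: trace_def unit_mat_nth intro!: sum.neutral)

text \<open>The change of basis \<open>B\<close> allows \<open>X\<close> to be a normal form of the matrix whose orbit is considered:
  the unipotent elements \<open>1 + t B E\<^sub>a\<^sub>b B'\<close> lie in the adjoint group whatever \<open>B\<close> is.\<close>

lemma family_chain:
  fixes X :: "'k::{alg_closed_field, field_char_0}^4^4"
  assumes B: "B ** B' = mat 1" "B' ** B = mat 1" and X: "trace X = 0" and "family X r V"
  shows "(\<forall>M\<in>V. trace M = 0) \<and> irreducible_in sl4.zariski ((\<lambda>M. emb (B ** M ** B')) ` V) \<and>
    (\<lambda>M. emb (B ** M ** B')) ` V \<subseteq> sl4.adjoint_orbit (emb (B ** X ** B')) \<and>
    sl4.chain_below (sl4.adjoint_orbit (emb (B ** X ** B'))) r ((\<lambda>M. emb (B ** M ** B')) ` V)"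
  using assms(4)
proof induction
  have x: "emb (B ** X ** B') \<in> sl4" using trace_conj[OF B(2)] X by simp
  case zero
  have irr: "irreducible_in sl4.zariski {emb (B ** X ** B')}" by (rule sl4.irreducible_singleton[OF x])
  have sub: "{emb (B ** X ** B')} \<subseteq> sl4.adjoint_orbit (emb (B ** X ** B'))"
    using sl4.orbit_refl[OF x] by simp
  show ?case
    using X irr sub sl4.chain_below_0[OF irr sub sl4.orbit_subset[OF x]] by simp
next
  have x: "emb (B ** X ** B') \<in> sl4" using trace_conj[OF B(2)] X by simp
  case (Suc r V a b i j c M0 t)
  let ?C = "\<lambda>M. emb (B ** M ** B')" and ?V' = "{shear a b t M |t M. M \<in> V}"
  let ?O = "sl4.adjoint_orbit (emb (B ** X ** B'))"
  define n where "n = emb (B ** unit_mat a b ** B')"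
  have sq: "smat s (B ** unit_mat a b ** B') ** smat s (B ** unit_mat a b ** B') = 0"
    and tr: "trace (smat s (B ** unit_mat a b ** B')) = 0" for s
  proof -
    have "(B ** unit_mat a b ** B') ** (B ** unit_mat a b ** B') = B ** (unit_mat a b ** (B' ** B) ** unit_mat a b) ** B'"
      by (simp add: matrix_mul_assoc)
    also have "unit_mat a b ** (B' ** B) ** unit_mat a b = (0 :: 'k^4^4)"
      using Suc.hyps(2) by (simp add: B(2) vec_eq_iff mul_unit_mat unit_mat_nth)
    finally show "smat s (B ** unit_mat a b ** B') ** smat s (B ** unit_mat a b ** B') = 0"
      by (simp add: mul_smat smat_simps)
    show "trace (smat s (B ** unit_mat a b ** B')) = 0"
      using Suc.hyps(2) by (simp add: trace_smat trace_conj[OF B(2)] trace_unit_mat)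
  qed
  have n: "n \<in> sl4.nilpotents"
    unfolding n_def using square_zero_nilpotent(1)[OF sq[of 1] tr[of 1]] by (simp add: smat_simps)
  have step: "sl4.exp_ad (matrix_scale s n) (?C M) = ?C (shear a b s M)" if M: "M \<in> V" for s M
  proof -
    let ?N = "smat s (B ** unit_mat a b ** B')"
    have "trace (B ** M ** B') = 0" using Suc.IH M trace_conj[OF B(2), of M] by simp
    from square_zero_nilpotent(2)[OF sq tr this]
    have "sl4.exp_ad (matrix_scale s n) (?C M) = emb ((mat 1 + ?N) ** (B ** M ** B') ** (mat 1 - ?N))"
      unfolding n_def emb_smat .
    also have "mat 1 + ?N = B ** (mat 1 + smat s (unit_mat a b)) ** B'"
      by (simp add: mul_simps B)
    also have "mat 1 - ?N = B ** (mat 1 - smat s (unit_mat a b)) ** B'"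
      by (simp add: mul_simps B)
    also have "B ** (mat 1 + smat s (unit_mat a b)) ** B' ** (B ** M ** B') ** (B ** (mat 1 - smat s (unit_mat a b)) ** B')
      = B ** ((mat 1 + smat s (unit_mat a b)) ** (B' ** B) ** M ** (B' ** B) ** (mat 1 - smat s (unit_mat a b))) ** B'"
      by (simp only: matrix_mul_assoc)
    finally show ?thesis by (simp add: B(2) shear_def)
  qed
  have img: "?C ` ?V' = {sl4.exp_ad (matrix_scale s n) y |s y. y \<in> ?C ` V}"
  proof (intro equalityI subsetI)
    fix y assume "y \<in> ?C ` ?V'"
    then obtain s M where M: "M \<in> V" "y = ?C (shear a b s M)" by blast
    then have "y = sl4.exp_ad (matrix_scale s n) (?C M)" using step by simp
    then show "y \<in> {sl4.exp_ad (matrix_scale s n) y |s y. y \<in> ?C ` V}" using M(1) by blast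
  next
    fix y assume "y \<in> {sl4.exp_ad (matrix_scale s n) y |s y. y \<in> ?C ` V}"
    then obtain s M where M: "M \<in> V" "y = sl4.exp_ad (matrix_scale s n) (?C M)" by blast
    then have "y = ?C (shear a b s M)" using step by simp
    then show "y \<in> ?C ` ?V'" using M(1) by blast
  qed
  let ?p = "\<lambda>A. (B' ** proj A ** B) $ i $ j - c"
  have unconj: "B' ** (B ** M ** B') ** B = M" for M
  proof -
    have "B' ** (B ** M ** B') ** B = (B' ** B) ** M ** (B' ** B)" by (simp only: matrix_mul_assoc)
    then show ?thesis by (simp add: B)
  qed
  have p: "?p \<in> sl4.poly_funs"
  proof -
    have "(\<lambda>M. (B' ** M ** B) $ i $ j - c) \<in> alg entries"
      unfolding mul_nth by (intro alg_intros entry_alg)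
    then show ?thesis by (rule poly_proj)
  qed
  have irr: "irreducible_in sl4.zariski (?C ` V)" and sub: "?C ` V \<subseteq> ?O"
    and ch: "sl4.chain_below ?O r (?C ` V)" using Suc.IH by auto
  have p0: "?p y = 0" if "y \<in> ?C ` V" for y
    using that Suc.hyps(3) unconj by auto
  have p1: "?p (sl4.exp_ad (matrix_scale t n) (?C M0)) \<noteq> 0"
    using step[OF Suc.hyps(4)] unconj Suc.hyps(5) by simp
  have tr': "trace (shear a b s M) = 0" if "M \<in> V" for s M
  proof -
    have "?C M \<in> sl4" using sub that sl4.orbit_subset[OF x] by blast
    from sl4.exp_ad_closed[OF sl4.nilpotents_scale[OF n] this]
    have "trace (B ** shear a b s M ** B') = 0" unfolding step[OF that] by simp
    then show ?thesis by (simp add: trace_conj[OF B(2)])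
  qed
  have "?C M0 \<in> ?C ` V" using Suc.hyps(4) by (rule imageI)
  from sl4.chain_below_sweep[OF x ch irr sub n p p0 this p1]
  have ch': "sl4.chain_below ?O (Suc r) (?C ` ?V')" unfolding img .
  have irr': "irreducible_in sl4.zariski (?C ` ?V')"
    unfolding img by (rule sl4.irreducible_exp_ad_sweep[OF irr n])
  have sub': "?C ` ?V' \<subseteq> ?O"
    unfolding img using sl4.orbit_step[OF x _ sl4.nilpotents_scale[OF n]] sub by blast
  show ?case using tr' ch' irr' sub' by blast
qed

lemma family_orbit_dim:
  fixes X :: "'k::{alg_closed_field, field_char_0}^4^4"
  assumes "B ** B' = mat 1" "B' ** B = mat 1" "trace X = 0" "family X r V"
  shows "enat r \<le> orbit_dim (B ** X ** B')"
  using family_chain[OF assms] sl4.chain_below_krull_dim by blast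

text \<open>The invariant \<open>P\<close> proves that an entry is constant on a family, and the known members
  \<open>W\<close> provide a matrix at which the next step changes that entry.\<close>

definition reach :: "'k::comm_ring_1^4^4 \<Rightarrow> nat \<Rightarrow> ('k^4^4 \<Rightarrow> bool) \<Rightarrow> ('k^4^4) set \<Rightarrow> bool" where
  "reach X r P W \<longleftrightarrow> (\<exists>V. family X r V \<and> (\<forall>M\<in>V. P M) \<and> W \<subseteq> V)"

lemma reach_zero: "P X \<Longrightarrow> reach X 0 P {X}"
  unfolding reach_def using family.zero by blast

lemma reach_Suc:
  assumes "reach X r P W" "a \<noteq> b" "\<And>M. P M \<Longrightarrow> M $ i $ j = c" "M0 \<in> W" "shear a b t M0 $ i $ j \<noteq> c"
    and "\<And>M s. P M \<Longrightarrow> P' (shear a b s M)" "X \<in> W"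
  shows "reach X (Suc r) P' {shear a b 1 X, X}"
proof -
  obtain V where V: "family X r V" "\<forall>M\<in>V. P M" "W \<subseteq> V" using assms(1) unfolding reach_def by blast
  let ?V' = "{shear a b t M |t M. M \<in> V}"
  have "family X (Suc r) ?V'"
    by (rule family.Suc[OF V(1) assms(2) _ _ assms(5)]) (use V assms(3,4) in auto)
  moreover have "\<forall>M\<in>?V'. P' M" using V(2) assms(6) by blast
  moreover have "M \<in> ?V'" if "M \<in> V" for M
    using that shear_zero[of a b M] by (intro CollectI exI[of _ 0] exI[of _ M]) simp
  moreover have "shear a b 1 X \<in> ?V'" "X \<in> V" using V(3) assms(7) by blast+
  ultimately show ?thesis unfolding reach_def by (intro exI[of _ ?V']) blast
qed

lemma reach_orbit_dim:
  fixes X :: "'k::{alg_closed_field, field_char_0}^4^4"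
  assumes "B ** B' = mat 1" "B' ** B = mat 1" "trace X = 0" "reach X r P W"
  shows "enat r \<le> orbit_dim (B ** X ** B')"
  using assms(4) family_orbit_dim[OF assms(1-3)] unfolding reach_def by blast

text \<open>Here \<open>X e\<^sub>1 = e\<^sub>2\<close> and \<open>X e\<^sub>2 = e\<^sub>3\<close>. The first step moves only \<open>e\<^sub>4\<close>. The next four fix
  \<open>e\<^sub>1\<close> and \<open>e\<^sub>2\<close>, so they keep the first column \<open>e\<^sub>2\<close> and free the second one, which is the image of
  \<open>e\<^sub>3\<close>. The last four fix \<open>e\<^sub>1\<close> and free the first column, which is the image of \<open>e\<^sub>2\<close>.\<close>

lemma reach_cyclic:
  fixes X :: "'k::field_char_0^4^4"
  assumes X: "\<And>k. X $ k $ 1 = (if k = 2 then 1 else 0)" "\<And>k. X $ k $ 2 = (if k = 3 then 1 else 0)"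
  shows "\<exists>P W. reach X 9 P W"
proof -
  let ?c1 = "\<lambda>M::'k^4^4. M $ 1 $ 1 = 0 \<and> M $ 2 $ 1 = 1 \<and> M $ 3 $ 1 = 0 \<and> M $ 4 $ 1 = 0"
  have "reach X 0 (\<lambda>M. ?c1 M \<and> M $ 1 $ 2 = 0 \<and> M $ 2 $ 2 = 0 \<and> M $ 3 $ 2 = 1 \<and> M $ 4 $ 2 = 0
      \<and> M $ 2 $ 4 = X $ 2 $ 4) {X}"
    by (rule reach_zero) (simp add: X)
  from reach_Suc[OF this, of 1 4 2 4 "X $ 2 $ 4" X 1
      "\<lambda>M. ?c1 M \<and> M $ 1 $ 2 = 0 \<and> M $ 2 $ 2 = 0 \<and> M $ 3 $ 2 = 1 \<and> M $ 4 $ 2 = 0"]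
  have "reach X 1 (\<lambda>M. ?c1 M \<and> M $ 1 $ 2 = 0 \<and> M $ 2 $ 2 = 0 \<and> M $ 3 $ 2 = 1 \<and> M $ 4 $ 2 = 0) {shear 1 4 1 X, X}"
    by (simp add: shear_nth X)
  from reach_Suc[OF this, of 4 3 4 2 0 X 1
      "\<lambda>M. ?c1 M \<and> M $ 1 $ 2 = 0 \<and> M $ 2 $ 2 = 0 \<and> M $ 3 $ 2 = 1"]
  have "reach X 2 (\<lambda>M. ?c1 M \<and> M $ 1 $ 2 = 0 \<and> M $ 2 $ 2 = 0 \<and> M $ 3 $ 2 = 1) {shear 4 3 1 X, X}"
    by (simp add: shear_nth X eval_nat_numeral)
  from reach_Suc[OF this, of 3 4 3 2 1 "shear 4 3 1 X" 1 "\<lambda>M. ?c1 M \<and> M $ 1 $ 2 = 0 \<and> M $ 2 $ 2 = 0"]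
  have "reach X 3 (\<lambda>M. ?c1 M \<and> M $ 1 $ 2 = 0 \<and> M $ 2 $ 2 = 0) {shear 3 4 1 X, X}"
    by (simp add: shear_nth X eval_nat_numeral)
  from reach_Suc[OF this, of 1 3 1 2 0 X 1 "\<lambda>M. ?c1 M \<and> M $ 2 $ 2 = 0"]
  have "reach X 4 (\<lambda>M. ?c1 M \<and> M $ 2 $ 2 = 0) {shear 1 3 1 X, X}"
    by (simp add: shear_nth X eval_nat_numeral)
  from reach_Suc[OF this, of 2 3 2 2 0 X 1 ?c1]
  have "reach X 5 ?c1 {shear 2 3 1 X, X}"
    by (simp add: shear_nth X eval_nat_numeral)
  from reach_Suc[OF this, of 3 2 3 1 0 X 1 "\<lambda>M. M $ 1 $ 1 = 0 \<and> M $ 2 $ 1 = 1 \<and> M $ 4 $ 1 = 0"]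
  have "reach X 6 (\<lambda>M. M $ 1 $ 1 = 0 \<and> M $ 2 $ 1 = 1 \<and> M $ 4 $ 1 = 0) {shear 3 2 1 X, X}"
    by (simp add: shear_nth X eval_nat_numeral)
  from reach_Suc[OF this, of 2 3 2 1 1 "shear 3 2 1 X" 1 "\<lambda>M. M $ 1 $ 1 = 0 \<and> M $ 4 $ 1 = 0"]
  have "reach X 7 (\<lambda>M. M $ 1 $ 1 = 0 \<and> M $ 4 $ 1 = 0) {shear 2 3 1 X, X}"
    by (simp add: shear_nth X eval_nat_numeral)
  from reach_Suc[OF this, of 1 2 1 1 0 X 1 "\<lambda>M. M $ 4 $ 1 = 0"]
  have "reach X 8 (\<lambda>M. M $ 4 $ 1 = 0) {shear 1 2 1 X, X}"
    by (simp add: shear_nth X eval_nat_numeral)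
  from reach_Suc[OF this, of 4 2 4 1 0 X 1 "\<lambda>_. True"]
  show ?thesis by (simp add: shear_nth X eval_nat_numeral) blast
qed

text \<open>Here \<open>X = e\<^sub>1 w\<^sup>T + s\<close> with \<open>w = (u, 1, 1, 1)\<close>. The first three steps fix \<open>e\<^sub>1\<close> and move the last
  three coordinates of \<open>w\<close>; the others move \<open>e\<^sub>1\<close>.\<close>

lemma reach_rank_one:
  fixes X :: "'k::field_char_0^4^4"
  assumes X: "\<And>i j. X $ i $ j = (if i = 1 then if j = 1 then u else 1 else 0) + (if i = j then s else 0)"
  shows "\<exists>P W. reach X 6 P W"
proof -
  let ?r2 = "\<lambda>M::'k^4^4. M $ 2 $ 1 = 0 \<and> M $ 2 $ 2 = s \<and> M $ 2 $ 3 = 0 \<and> M $ 2 $ 4 = 0"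
  let ?r3 = "\<lambda>M::'k^4^4. M $ 3 $ 1 = 0 \<and> M $ 3 $ 2 = 0 \<and> M $ 3 $ 3 = s \<and> M $ 3 $ 4 = 0"
  let ?r4 = "\<lambda>M::'k^4^4. M $ 4 $ 1 = 0 \<and> M $ 4 $ 2 = 0 \<and> M $ 4 $ 3 = 0 \<and> M $ 4 $ 4 = s"
  \<comment> \<open>the entry of the first column that conjugation of \<open>X\<close> by \<open>1 + t E\<^sub>k\<^sub>1\<close> produces\<close>
  obtain t :: 'k where t: "t * u - t * t \<noteq> 0"
  proof (cases "u = 1")
    case True
    show thesis by (rule that[of 2]) (simp add: True)
  next
    case False
    show thesis by (rule that[of 1]) (simp add: False)
  qed
  have "reach X 0 (\<lambda>M. ?r2 M \<and> ?r3 M \<and> ?r4 M \<and> M $ 1 $ 2 = 1 \<and> M $ 1 $ 3 = 1 \<and> M $ 1 $ 4 = 1) {X}"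
    by (rule reach_zero) (simp add: X)
  from reach_Suc[OF this, of 2 3 1 3 1 X 1
      "\<lambda>M. ?r2 M \<and> ?r3 M \<and> ?r4 M \<and> M $ 1 $ 2 = 1 \<and> M $ 1 $ 4 = 1"]
  have "reach X 1 (\<lambda>M. ?r2 M \<and> ?r3 M \<and> ?r4 M \<and> M $ 1 $ 2 = 1 \<and> M $ 1 $ 4 = 1) {shear 2 3 1 X, X}"
    by (simp add: shear_nth X)
  from reach_Suc[OF this, of 3 2 1 2 1 X 1 "\<lambda>M. ?r2 M \<and> ?r3 M \<and> ?r4 M \<and> M $ 1 $ 4 = 1"]
  have "reach X 2 (\<lambda>M. ?r2 M \<and> ?r3 M \<and> ?r4 M \<and> M $ 1 $ 4 = 1) {shear 3 2 1 X, X}"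
    by (simp add: shear_nth X eval_nat_numeral)
  from reach_Suc[OF this, of 2 4 1 4 1 X 1 "\<lambda>M. ?r2 M \<and> ?r3 M \<and> ?r4 M"]
  have "reach X 3 (\<lambda>M. ?r2 M \<and> ?r3 M \<and> ?r4 M) {shear 2 4 1 X, X}"
    by (simp add: shear_nth X eval_nat_numeral)
  from reach_Suc[OF this, of 2 1 2 1 0 X t "\<lambda>M. ?r3 M \<and> ?r4 M"]
  have "reach X 4 (\<lambda>M. ?r3 M \<and> ?r4 M) {shear 2 1 1 X, X}"
    using t by (simp add: shear_nth X eval_nat_numeral algebra_simps)
  from reach_Suc[OF this, of 3 1 3 1 0 X t ?r4]
  have "reach X 5 ?r4 {shear 3 1 1 X, X}"
    using t by (simp add: shear_nth X eval_nat_numeral algebra_simps)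
  from reach_Suc[OF this, of 4 1 4 1 0 X t "\<lambda>_. True"]
  show ?thesis using t by (simp add: shear_nth X eval_nat_numeral algebra_simps) blast
qed

text \<open>Here \<open>X\<close> consists of two equal 2 by 2 blocks. The first four steps fix \<open>e\<^sub>1\<close> and \<open>e\<^sub>2\<close> and act on the
  third column; the other four fix \<open>e\<^sub>1\<close> and free the first column, which is \<open>l e\<^sub>1\<close> plus the
  image of \<open>e\<^sub>2\<close>.\<close>

lemma reach_two_blocks:
  fixes X :: "'k::field_char_0^4^4"
  assumes X: "\<And>k. X $ k $ 1 = (if k = 1 then l else if k = 2 then 1 else 0)"
    "\<And>k. X $ k $ 2 = (if k = 2 then d else 0)"
    "\<And>k. X $ k $ 3 = (if k = 3 then l else if k = 4 then 1 else 0)"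
    "\<And>k. X $ k $ 4 = (if k = 4 then d else 0)"
  shows "\<exists>P W. reach X 8 P W"
proof -
  let ?c1 = "\<lambda>M::'k^4^4. M $ 1 $ 1 = l \<and> M $ 2 $ 1 = 1 \<and> M $ 3 $ 1 = 0 \<and> M $ 4 $ 1 = 0"
  let ?r1 = "\<lambda>M::'k^4^4. M $ 1 $ 3 = 0 \<and> M $ 1 $ 4 = 0"
  let ?r2 = "\<lambda>M::'k^4^4. M $ 2 $ 3 = 0 \<and> M $ 2 $ 4 = 0"
  have "reach X 0 (\<lambda>M. ?c1 M \<and> ?r1 M \<and> ?r2 M \<and> M $ 4 $ 3 = 1 \<and> M $ 3 $ 3 = l) {X}"
    by (rule reach_zero) (simp add: X)
  from reach_Suc[OF this, of 3 4 3 3 l X 1 "\<lambda>M. ?c1 M \<and> ?r1 M \<and> ?r2 M \<and> M $ 4 $ 3 = 1"]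
  have "reach X 1 (\<lambda>M. ?c1 M \<and> ?r1 M \<and> ?r2 M \<and> M $ 4 $ 3 = 1) {shear 3 4 1 X, X}"
    by (simp add: shear_nth X)
  note 1 = reach_Suc[OF this, of 4 3 4 3 1 _ 1 "\<lambda>M. ?c1 M \<and> ?r1 M \<and> ?r2 M"]
  have "reach X 2 (\<lambda>M. ?c1 M \<and> ?r1 M \<and> ?r2 M) {shear 4 3 1 X, X}"
  proof (cases "d = l")
    \<comment> \<open>the step leaves this entry of \<open>X\<close> itself unchanged when the two eigenvalues agree\<close>
    case True
    then show ?thesis using 1[of "shear 3 4 1 X"] by (simp add: shear_nth X eval_nat_numeral)
  next
    case False
    then show ?thesis using 1[of X] by (simp add: shear_nth X eval_nat_numeral)
  qed
  from reach_Suc[OF this, of 1 4 1 3 0 X 1 "\<lambda>M. ?c1 M \<and> M $ 2 $ 3 = 0"]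
  have "reach X 3 (\<lambda>M. ?c1 M \<and> M $ 2 $ 3 = 0) {shear 1 4 1 X, X}"
    by (simp add: shear_nth X eval_nat_numeral)
  from reach_Suc[OF this, of 2 4 2 3 0 X 1 ?c1]
  have "reach X 4 ?c1 {shear 2 4 1 X, X}"
    by (simp add: shear_nth X eval_nat_numeral)
  from reach_Suc[OF this, of 3 2 3 1 0 X 1 "\<lambda>M. M $ 1 $ 1 = l \<and> M $ 2 $ 1 = 1 \<and> M $ 4 $ 1 = 0"]
  have "reach X 5 (\<lambda>M. M $ 1 $ 1 = l \<and> M $ 2 $ 1 = 1 \<and> M $ 4 $ 1 = 0) {shear 3 2 1 X, X}"
    by (simp add: shear_nth X eval_nat_numeral)
  from reach_Suc[OF this, of 2 3 2 1 1 "shear 3 2 1 X" 1 "\<lambda>M. M $ 1 $ 1 = l \<and> M $ 4 $ 1 = 0"]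
  have "reach X 6 (\<lambda>M. M $ 1 $ 1 = l \<and> M $ 4 $ 1 = 0) {shear 2 3 1 X, X}"
    by (simp add: shear_nth X eval_nat_numeral)
  from reach_Suc[OF this, of 1 2 1 1 l X 1 "\<lambda>M. M $ 4 $ 1 = 0"]
  have "reach X 7 (\<lambda>M. M $ 4 $ 1 = 0) {shear 1 2 1 X, X}"
    by (simp add: shear_nth X eval_nat_numeral)
  from reach_Suc[OF this, of 4 2 4 1 0 X 1 "\<lambda>_. True"]
  show ?thesis by (simp add: shear_nth X eval_nat_numeral) blast
qed


subsection \<open>Normal forms in adapted bases\<close>

lemma mul_axis: "(M *v axis j 1) $ k = (M :: 'k::comm_ring_1^4^4) $ k $ j"
  by (simp add: matrix_vector_mult_def axis_def if_distrib cong: if_cong)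

lemma smat_one_vec: "smat l (mat 1) *v x = l *s (x :: 'k::comm_ring_1^4)"
  by (simp add: vec_eq_iff matrix_vector_mult_def mat_def if_distrib if_distribR cong: if_cong)

lemma outer_vec: "outer v w *v x = (\<Sum>i\<in>UNIV. w $ i * x $ i) *s (v :: 'k::comm_ring_1^4)"
  by (simp add: vec_eq_iff matrix_vector_mult_def sum_distrib_left sum_distrib_right ac_simps)

lemma mat_vec_scale: "A *v (c *s x) = c *s (A *v (x :: 'k::comm_ring_1^4) :: 'k^4)"
  by (simp add: vec_eq_iff matrix_vector_mult_def sum_distrib_left ac_simps)

lemma span3_iff: "x \<in> vec.span {a, b, c} \<longleftrightarrow> (\<exists>r s t. x = r *s a + s *s b + t *s (c :: 'k::field^4))"
proof
  assume "x \<in> vec.span {a, b, c}"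
  then obtain r s t where "x - r *s a - s *s b = t *s c"
    unfolding vec.span_insert[of a] vec.span_insert[of b] vec.span_singleton by auto
  then have "x = r *s a + s *s b + t *s c" by (simp add: algebra_simps)
  then show "\<exists>r s t. x = r *s a + s *s b + t *s c" by blast
next
  assume "\<exists>r s t. x = r *s a + s *s b + t *s c"
  then show "x \<in> vec.span {a, b, c}"
    by (auto intro!: vec.span_add vec.span_scale intro: vec.span_base)
qed

lemma span2_iff: "x \<in> vec.span {a, b} \<longleftrightarrow> (\<exists>r s. x = r *s a + s *s (b :: 'k::field^4))"
proof
  assume "x \<in> vec.span {a, b}"
  then obtain r s where "x - r *s a = s *s b"
    unfolding vec.span_insert[of a] vec.span_singleton by auto
  then have "x = r *s a + s *s b" by (simp add: algebra_simps)
  then show "\<exists>r s. x = r *s a + s *s b" by blast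
next
  assume "\<exists>r s. x = r *s a + s *s b"
  then show "x \<in> vec.span {a, b}"
    by (auto intro!: vec.span_add vec.span_scale intro: vec.span_base)
qed

lemma span1_iff: "x \<in> vec.span {a} \<longleftrightarrow> (\<exists>r. x = r *s (a :: 'k::field^4))"
  unfolding vec.span_singleton by auto

definition adapted :: "'k::field^4 \<Rightarrow> 'k^4 \<Rightarrow> 'k^4 \<Rightarrow> 'k^4 \<Rightarrow> 'k^4^4 \<Rightarrow> 'k^4^4 \<Rightarrow> bool" where
  "adapted b1 b2 b3 b4 B B' \<longleftrightarrow> B ** B' = mat 1 \<and> B' ** B = mat 1 \<and>
    B *v axis 1 1 = b1 \<and> B *v axis 2 1 = b2 \<and> B *v axis 3 1 = b3 \<and> B *v axis 4 1 = b4"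

lemma adapted_exists:
  fixes b1 b2 b3 b4 :: "'k::field^4"
  assumes "b1 \<noteq> 0" "b2 \<notin> vec.span {b1}" "b3 \<notin> vec.span {b1, b2}" "b4 \<notin> vec.span {b1, b2, b3}"
  obtains B B' where "adapted b1 b2 b3 b4 B B'"
proof -
  define B :: "'k^4^4" where "B = (\<chi> k j. if j = 1 then b1 $ k else if j = 2 then b2 $ k else if j = 3 then b3 $ k else b4 $ k)"
  have Bv: "B *v x = x $ 1 *s b1 + x $ 2 *s b2 + x $ 3 *s b3 + x $ 4 *s b4" for x
    by (simp add: vec_eq_iff matrix_vector_mult_def sum_4 B_def ac_simps)
  have solve: "y = (- inverse c) *s z" if "z + c *s y = 0" "c \<noteq> 0" for y z :: "'k^4" and c
  proof -
    have "c *s y = - z" using that(1) by (simp add: eq_neg_iff_add_eq_0 add.commute)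
    then have "inverse c *s (c *s y) = inverse c *s (- z)" by simp
    then show ?thesis using that(2) by (simp add: vec_eq_iff)
  qed
  have "x = 0" if x: "B *v x = 0" for x
  proof -
    have 4: "x $ 4 = 0"
    proof (rule ccontr)
      assume "x $ 4 \<noteq> 0"
      from solve[OF x[unfolded Bv] this]
      have "b4 = (- inverse (x $ 4) * x $ 1) *s b1 + (- inverse (x $ 4) * x $ 2) *s b2 + (- inverse (x $ 4) * x $ 3) *s b3"
        by (simp add: vec_eq_iff algebra_simps)
      then show False using assms(4) span3_iff by blast
    qed
    have 3: "x $ 3 = 0"
    proof (rule ccontr)
      assume 3: "x $ 3 \<noteq> 0"
      have "x $ 1 *s b1 + x $ 2 *s b2 + x $ 3 *s b3 = 0" using x 4 unfolding Bv by simp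
      from solve[OF this 3] have "b3 = (- inverse (x $ 3) * x $ 1) *s b1 + (- inverse (x $ 3) * x $ 2) *s b2"
        by (simp add: vec_eq_iff algebra_simps)
      then show False using assms(3) span2_iff by blast
    qed
    have 2: "x $ 2 = 0"
    proof (rule ccontr)
      assume 2: "x $ 2 \<noteq> 0"
      have "x $ 1 *s b1 + x $ 2 *s b2 = 0" using x 4 3 unfolding Bv by simp
      from solve[OF this 2] have "b2 = (- inverse (x $ 2) * x $ 1) *s b1"
        by (simp add: vec_eq_iff algebra_simps)
      then show False using assms(2) span1_iff by blast
    qed
    have "x $ 1 = 0" using x assms(1) unfolding Bv by (simp add: 2 3 4)
    then show ?thesis using 2 3 4 by (simp add: vec_eq_iff forall_4)
  qed
  then obtain B' where "B ** B' = mat 1" "B' ** B = mat 1" by (rule matrix_inverse_if_injective)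
  moreover have "B *v axis 1 1 = b1" "B *v axis 2 1 = b2" "B *v axis 3 1 = b3" "B *v axis 4 1 = b4"
    unfolding Bv by (simp_all add: axis_def)
  ultimately show thesis using that unfolding adapted_def by blast
qed

lemma adapted_inverse:
  assumes "adapted b1 b2 b3 b4 B B'"
  shows "B' *v b1 = axis 1 1" "B' *v b2 = axis 2 1" "B' *v b3 = axis 3 1" "B' *v b4 = axis 4 1"
proof -
  have "B' *v (B *v x) = x" for x using assms by (simp add: adapted_def matrix_vector_mul_assoc)
  then show "B' *v b1 = axis 1 1" "B' *v b2 = axis 2 1" "B' *v b3 = axis 3 1" "B' *v b4 = axis 4 1"
    using assms unfolding adapted_def by metis+
qed

lemma adapted_column:
  fixes M :: "'k::field^4^4"
  assumes "adapted b1 b2 b3 b4 B B'"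
  shows "(B' ** M ** B) $ k $ 1 = (B' *v (M *v b1)) $ k" "(B' ** M ** B) $ k $ 2 = (B' *v (M *v b2)) $ k"
    "(B' ** M ** B) $ k $ 3 = (B' *v (M *v b3)) $ k" "(B' ** M ** B) $ k $ 4 = (B' *v (M *v b4)) $ k"
proof -
  have "(B' ** M ** B) $ k $ j = (B' *v (M *v (B *v axis j 1))) $ k" for j
    by (simp add: mul_axis[symmetric] matrix_vector_mul_assoc matrix_mul_assoc)
  then show "(B' ** M ** B) $ k $ 1 = (B' *v (M *v b1)) $ k" "(B' ** M ** B) $ k $ 2 = (B' *v (M *v b2)) $ k"
    "(B' ** M ** B) $ k $ 3 = (B' *v (M *v b3)) $ k" "(B' ** M ** B) $ k $ 4 = (B' *v (M *v b4)) $ k"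
    using assms unfolding adapted_def by simp_all
qed

lemma reach_adapted:
  fixes M :: "'k::{alg_closed_field, field_char_0}^4^4"
  assumes "adapted b1 b2 b3 b4 B B'" "trace M = 0" "reach (B' ** M ** B) r P W"
  shows "enat r \<le> orbit_dim M"
proof -
  have B: "B ** B' = mat 1" "B' ** B = mat 1" using assms(1) by (auto simp: adapted_def)
  have "B ** (B' ** M ** B) ** B' = (B ** B') ** M ** (B ** B')" by (simp only: matrix_mul_assoc)
  then show ?thesis
    using reach_orbit_dim[OF B _ assms(3)] trace_conj[OF B(1), of M] assms(2) B by simp
qed

text \<open>An affine hyperplane \<open>w \<cdot> b = 1\<close> spans the whole space, so it is not contained in a proper
  subspace. The normalization is what brings the row vector in \<open>reach_rank_one\<close> to the form
  \<open>(u, 1, 1, 1)\<close>.\<close>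

lemma exists_outside:
  fixes S :: "('k::field^4) set"
  assumes "finite S" "card S < 4" "w \<noteq> 0"
  obtains b where "b \<notin> vec.span S" "(\<Sum>i\<in>UNIV. w $ i * b $ i) = 1"
proof -
  let ?w = "\<lambda>b. \<Sum>i\<in>UNIV. w $ i * b $ i"
  have less: "vec.dim (vec.span S) < 4" using vec.dim_le_card'[OF assms(1)] assms(2) by simp
  have "vec.span S \<noteq> UNIV"
  proof
    assume "vec.span S = UNIV"
    then have "vec.dim (vec.span S) = CARD(4)" using vec_dim_card[where 'n = 4 and 'a = 'k] by metis
    then show False using less by simp
  qed
  then obtain x where x: "x \<notin> vec.span S" by blast
  obtain i where "w $ i \<noteq> 0" using assms(3) by (auto simp: vec_eq_iff)
  then have u: "?w (axis i (inverse (w $ i))) = 1"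
    by (simp add: axis_def if_distrib cong: if_cong)
  define u where "u = axis i (inverse (w $ i))"
  have wu: "?w u = 1" using u by (simp add: u_def)
  show thesis
  proof (cases "u \<in> vec.span S")
    case False
    then show thesis using that wu by blast
  next
    case True
    let ?b = "x - (?w x - 1) *s u"
    have "?w (x - c *s y) = ?w x - c * ?w y" for c y
      by (simp add: right_diff_distrib sum_subtractf sum_distrib_left ac_simps)
    then have "?w ?b = ?w x - (?w x - 1) * ?w u" by blast
    then have "?w ?b = 1" using wu by simp
    moreover have "?b \<notin> vec.span S"
    proof
      assume "?b \<in> vec.span S"
      then have "?b + (?w x - 1) *s u \<in> vec.span S"
        by (intro vec.span_add vec.span_scale True)
      then show False using x by simp
    qed
    ultimately show thesis using that by blast
  qed
qed

lemma orbit_dim_cyclic: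
  fixes X :: "'k::{alg_closed_field, field_char_0}^4^4"
  assumes "trace X = 0" "v \<noteq> 0" "X *v v \<notin> vec.span {v}" "X *v (X *v v) \<notin> vec.span {v, X *v v}"
  shows "9 \<le> orbit_dim X"
proof -
  have "card {v, X *v v, X *v (X *v v)} < 4"
    using card_length[of "[v, X *v v, X *v (X *v v)]"] by simp
  then obtain b where "b \<notin> vec.span {v, X *v v, X *v (X *v v)}"
    using exists_outside[of "{v, X *v v, X *v (X *v v)}" "axis 1 1"] by (auto simp: axis_eq_0_iff)
  then obtain B B' where ad: "adapted v (X *v v) (X *v (X *v v)) b B B'"
    using adapted_exists[OF assms(2-4)] by blast
  obtain P W where "reach (B' ** X ** B) 9 P W"
    using reach_cyclic[of "B' ** X ** B"] adapted_column[OF ad] adapted_inverse[OF ad]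
    by (auto simp: axis_def)
  from reach_adapted[OF ad assms(1) this] show ?thesis by (simp add: numeral_eq_enat)
qed

lemma orbit_dim_two_blocks:
  fixes N :: "'k::{alg_closed_field, field_char_0}^4^4"
  assumes sq: "N ** N = smat b N" and tr: "trace (N + smat l (mat 1)) = 0"
    and v: "v \<noteq> 0" "N *v v \<notin> vec.span {v}" and u: "u \<notin> vec.span {v, N *v v}"
    "N *v u \<notin> vec.span {v, N *v v, u}"
  shows "8 \<le> orbit_dim (N + smat l (mat 1))"
proof -
  let ?X = "N + smat l (mat 1)"
  obtain B B' where ad: "adapted v (N *v v) u (N *v u) B B'"
    using adapted_exists[OF v u] by blast
  have NN: "N *v (N *v x) = b *s (N *v x)" for x
  proof -
    have "N *v (N *v x) = smat b N *v x" by (simp add: matrix_vector_mul_assoc sq)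
    then show ?thesis by (simp add: vec_eq_iff matrix_vector_mult_def sum_distrib_left mult.assoc)
  qed
  have "\<exists>P W. reach (B' ** ?X ** B) 8 P W"
    by (rule reach_two_blocks[where l = l and d = "b + l"])
      (simp_all add: adapted_column[OF ad] matrix_vector_mult_add_rdistrib smat_one_vec
        NN matrix_vector_right_distrib mat_vec_scale adapted_inverse[OF ad] axis_def algebra_simps)
  then show ?thesis using reach_adapted[OF ad tr] by (auto simp: numeral_eq_enat)
qed

lemma orbit_dim_rank_one_ge:
  fixes v w :: "'k::{alg_closed_field, field_char_0}^4"
  assumes tr: "trace (outer v w + smat s (mat 1)) = 0" and vw: "v \<noteq> 0" "w \<noteq> 0"
  shows "6 \<le> orbit_dim (outer v w + smat s (mat 1))"
proof -
  let ?X = "outer v w + smat s (mat 1)" and ?w = "\<lambda>b. \<Sum>i\<in>UNIV. w $ i * b $ i"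
  obtain b2 where b2: "b2 \<notin> vec.span {v}" "?w b2 = 1" using exists_outside[OF _ _ vw(2), of "{v}"] by auto
  have "card {v, b2} < 4" using card_length[of "[v, b2]"] by simp
  then obtain b3 where b3: "b3 \<notin> vec.span {v, b2}" "?w b3 = 1"
    using exists_outside[OF _ _ vw(2), of "{v, b2}"] by auto
  have "card {v, b2, b3} < 4" using card_length[of "[v, b2, b3]"] by simp
  then obtain b4 where b4: "b4 \<notin> vec.span {v, b2, b3}" "?w b4 = 1"
    using exists_outside[OF _ _ vw(2), of "{v, b2, b3}"] by auto
  obtain B B' where ad: "adapted v b2 b3 b4 B B'"
    using adapted_exists[OF vw(1) b2(1) b3(1) b4(1)] by blast
  have Xv: "?X *v x = ?w x *s v + s *s x" for x
    by (simp add: matrix_vector_mult_add_rdistrib smat_one_vec outer_vec)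
  have "(B' ** ?X ** B) $ i $ j = (if i = 1 then if j = 1 then ?w v else 1 else 0) + (if i = j then s else 0)" for i j
    using exhaust_4[of j]
    by (elim disjE; simp add: adapted_column[OF ad] Xv matrix_vector_right_distrib mat_vec_scale
        adapted_inverse[OF ad] b2(2) b3(2) b4(2) axis_def; auto)
  then have "\<exists>P W. reach (B' ** ?X ** B) 6 P W" by (rule reach_rank_one)
  then show ?thesis using reach_adapted[OF ad tr] by (auto simp: numeral_eq_enat)
qed


section \<open>Upper bounds for orbit dimensions\<close>

text \<open>Since orbits consist of conjugates, it suffices to parametrize the conjugates of \<open>M\<close> on which a
  single polynomial \<open>d\<close> does not vanish.\<close>

lemma orbit_dim_le_parameters:
  fixes M :: "'k::{alg_closed_field, field_char_0}^4^4" and F :: "('i \<Rightarrow> 'k) \<Rightarrow> 'k^4^4"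
  assumes tr: "trace M = 0" and I: "finite I"
    and F: "\<And>i j. (\<lambda>t. F t $ i $ j) \<in> alg ((\<lambda>i t. t i) ` I)"
    and d: "d \<in> alg entries" "d M \<noteq> 0"
    and onto: "\<And>G H. G ** H = mat 1 \<Longrightarrow> H ** G = mat 1 \<Longrightarrow> d (G ** M ** H) \<noteq> 0 \<Longrightarrow> G ** M ** H \<in> range F"
  shows "orbit_dim M \<le> enat (card I)"
proof (rule sl4.krull_dim_le_parameters[where \<phi> = "\<lambda>t. emb (F t)" and \<delta> = "\<lambda>A. d (proj A)"])
  have M: "emb M \<in> sl4" using tr by simp
  show "irreducible_in sl4.zariski (sl4.adjoint_orbit (emb M))" by (rule sl4.orbit_irreducible[OF M])
  show "emb M \<in> sl4.adjoint_orbit (emb M)" by (rule sl4.orbit_refl[OF M])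
  show "(\<lambda>t. p (emb (F t))) \<in> alg ((\<lambda>i t. t i) ` I)" if "p \<in> sl4.poly_funs" for p
    by (rule alg_subst[OF poly_emb[OF that]]) (use F in auto)
  show "(\<lambda>A. d (proj A)) \<in> sl4.poly_funs" by (rule poly_proj[OF d(1)])
  show "d (proj (emb M)) \<noteq> 0" using d(2) by simp
  fix y assume y: "y \<in> sl4.adjoint_orbit (emb M)" "d (proj y) \<noteq> 0"
  obtain G H where GH: "G ** H = mat 1" "H ** G = mat 1" "y = emb (G ** M ** H)"
    using orbit_conj[OF tr y(1)] .
  then obtain t where "G ** M ** H = F t" using onto[OF GH(1,2)] y(2) by auto
  then show "y \<in> range (\<lambda>t. emb (F t))" using GH(3) by auto
qed (rule I)

lemma alg_coord: "i \<in> I \<Longrightarrow> (\<lambda>t. t i) \<in> alg ((\<lambda>i t. t i) ` I)"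
  by (rule alg.gen) blast

lemma trace_outer: "trace (outer v w) = (\<Sum>i\<in>UNIV. v $ i * w $ i)"
  by (simp add: trace_def)

lemma conj_outer: "G ** outer v w ** H = outer (G *v v) (transpose H *v w)"
  by (simp add: mul_outer)

lemma conj_scalar:
  fixes G :: "'k::comm_ring_1^4^4"
  assumes "G ** H = mat 1"
  shows "G ** smat s (mat 1) ** H = smat s (mat 1)"
  using assms by (simp add: mul_smat)

text \<open>Conjugates are \<open>v' w'\<^sup>T + s\<close> with \<open>v' \<cdot> w' = - 4 s\<close>. Where \<open>v'\<^sub>i \<noteq> 0\<close>, the vectors can be rescaled to
  \<open>v'\<^sub>i = 1\<close>, and then \<open>w'\<^sub>i\<close> is determined by the remaining six coordinates.\<close>

lemma orbit_dim_rank_one_le: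
  fixes v w :: "'k::{alg_closed_field, field_char_0}^4"
  assumes tr: "trace (outer v w + smat s (mat 1)) = 0" and vw: "v \<noteq> 0" "w \<noteq> 0"
  shows "orbit_dim (outer v w + smat s (mat 1)) \<le> 6"
proof -
  obtain i where i: "v $ i \<noteq> 0" using vw(1) by (auto simp: vec_eq_iff)
  obtain j where j: "w $ j \<noteq> 0" using vw(2) by (auto simp: vec_eq_iff)
  let ?X = "outer v w + smat s (mat 1)"
  let ?I = "(UNIV - {i}) <+> (UNIV - {i})"
  define vv where "vv t l = (if l = i then 1 else t (Inl l))" for t :: "4 + 4 \<Rightarrow> 'k" and l
  define ww where "ww t l = (if l = i then - (4 * s) - (\<Sum>m\<in>UNIV - {i}. t (Inr m) * t (Inl m)) else t (Inr l))"
    for t :: "4 + 4 \<Rightarrow> 'k" and l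
  define F where "F t = outer (\<chi> l. vv t l) (\<chi> l. ww t l) + smat s (mat 1)" for t
  have card: "card ?I = 6" by (simp add: card_Plus)
  have "orbit_dim ?X \<le> enat (card ?I)"
  proof (rule orbit_dim_le_parameters[where F = F and d = "\<lambda>Y. Y $ i $ j - (smat s (mat 1)) $ i $ j"])
    show "trace ?X = 0" by (rule tr)
    show "finite ?I" by simp
    have coords: "(\<lambda>t. t (Inl l)) \<in> alg ((\<lambda>i t. t i) ` ?I)" "(\<lambda>t. t (Inr l)) \<in> alg ((\<lambda>i t. t i) ` ?I)"
      if "l \<noteq> i" for l
      using that by (auto intro: alg_coord)
    have vv: "(\<lambda>t. vv t l) \<in> alg ((\<lambda>i t. t i) ` ?I)" for l
      unfolding vv_def using coords(1)[of l] by (cases "l = i") (simp_all add: alg.const)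
    have "(\<lambda>t. - (4 * s) - (\<Sum>m\<in>UNIV - {i}. t (Inr m) * t (Inl m))) \<in> alg ((\<lambda>i t. t i) ` ?I)"
      by (intro alg_intros coords) auto
    then have ww: "(\<lambda>t. ww t l) \<in> alg ((\<lambda>i t. t i) ` ?I)" for l
      unfolding ww_def using coords(2)[of l] by (cases "l = i") simp_all
    show "(\<lambda>t. F t $ k $ l) \<in> alg ((\<lambda>i t. t i) ` ?I)" for k l
      unfolding F_def by (simp, intro alg_intros vv ww)
    show "(\<lambda>Y. Y $ i $ j - smat s (mat 1) $ i $ j) \<in> alg entries"
      by (intro alg_intros entry_alg)
    show "?X $ i $ j - smat s (mat 1) $ i $ j \<noteq> 0" using i j by simp
    fix G H :: "'k^4^4"
    assume GH: "G ** H = mat 1" "H ** G = mat 1" "(G ** ?X ** H) $ i $ j - smat s (mat 1) $ i $ j \<noteq> 0"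
    define v' w' where "v' = G *v v" and "w' = transpose H *v w"
    have Y: "G ** ?X ** H = outer v' w' + smat s (mat 1)"
      unfolding v'_def w'_def mul_add conj_outer conj_scalar[OF GH(1)] ..
    have v'i: "v' $ i \<noteq> 0" using GH(3) unfolding Y by auto
    have "trace (outer v' w' + smat s (mat 1)) = 0"
      using trace_conj[OF GH(2), of ?X] tr unfolding Y by simp
    then have dot: "(\<Sum>m\<in>UNIV. v' $ m * w' $ m) = - (4 * s)"
      by (simp add: trace_add trace_smat trace_one trace_outer eq_neg_iff_add_eq_0 mult.commute)
    define t :: "4 + 4 \<Rightarrow> 'k" where "t = case_sum (\<lambda>l. v' $ l / v' $ i) (\<lambda>l. v' $ i * w' $ l)"
    have "vv t l = v' $ l / v' $ i" for l using v'i by (simp add: vv_def t_def)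
    moreover have "ww t l = v' $ i * w' $ l" for l
    proof (cases "l = i")
      case True
      have "(\<Sum>m\<in>UNIV - {i}. t (Inr m) * t (Inl m)) = (\<Sum>m\<in>UNIV - {i}. v' $ m * w' $ m)"
        using v'i by (intro sum.cong) (auto simp: t_def)
      also have "\<dots> = - (4 * s) - v' $ i * w' $ i"
        using sum.remove[of UNIV i "\<lambda>m. v' $ m * w' $ m"] dot by simp
      finally show ?thesis using True by (simp add: ww_def)
    qed (simp add: ww_def t_def)
    ultimately have "F t = outer v' w' + smat s (mat 1)"
      using v'i by (simp add: F_def vec_eq_iff)
    then show "G ** ?X ** H \<in> range F" unfolding Y by (metis rangeI)
  qed
  then show ?thesis unfolding card by (simp add: numeral_eq_enat)
qed

lemma orbit_dim_zero: "orbit_dim (0 :: 'k::{alg_closed_field, field_char_0}^4^4) = 0"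
proof -
  have "orbit_dim (0 :: 'k^4^4) \<le> enat (card ({} :: nat set))"
  proof (rule orbit_dim_le_parameters[where F = "\<lambda>_. 0" and d = "\<lambda>_. 1"])
    show "trace (0 :: 'k^4^4) = 0" by (simp add: trace_def)
    show "(\<lambda>_. 1) \<in> alg entries" by (rule alg.const)
    show "(\<lambda>t. (0 :: 'k^4^4) $ i $ j) \<in> alg ((\<lambda>i t. t i) ` {})" for i j by (rule alg.const)
  qed auto
  then show ?thesis by (simp add: zero_enat_def[symmetric])
qed

text \<open>For \<open>a \<noteq> 0\<close> this is conjugate to \<open>diag(a, a, -a, -a)\<close>, and for \<open>a = 0\<close> it is a nilpotent matrix
  unit.\<close>

definition gamma :: "'k::comm_ring_1 \<Rightarrow> 'k^4^4" where
  "gamma a = (\<chi> i j. if i = j then if i = 1 \<or> i = 2 then a else - a else if i = 1 \<and> j = 4 then 1 else 0)"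

lemma gamma_nth: "gamma a $ i $ j = (if i = j then if i = 1 \<or> i = 2 then a else - a else if i = 1 \<and> j = 4 then 1 else 0)"
  by (simp add: gamma_def)

lemma trace_gamma: "trace (gamma a) = 0"
  by (simp add: trace_def sum_4 gamma_nth)

lemma dot_conj:
  fixes G H :: "'k::comm_ring_1^4^4"
  assumes "H ** G = mat 1"
  shows "(\<Sum>i\<in>UNIV. (transpose H *v r) $ i * (G *v u) $ i) = (\<Sum>i\<in>UNIV. r $ i * u $ i)"
proof -
  have "(\<Sum>i\<in>UNIV. (transpose H *v r) $ i * (G *v u) $ i) = trace (outer (G *v u) (transpose H *v r))"
    by (simp add: trace_outer mult.commute)
  also have "\<dots> = trace (outer u r)"
    unfolding conj_outer[symmetric] by (rule trace_conj[OF assms])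
  finally show ?thesis by (simp add: trace_outer mult.commute)
qed

text \<open>An idempotent of rank 2 whose leading 2 by 2 block is invertible factors uniquely
  as the product of a 4 by 2 matrix with blocks \<open>1, M\<close> and a 2 by 4 matrix with blocks
  \<open>1 - N M, N\<close>, where \<open>M, N\<close> are arbitrary 2 by 2 matrices.\<close>

definition idem_param :: "(4 \<times> 4 \<Rightarrow> 'k::comm_ring_1) \<Rightarrow> 4 \<Rightarrow> 4 \<Rightarrow> 'k" where
  "idem_param t k j = (if j = 1 \<or> j = 2 then (if k = j then 1 else 0) - t (k, 3) * t (3, j) - t (k, 4) * t (4, j)
     else t (k, j))"

definition idem_mat :: "(4 \<times> 4 \<Rightarrow> 'k::comm_ring_1) \<Rightarrow> 'k^4^4" where
  "idem_mat t = (\<chi> i j. if i = 1 \<or> i = 2 then idem_param t i j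
     else t (i, 1) * idem_param t 1 j + t (i, 2) * idem_param t 2 j)"

lemma idem_mat_onto:
  fixes u1 u2 w1 w2 :: "'k::field^4"
  assumes dots: "(\<Sum>i\<in>UNIV. w1 $ i * u1 $ i) = 1" "(\<Sum>i\<in>UNIV. w1 $ i * u2 $ i) = 0"
    "(\<Sum>i\<in>UNIV. w2 $ i * u1 $ i) = 0" "(\<Sum>i\<in>UNIV. w2 $ i * u2 $ i) = 1"
    and D: "u1 $ 1 * u2 $ 2 - u1 $ 2 * u2 $ 1 \<noteq> 0"
  shows "outer u1 w1 + outer u2 w2 \<in> range idem_mat"
proof -
  let ?P = "outer u1 w1 + outer u2 w2"
  define D where "D = u1 $ 1 * u2 $ 2 - u1 $ 2 * u2 $ 1"
  have D0: "D \<noteq> 0" using D by (simp add: D_def)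
  define m1 where "m1 i = (u1 $ i * u2 $ 2 - u2 $ i * u1 $ 2) / D" for i
  define m2 where "m2 i = (u2 $ i * u1 $ 1 - u1 $ i * u2 $ 1) / D" for i
  define t where "t = (\<lambda>(i, j). if i = 1 \<or> i = 2 then ?P $ i $ j else if j = 1 then m1 i else m2 i)"
  have Pu: "(\<Sum>l\<in>UNIV. ?P $ k $ l * u1 $ l) = u1 $ k" "(\<Sum>l\<in>UNIV. ?P $ k $ l * u2 $ l) = u2 $ k" for k
  proof -
    have "(\<Sum>l\<in>UNIV. ?P $ k $ l * x $ l) = u1 $ k * (\<Sum>l\<in>UNIV. w1 $ l * x $ l) + u2 $ k * (\<Sum>l\<in>UNIV. w2 $ l * x $ l)" for x
      by (simp add: algebra_simps sum.distrib sum_distrib_left)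
    then show "(\<Sum>l\<in>UNIV. ?P $ k $ l * u1 $ l) = u1 $ k" "(\<Sum>l\<in>UNIV. ?P $ k $ l * u2 $ l) = u2 $ k"
      using dots by simp_all
  qed
  have m: "m1 1 = 1" "m1 2 = 0" "m2 1 = 0" "m2 2 = 1"
    using D0 by (simp_all add: m1_def m2_def D_def field_simps)
  have lin: "(\<Sum>l\<in>UNIV. ?P $ k $ l * ((a * u1 $ l - b * u2 $ l) / D)) = (a * u1 $ k - b * u2 $ k) / D" for k a b
  proof -
    have "(\<Sum>l\<in>UNIV. ?P $ k $ l * ((a * u1 $ l - b * u2 $ l) / D))
        = (a * (\<Sum>l\<in>UNIV. ?P $ k $ l * u1 $ l) - b * (\<Sum>l\<in>UNIV. ?P $ k $ l * u2 $ l)) / D"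
      unfolding sum_distrib_left sum_subtractf[symmetric] sum_divide_distrib
      by (intro sum.cong) (auto simp: algebra_simps add_divide_distrib diff_divide_distrib)
    then show ?thesis unfolding Pu .
  qed
  \<comment> \<open>\<open>m1\<close> and \<open>m2\<close> are the basis of the image of the idempotent whose top block is the identity\<close>
  have Pm1: "(\<Sum>l\<in>UNIV. ?P $ k $ l * m1 l) = m1 k" for k
    using lin[of k "u2 $ 2" "u1 $ 2"] by (simp add: m1_def mult.commute)
  have Pm2: "(\<Sum>l\<in>UNIV. ?P $ k $ l * m2 l) = m2 k" for k
    using lin[of k "- (u2 $ 1)" "- (u1 $ 1)"] by (simp add: m2_def mult.commute add.commute)
  have top: "idem_param t k j = ?P $ k $ j" if k: "k = 1 \<or> k = 2" for k j
  proof -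
    have "?P $ k $ 1 = (if k = 1 then 1 else 0) - ?P $ k $ 3 * m1 3 - ?P $ k $ 4 * m1 4"
      using Pm1[of k] k unfolding sum_4 m by (auto simp: m algebra_simps simp del: plus_vec_def outer_nth vector_add_component)
    moreover have "?P $ k $ 2 = (if k = 2 then 1 else 0) - ?P $ k $ 3 * m2 3 - ?P $ k $ 4 * m2 4"
      using Pm2[of k] k unfolding sum_4 m by (auto simp: m algebra_simps simp del: plus_vec_def outer_nth vector_add_component)
    ultimately show ?thesis
      using k exhaust_4[of j] by (auto simp: idem_param_def t_def simp del: outer_nth vector_add_component)
  qed
  have bottom: "?P $ i $ j = m1 i * ?P $ 1 $ j + m2 i * ?P $ 2 $ j" for i j
  proof -
    have "D * ?P $ i $ j = (D * m1 i) * ?P $ 1 $ j + (D * m2 i) * ?P $ 2 $ j"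
      using D0 by (simp add: m1_def m2_def) (simp add: D_def algebra_simps)
    also have "\<dots> = D * (m1 i * ?P $ 1 $ j + m2 i * ?P $ 2 $ j)" by (simp add: algebra_simps)
    finally show ?thesis using D0 by simp
  qed
  have "idem_mat t = ?P"
  proof (simp only: vec_eq_iff, intro allI)
    fix i j
    show "idem_mat t $ i $ j = ?P $ i $ j"
    proof (cases "i = 1 \<or> i = 2")
      case True
      then show ?thesis using top[OF True] by (simp add: idem_mat_def del: outer_nth vector_add_component)
    next
      case False
      then have "t (i, 1) = m1 i" "t (i, 2) = m2 i" by (simp_all add: t_def)
      then have "idem_mat t $ i $ j = m1 i * ?P $ 1 $ j + m2 i * ?P $ 2 $ j"
        using False by (simp add: idem_mat_def top del: outer_nth vector_add_component)
      also have "\<dots> = ?P $ i $ j" by (rule bottom[symmetric])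
      finally show ?thesis .
    qed
  qed
  then show ?thesis by (metis rangeI)
qed

text \<open>\<open>gamma a + a\<close> is \<open>2 a\<close> times an idempotent of rank 2, and the orbit is parametrized by the blocks \<open>M, N\<close>
  of \<open>idem_mat\<close>.\<close>

lemma orbit_dim_gamma_le:
  fixes a :: "'k::{alg_closed_field, field_char_0}"
  assumes a: "a \<noteq> 0"
  shows "orbit_dim (gamma a) \<le> 8"
proof -
  define I :: "(4 \<times> 4) set"
    where "I = {(3, 1), (3, 2), (4, 1), (4, 2), (1, 3), (1, 4), (2, 3), (2, 4)}"
  have in_I: "(3, 1) \<in> I" "(3, 2) \<in> I" "(4, 1) \<in> I" "(4, 2) \<in> I"
    "(1, 3) \<in> I" "(1, 4) \<in> I" "(2, 3) \<in> I" "(2, 4) \<in> I"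
    by (simp_all add: I_def)
  define r :: "'k^4" where "r = (\<chi> i. if i = 1 then 1 else if i = 4 then 1 / (2 * a) else 0)"
  let ?e1 = "axis 1 1 :: 'k^4" and ?e2 = "axis 2 1 :: 'k^4"
  have gamma: "gamma a = smat (2 * a) (outer ?e1 r + outer ?e2 ?e2) - smat a (mat 1)"
    using a by (simp add: vec_eq_iff forall_4 gamma_nth axis_def r_def mat_def)
  let ?d = "\<lambda>Y :: 'k^4^4. (Y $ 1 $ 1 + a) * (Y $ 2 $ 2 + a) - Y $ 1 $ 2 * Y $ 2 $ 1"
  have "orbit_dim (gamma a) \<le> enat (card I)"
  proof (rule orbit_dim_le_parameters[where F = "\<lambda>t. smat (2 * a) (idem_mat t) - smat a (mat 1)" and d = ?d])
    show "trace (gamma a) = 0" by (rule trace_gamma)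
    show "finite I" by (simp add: I_def)
    have "(\<lambda>t. idem_param t k j :: 'k) \<in> alg ((\<lambda>i t. t i) ` I)" if "k = 1 \<or> k = 2" for k j
      using that exhaust_4[of j] unfolding idem_param_def
      by (auto intro!: alg_intros alg_coord simp: in_I)
    then show "(\<lambda>t. (smat (2 * a) (idem_mat t) - smat a (mat 1)) $ i $ j) \<in> alg ((\<lambda>i t. t i) ` I)" for i j
      using exhaust_4[of i] unfolding idem_mat_def
      by (auto intro!: alg_intros alg_coord simp: in_I)
    show "?d \<in> alg entries" by (intro alg_intros entry_alg)
    show "?d (gamma a) \<noteq> 0" using a by (simp add: gamma_nth)
    fix G H :: "'k^4^4"
    assume GH: "G ** H = mat 1" "H ** G = mat 1" and d: "?d (G ** gamma a ** H) \<noteq> 0"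
    define u1 u2 w1 w2 where "u1 = G *v ?e1" and "u2 = G *v ?e2"
      and "w1 = transpose H *v r" and "w2 = transpose H *v ?e2"
    let ?P = "outer u1 w1 + outer u2 w2"
    have Y: "G ** gamma a ** H = smat (2 * a) ?P - smat a (mat 1)"
      unfolding gamma u1_def u2_def w1_def w2_def mul_diff mul_smat mul_add conj_outer[symmetric]
      using GH(1) by simp
    have "?d (G ** gamma a ** H)
      = (4 * a * a) * (u1 $ 1 * u2 $ 2 - u1 $ 2 * u2 $ 1) * (w1 $ 1 * w2 $ 2 - w1 $ 2 * w2 $ 1)"
      unfolding Y by (simp add: mat_def algebra_simps)
    then have "u1 $ 1 * u2 $ 2 - u1 $ 2 * u2 $ 1 \<noteq> 0" using d by auto
    moreover have "(\<Sum>i\<in>UNIV. w1 $ i * u1 $ i) = 1" "(\<Sum>i\<in>UNIV. w1 $ i * u2 $ i) = 0"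
      "(\<Sum>i\<in>UNIV. w2 $ i * u1 $ i) = 0" "(\<Sum>i\<in>UNIV. w2 $ i * u2 $ i) = 1"
      unfolding u1_def u2_def w1_def w2_def dot_conj[OF GH(2)] by (simp_all add: sum_4 axis_def r_def)
    ultimately obtain t where "?P = idem_mat t" using idem_mat_onto by blast
    then show "G ** gamma a ** H \<in> range (\<lambda>t. smat (2 * a) (idem_mat t) - smat a (mat 1))"
      unfolding Y by (intro image_eqI[of _ _ t]) simp_all
  qed
  also have "enat (card I) = 8" by (simp add: I_def numeral_eq_enat)
  finally show ?thesis .
qed


section \<open>Classification by orbit dimension\<close>

text \<open>Modulo \<open>W\<close>, if \<open>F v\<close> is a multiple of \<open>G v\<close> for each \<open>v\<close>, the factor does not depend on \<open>v\<close>. When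
  \<open>G v\<close> and \<open>G v\<^sub>0\<close> are independent, compare the factors at \<open>v\<close>, \<open>v\<^sub>0\<close> and \<open>v + v\<^sub>0\<close>; otherwise
  subtract the multiple of \<open>v\<^sub>0\<close> that makes \<open>G v\<close> vanish.\<close>

lemma pointwise_multiple_mod:
  fixes F G :: "'k::field^4^4"
  assumes W: "vec.subspace W" and pt: "\<And>v. \<exists>c. F *v v - c *s (G *v v) \<in> W"
  shows "\<exists>c. \<forall>v. F *v v - c *s (G *v v) \<in> W"
proof (cases "\<forall>v. G *v v \<in> W")
  case True
  have "F *v v - 0 *s (G *v v) \<in> W" for v
  proof -
    obtain c where "F *v v - c *s (G *v v) \<in> W" using pt by blast
    then have "(F *v v - c *s (G *v v)) + c *s (G *v v) \<in> W"
      using True by (intro vec.subspace_add[OF W] vec.subspace_scale[OF W]) auto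
    then show ?thesis by simp
  qed
  then show ?thesis by blast
next
  case False
  then obtain v0 where v0: "G *v v0 \<notin> W" by blast
  obtain c0 where c0: "F *v v0 - c0 *s (G *v v0) \<in> W" using pt by blast
  have "F *v v - c0 *s (G *v v) \<in> W" for v
  proof -
    obtain c where c: "F *v v - c *s (G *v v) \<in> W" using pt by blast
    obtain d where d: "F *v (v + v0) - d *s (G *v (v + v0)) \<in> W" using pt by blast
    have "(F *v (v + v0) - d *s (G *v (v + v0))) - (F *v v - c *s (G *v v)) - (F *v v0 - c0 *s (G *v v0)) \<in> W"
      by (intro vec.subspace_diff[OF W] c c0 d)
    also have "(F *v (v + v0) - d *s (G *v (v + v0))) - (F *v v - c *s (G *v v)) - (F *v v0 - c0 *s (G *v v0))
      = (c - d) *s (G *v v) + (c0 - d) *s (G *v v0)"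
      by (simp add: matrix_vector_right_distrib vec_eq_iff algebra_simps)
    finally have rel: "(c - d) *s (G *v v) + (c0 - d) *s (G *v v0) \<in> W" .
    show ?thesis
    proof (cases "c = d")
      case True
      then have "(c0 - d) *s (G *v v0) \<in> W" using rel by simp
      then have "c0 = d"
        using v0 vec.subspace_scale[OF W, of "(c0 - d) *s (G *v v0)" "inverse (c0 - d)"] by (cases "c0 = d") auto
      then show ?thesis using c True by simp
    next
      case False
      define s where "s = - (c0 - d) / (c - d)"
      have "inverse (c - d) *s ((c - d) *s (G *v v) + (c0 - d) *s (G *v v0)) \<in> W"
        by (rule vec.subspace_scale[OF W rel])
      also have "inverse (c - d) *s ((c - d) *s (G *v v) + (c0 - d) *s (G *v v0)) = G *v (v - s *s v0)"
        using False by (simp add: s_def vec_eq_iff matrix_vector_mult_diff_distrib mat_vec_scale divide_simps)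
          (simp add: algebra_simps)
      finally have Gs: "G *v (v - s *s v0) \<in> W" .
      obtain e where e: "F *v (v - s *s v0) - e *s (G *v (v - s *s v0)) \<in> W" using pt by blast
      have "(F *v (v - s *s v0) - e *s (G *v (v - s *s v0))) + (e - c0) *s (G *v (v - s *s v0))
          + s *s (F *v v0 - c0 *s (G *v v0)) \<in> W"
        by (intro vec.subspace_add[OF W] vec.subspace_scale[OF W] e Gs c0)
      also have "(F *v (v - s *s v0) - e *s (G *v (v - s *s v0))) + (e - c0) *s (G *v (v - s *s v0))
          + s *s (F *v v0 - c0 *s (G *v v0)) = F *v v - c0 *s (G *v v)"
        by (simp add: vec_eq_iff matrix_vector_mult_diff_distrib mat_vec_scale algebra_simps)
      finally show ?thesis .
    qed
  qed
  then show ?thesis by blast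
qed

lemma smat_vec: "smat c A *v x = c *s (A *v (x :: 'k::comm_ring_1^4))"
  by (simp add: vec_eq_iff matrix_vector_mult_def sum_distrib_left mult.assoc)

text \<open>Let \<open>k\<close> be an eigenvector with eigenvalue \<open>l\<close> and \<open>N = X - l\<close>. Comparing the quadratic
  relations for \<open>v\<close> and \<open>v + k\<close>, which have the same images under \<open>N\<close>, shows that \<open>N v\<close> is
  always an eigenvector of \<open>N\<close>.\<close>

lemma quadratic_if_no_cyclic:
  fixes X :: "'k::{alg_closed_field, field_char_0}^4^4"
  assumes "\<And>v. \<exists>a b. X *v (X *v v) = a *s v + b *s (X *v v)"
  obtains l b where "(X - smat l (mat 1)) ** (X - smat l (mat 1)) = smat b (X - smat l (mat 1))"
proof -
  obtain l where l: "det (X - smat l (mat 1)) = 0" using eigenvalue_exists by blast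
  define N where "N = X - smat l (mat 1)"
  obtain k where k: "k \<noteq> 0" "N *v k = 0" using singular_kernel l unfolding N_def by metis
  have X: "X *v v = N *v v + l *s v" for v
    by (simp add: N_def matrix_vector_mult_diff_rdistrib smat_one_vec)
  have quad: "\<exists>a b. N *v (N *v v) = a *s v + b *s (N *v v)" for v
  proof -
    obtain a b where ab: "X *v (X *v v) = a *s v + b *s (X *v v)" using assms by blast
    have "N *v (N *v v) = (a + b * l - l * l) *s v + (b - 2 * l) *s (N *v v)"
      using ab by (simp add: X matrix_vector_right_distrib mat_vec_scale vec_eq_iff algebra_simps)
    then show ?thesis by blast
  qed
  have pt: "\<exists>b. N *v (N *v v) = b *s (N *v v)" for v
  proof -
    obtain a b where ab: "N *v (N *v v) = a *s v + b *s (N *v v)" using quad by blast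
    obtain a' b' where ab': "N *v (N *v (v + k)) = a' *s (v + k) + b' *s (N *v (v + k))" using quad by blast
    have v': "N *v (N *v v) = a' *s v + a' *s k + b' *s (N *v v)"
      using ab' by (simp add: matrix_vector_right_distrib k(2) vec_eq_iff algebra_simps)
    show ?thesis
    proof (cases "a' = 0")
      case True
      then have "N *v (N *v v) = b' *s (N *v v)" using v' by simp
      then show ?thesis by blast
    next
      case False
      define \<alpha> \<beta> where "\<alpha> = (a - a') / a'" and "\<beta> = (b - b') / a'"
      have eq: "a' *s k = (a - a') *s v + (b - b') *s (N *v v)"
        using ab v' by (simp add: vec_eq_iff algebra_simps)
      have "k = inverse a' *s (a' *s k)" using False by simp
      then have kv: "k = \<alpha> *s v + \<beta> *s (N *v v)"
        unfolding eq by (simp add: \<alpha>_def \<beta>_def vec_eq_iff divide_simps False)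
      have "N *v k = \<alpha> *s (N *v v) + \<beta> *s (N *v (N *v v))"
        by (subst kv) (simp add: matrix_vector_right_distrib mat_vec_scale)
      then have 0: "\<alpha> *s (N *v v) + \<beta> *s (N *v (N *v v)) = 0" using k(2) by simp
      show ?thesis
      proof (cases "\<beta> = 0")
        case True
        then have "\<alpha> \<noteq> 0" using kv k(1) by auto
        then have "N *v v = 0" using 0 True by simp
        then show ?thesis by simp
      next
        case False
        have "\<beta> *s (N *v (N *v v)) = - (\<alpha> *s (N *v v))" using 0 by (simp add: eq_neg_iff_add_eq_0 add.commute)
        then have "inverse \<beta> *s (\<beta> *s (N *v (N *v v))) = inverse \<beta> *s (- (\<alpha> *s (N *v v)))" by simp
        then have "N *v (N *v v) = (- \<alpha> / \<beta>) *s (N *v v)"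
          using False by (simp add: vec_eq_iff divide_simps)
        then show ?thesis by blast
      qed
    qed
  qed
  have "\<exists>c. (N ** N) *v v - c *s (N *v v) \<in> {0}" for v
  proof -
    obtain b where "N *v (N *v v) = b *s (N *v v)" using pt by blast
    then show ?thesis by (intro exI[of _ b]) (simp add: matrix_vector_mul_assoc[symmetric])
  qed
  then obtain b where "\<forall>v. (N ** N) *v v - b *s (N *v v) \<in> {0}"
    using pointwise_multiple_mod[of "{0}" "N ** N" N] by (auto simp: vec.subspace_single_0)
  then have "(N ** N) *v v = smat b N *v v" for v by (simp add: smat_vec)
  then have "N ** N = smat b N" by (simp add: matrix_eq)
  then show thesis using that unfolding N_def by blast
qed

text \<open>Write \<open>M u = r v + s M v\<close>. Comparing \<open>M (M u)\<close> with \<open>b M u\<close> gives \<open>r M v = r b v\<close>, so \<open>r = 0\<close> and the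
  range of \<open>M\<close> is the line through \<open>M v\<close>.\<close>

lemma rank_one_if_range_in_plane:
  fixes M :: "'k::field^4^4"
  assumes sq: "M ** M = smat b M" and v: "M *v v \<notin> vec.span {v}"
    and range: "\<And>u. M *v u \<in> vec.span {v, M *v v}"
  shows "\<exists>z. M = outer (M *v v) z \<and> z \<noteq> 0 \<and> M *v v \<noteq> 0"
proof -
  have MM: "M *v (M *v x) = b *s (M *v x)" for x
    by (simp add: matrix_vector_mul_assoc sq smat_vec)
  have nz: "M *v v \<noteq> 0" using v vec.span_zero by metis
  have "\<exists>z. M *v u = z *s (M *v v)" for u
  proof -
    obtain r s where rs: "M *v u = r *s v + s *s (M *v v)" using range[of u] span2_iff by blast
    have "M *v (M *v u) = r *s (M *v v) + (s * b) *s (M *v v)"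
      by (subst rs) (simp add: matrix_vector_right_distrib mat_vec_scale MM)
    moreover have "M *v (M *v u) = (b * r) *s v + (b * s) *s (M *v v)"
      unfolding MM by (subst rs) (simp add: vec_eq_iff algebra_simps)
    ultimately have "r *s (M *v v) + (s * b) *s (M *v v) = (b * r) *s v + (b * s) *s (M *v v)" by simp
    then have "r *s (M *v v) = (b * r) *s v" by (simp add: mult.commute[of b s])
    also have "\<dots> = r *s (b *s v)" by (simp add: mult.commute)
    finally have "r *s (M *v v) = r *s (b *s v)" .
    then have "r = 0 \<or> M *v v = b *s v" using vector_mul_lcancel by blast
    then have "r = 0" using v span1_iff by blast
    then show ?thesis using rs by auto
  qed
  then obtain f where f: "\<And>u. M *v u = f u *s (M *v v)" by metis
  have "M = outer (M *v v) (\<chi> j. f (axis j 1))"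
  proof (simp only: vec_eq_iff, intro allI)
    fix i j
    have "M $ i $ j = (M *v axis j 1) $ i" by (simp add: mul_axis)
    also have "\<dots> = f (axis j 1) * (M *v v) $ i" by (subst f) simp
    finally show "M $ i $ j = outer (M *v v) (\<chi> j. f (axis j 1)) $ i $ j" by simp
  qed
  moreover have "z \<noteq> 0" if "M = outer (M *v v) z" for z
  proof
    assume "z = 0"
    then have "M = 0" using that outer_zero(1) by metis
    then show False using nz by simp
  qed
  ultimately show ?thesis using nz by blast
qed

text \<open>Choose \<open>v\<close> such that \<open>v\<close> and \<open>N v\<close> span a plane. If no \<open>u\<close> as in the first case exists, \<open>N\<close> acts on
  the quotient by this plane as a scalar \<open>\<mu>\<close>, which is 0 or \<open>b\<close>, and then \<open>N - \<mu>\<close> maps everything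
  into the plane and is quadratic as well.\<close>

lemma quadratic_dichotomy:
  fixes N :: "'k::field^4^4"
  assumes sq: "N ** N = smat b N" and nonscalar: "\<And>c. N \<noteq> smat c (mat 1)"
  obtains (two_blocks) v u where "v \<noteq> 0" "N *v v \<notin> vec.span {v}" "u \<notin> vec.span {v, N *v v}"
      "N *v u \<notin> vec.span {v, N *v v, u}"
    | (rank_one) v w c where "N = outer v w + smat c (mat 1)" "v \<noteq> 0" "w \<noteq> 0"
proof -
  have NN: "N *v (N *v x) = b *s (N *v x)" for x
    by (simp add: matrix_vector_mul_assoc sq smat_vec)
  have "\<exists>v. N *v v \<notin> vec.span {v}"
  proof (rule ccontr)
    assume "\<not> ?thesis"
    then have "\<exists>c. N *v v - c *s (mat 1 *v v) \<in> {0}" for v using span1_iff[of "N *v v" v] by auto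
    then obtain c where "\<forall>v. N *v v - c *s (mat 1 *v v) \<in> {0}"
      using pointwise_multiple_mod[of "{0}" N "mat 1"] by (auto simp: vec.subspace_single_0)
    then have "N *v v = smat c (mat 1) *v v" for v by (simp add: smat_one_vec)
    then have "N = smat c (mat 1)" by (simp add: matrix_eq)
    then show False using nonscalar by blast
  qed
  then obtain v where v: "N *v v \<notin> vec.span {v}" by blast
  have v0: "v \<noteq> 0" using v vec.span_zero by auto
  let ?W = "vec.span {v, N *v v}"
  have WW: "vec.subspace ?W" by (rule vec.subspace_span)
  have NW: "N *v x \<in> ?W" if x: "x \<in> ?W" for x
  proof -
    obtain r s where xrs: "x = r *s v + s *s (N *v v)" using x span2_iff by blast
    have "N *v x = 0 *s v + (r + s * b) *s (N *v v)"
      by (subst xrs) (simp add: matrix_vector_right_distrib mat_vec_scale NN vec_eq_iff algebra_simps)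
    then show ?thesis using span2_iff by blast
  qed
  show thesis
  proof (cases "\<exists>u. u \<notin> ?W \<and> N *v u \<notin> vec.span {v, N *v v, u}")
    case True
    then show thesis using two_blocks v v0 by blast
  next
    case False
    have "\<exists>c. N *v u - c *s (mat 1 *v u) \<in> ?W" for u
    proof (cases "u \<in> ?W")
      case True
      then show ?thesis using NW by (intro exI[of _ 0]) simp
    next
      case f: False
      then have "N *v u \<in> vec.span {v, N *v v, u}" using False by blast
      then obtain r s t where "N *v u = r *s v + s *s (N *v v) + t *s u" using span3_iff by blast
      then have "N *v u - t *s u = r *s v + s *s (N *v v)" by simp
      then have "N *v u - t *s (mat 1 *v u) \<in> ?W" unfolding span2_iff by auto
      then show ?thesis by blast
    qed
    then obtain \<mu> where \<mu>: "\<And>u. N *v u - \<mu> *s u \<in> ?W"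
      using pointwise_multiple_mod[OF WW, of N "mat 1"] by auto
    have "card {v, N *v v} < 4" using card_length[of "[v, N *v v]"] by simp
    then obtain u where u: "u \<notin> ?W"
      using exists_outside[of "{v, N *v v}" "axis 1 1"] by (auto simp: axis_eq_0_iff)
    have "N *v (N *v u - \<mu> *s u) - (b - \<mu>) *s (N *v u - \<mu> *s u) \<in> ?W"
      by (intro vec.subspace_diff[OF WW] vec.subspace_scale[OF WW] NW \<mu>)
    also have "N *v (N *v u - \<mu> *s u) - (b - \<mu>) *s (N *v u - \<mu> *s u) = ((b - \<mu>) * \<mu>) *s u"
      by (simp add: matrix_vector_mult_diff_distrib mat_vec_scale NN vec_eq_iff algebra_simps)
    finally have ku: "((b - \<mu>) * \<mu>) *s u \<in> ?W" .
    have k0: "k = 0" if k: "k *s u \<in> ?W" for k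
    proof (rule ccontr)
      assume "k \<noteq> 0"
      then show False using vec.subspace_scale[OF WW k, of "inverse k"] u by simp
    qed
    have "(b - \<mu>) * \<mu> = 0" by (rule k0[OF ku])
    define M where "M = N - smat \<mu> (mat 1)"
    have Mv: "M *v x = N *v x - \<mu> *s x" for x
      by (simp add: M_def matrix_vector_mult_diff_rdistrib smat_one_vec)
    have "M ** M = smat (b - 2 * \<mu>) M"
    proof -
      have "M ** M = smat b N - smat (2 * \<mu>) N + smat (\<mu> * \<mu>) (mat 1)"
        by (simp add: M_def mul_simps sq smat_simps) (simp add: vec_eq_iff algebra_simps)
      moreover have "\<mu> * \<mu> = - ((b - 2 * \<mu>) * \<mu>)" using \<open>(b - \<mu>) * \<mu> = 0\<close> by (simp add: algebra_simps)
      ultimately show ?thesis by (simp add: M_def smat_simps) (simp add: vec_eq_iff algebra_simps)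
    qed
    moreover have "M *v v \<notin> vec.span {v}"
    proof
      assume "M *v v \<in> vec.span {v}"
      then obtain r where "N *v v - \<mu> *s v = r *s v" unfolding Mv using span1_iff by blast
      then have "N *v v = (r + \<mu>) *s v" by (simp add: vec_eq_iff algebra_simps)
      then show False using v span1_iff by blast
    qed
    moreover have "M *v x \<in> vec.span {v, M *v v}" for x
    proof -
      obtain r s where "N *v x - \<mu> *s x = r *s v + s *s (N *v v)" using \<mu>[of x] span2_iff by blast
      then have "M *v x = (r + s * \<mu>) *s v + s *s (M *v v)"
        unfolding Mv by (simp add: vec_eq_iff algebra_simps)
      then show ?thesis using span2_iff by blast
    qed
    ultimately obtain z where z: "M = outer (M *v v) z" "z \<noteq> 0" "M *v v \<noteq> 0"
      using rank_one_if_range_in_plane by blast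
    have "N = outer (M *v v) z + smat \<mu> (mat 1)" using z(1) by (simp add: M_def)
    then show thesis using rank_one z(2,3) by blast
  qed
qed

definition scalar_square :: "('k::comm_ring_1^4^4) set" where
  "scalar_square = {M. M ** M = smat ((M ** M) $ 1 $ 1) (mat 1)}"

definition scalar_plus_rank_one :: "('k::comm_ring_1^4^4) set" where
  "scalar_plus_rank_one = {outer v w + smat s (mat 1) |v w s. v \<noteq> 0 \<and> w \<noteq> 0}"

text \<open>In the basis \<open>v, N v, u, N u\<close> the diagonal is \<open>0, b, 0, b\<close>.\<close>

lemma trace_quadratic:
  fixes N :: "'k::field_char_0^4^4"
  assumes sq: "N ** N = smat b N" and v: "v \<noteq> 0" "N *v v \<notin> vec.span {v}" "u \<notin> vec.span {v, N *v v}"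
    "N *v u \<notin> vec.span {v, N *v v, u}"
  shows "trace N = 2 * b"
proof -
  obtain B B' where ad: "adapted v (N *v v) u (N *v u) B B'"
    using adapted_exists[OF v] by blast
  have NN: "N *v (N *v x) = b *s (N *v x)" for x
    by (simp add: matrix_vector_mul_assoc sq smat_vec)
  have "trace (B' ** N ** B) = 2 * b"
    unfolding trace_def sum_4
    by (simp add: adapted_column[OF ad] NN mat_vec_scale adapted_inverse[OF ad] axis_def)
  then show ?thesis using trace_conj[of B B' N] ad unfolding adapted_def by simp
qed

theorem orbit_dim_classification:
  fixes X :: "'k::{alg_closed_field, field_char_0}^4^4"
  assumes tr: "trace X = 0"
  obtains "X = 0" "orbit_dim X = 0"
    | "X \<in> scalar_plus_rank_one" "orbit_dim X = 6"
    | "X \<in> scalar_square" "8 \<le> orbit_dim X"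
    | "9 \<le> orbit_dim X"
proof (cases "\<exists>v. v \<noteq> 0 \<and> X *v v \<notin> vec.span {v} \<and> X *v (X *v v) \<notin> vec.span {v, X *v v}")
  case True
  then show thesis using orbit_dim_cyclic[OF tr] that(4) by blast
next
  case False
  have quad: "\<exists>a b. X *v (X *v v) = a *s v + b *s (X *v v)" for v
  proof -
    consider "v = 0" | "X *v v \<in> vec.span {v}" | "X *v (X *v v) \<in> vec.span {v, X *v v}"
      using False by blast
    then show ?thesis
    proof cases
      case 2
      then obtain c where "X *v v = c *s v" using span1_iff by blast
      then have "X *v (X *v v) = 0 *s v + c *s (X *v v)" by (simp add: mat_vec_scale)
      then show ?thesis by blast
    next
      case 3
      then show ?thesis using span2_iff by blast
    qed simp
  qed
  obtain l b where sq: "(X - smat l (mat 1)) ** (X - smat l (mat 1)) = smat b (X - smat l (mat 1))"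
    using quadratic_if_no_cyclic[OF quad] .
  define N where "N = X - smat l (mat 1)"
  have X: "X = N + smat l (mat 1)" by (simp add: N_def)
  note sq = sq[folded N_def]
  show thesis
  proof (cases "\<exists>c. N = smat c (mat 1)")
    case True
    then obtain c where c: "X = smat (c + l) (mat 1)" using X by (auto simp: smat_simps)
    then have "(c + l) * 4 = 0" using tr by (simp only: trace_smat trace_one)
    then have "c + l = 0" by (metis mult_eq_0_iff zero_neq_numeral)
    then have "X = 0" using c by (simp add: smat_simps)
    then show thesis using that(1) orbit_dim_zero by simp
  next
    case False
    then have nonscalar: "N \<noteq> smat c (mat 1)" for c by blast
    show thesis
    proof (cases rule: quadratic_dichotomy[OF sq nonscalar, case_names two_blocks rank_one])
      case (two_blocks v u)
      have "trace N + 4 * l = 0" using tr unfolding X by (simp add: trace_add trace_smat trace_one mult.commute)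
      then have "(2 * b + 4 * l) / 2 = 0" using trace_quadratic[OF sq two_blocks] by simp
      then have b: "b = - (2 * l)" by (simp add: add_divide_distrib eq_neg_iff_add_eq_0)
      have "X ** X = smat b N + smat (2 * l) N + smat (l * l) (mat 1)"
        by (simp add: X mul_simps sq smat_simps) (simp add: vec_eq_iff algebra_simps)
      then have "X ** X = smat (l * l) (mat 1)" unfolding b by (simp add: vec_eq_iff)
      then have "X \<in> scalar_square" by (simp add: scalar_square_def mat_def)
      moreover have "8 \<le> orbit_dim X"
        using orbit_dim_two_blocks[OF sq _ two_blocks] tr unfolding X by blast
      ultimately show thesis using that(3) by blast
    next
      case (rank_one v w c)
      then have eq: "X = outer v w + smat (c + l) (mat 1)" unfolding X by (simp add: smat_simps add.assoc)
      then have "X \<in> scalar_plus_rank_one" using rank_one unfolding scalar_plus_rank_one_def by blast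
      moreover have "orbit_dim X = 6"
        using orbit_dim_rank_one_le orbit_dim_rank_one_ge tr rank_one unfolding eq by (metis antisym)
      ultimately show thesis using that(2) by blast
    qed
  qed
qed


section \<open>A sheet whose closure is not a union of sheets\<close>

lemma scalar_square_closed:
  fixes S :: "(nat \<Rightarrow> nat \<Rightarrow> 'k::{alg_closed_field, field_char_0}) set"
  assumes "S \<subseteq> sl4" "\<And>x. x \<in> S \<Longrightarrow> proj x \<in> scalar_square" "x \<in> sl4.zariski closure_of S"
  shows "proj x \<in> scalar_square"
proof -
  let ?q = "\<lambda>i j (M :: 'k^4^4). (M ** M) $ i $ j - (M ** M) $ 1 $ 1 * (mat 1) $ i $ j"
  have "?q i j \<in> alg entries" for i j
    unfolding mul_nth by (intro alg_intros entry_alg)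
  then have "(\<lambda>A. ?q i j (proj A)) \<in> sl4.poly_funs" for i j by (rule poly_proj)
  then have "?q i j (proj x) = 0" for i j
  proof (rule sl4.closure_of_vanish[OF _ _ assms(1,3)])
    fix y assume "y \<in> S"
    then have "(proj y ** proj y) = smat ((proj y ** proj y) $ 1 $ 1) (mat 1)"
      using assms(2) unfolding scalar_square_def by blast
    then have "(proj y ** proj y) $ i $ j = smat ((proj y ** proj y) $ 1 $ 1) (mat 1) $ i $ j" by simp
    then show "?q i j (proj y) = 0" unfolding smat_nth by simp
  qed
  then have "(proj x ** proj x) $ i $ j = smat ((proj x ** proj x) $ 1 $ 1) (mat 1) $ i $ j" for i j
    unfolding smat_nth right_minus_eq .
  then have "proj x ** proj x = smat ((proj x ** proj x) $ 1 $ 1) (mat 1)"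
    by (intro vec_eq_iff[THEN iffD2] allI)
  then show ?thesis unfolding scalar_square_def by (rule CollectI)
qed

lemma stratum_iff:
  fixes M :: "'k::{alg_closed_field, field_char_0}^4^4"
  shows "emb M \<in> sl4.orbit_dim_stratum m \<longleftrightarrow> trace M = 0 \<and> orbit_dim M = enat m"
  unfolding sl4.orbit_dim_stratum_def by simp

lemma stratum_6:
  "sl4.orbit_dim_stratum 6 = emb ` {M :: 'k::{alg_closed_field, field_char_0}^4^4. trace M = 0 \<and> M \<in> scalar_plus_rank_one}"
proof -
  have "emb M \<in> sl4.orbit_dim_stratum 6 \<longleftrightarrow> trace M = 0 \<and> M \<in> scalar_plus_rank_one" for M :: "'k^4^4"
  proof (cases "trace M = 0")
    case True
    have "orbit_dim M = 6 \<longleftrightarrow> M \<in> scalar_plus_rank_one"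
    proof
      assume 6: "orbit_dim M = 6"
      show "M \<in> scalar_plus_rank_one"
        using True 6 by (cases rule: orbit_dim_classification) (auto simp: numeral_eq_enat zero_enat_def)
    next
      assume "M \<in> scalar_plus_rank_one"
      then obtain v w s where "M = outer v w + smat s (mat 1)" "v \<noteq> 0" "w \<noteq> 0"
        unfolding scalar_plus_rank_one_def by blast
      then show "orbit_dim M = 6"
        using orbit_dim_rank_one_le orbit_dim_rank_one_ge True by (metis antisym)
    qed
    then show ?thesis using True by (simp add: stratum_iff numeral_eq_enat)
  qed (simp add: stratum_iff)
  moreover have "sl4.orbit_dim_stratum 6 \<subseteq> sl4" unfolding sl4.orbit_dim_stratum_def by blast
  ultimately show ?thesis by (force elim: sl4_cases)
qed

lemma stratum_8_scalar_square:
  fixes M :: "'k::{alg_closed_field, field_char_0}^4^4"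
  assumes "emb M \<in> sl4.orbit_dim_stratum 8"
  shows "M \<in> scalar_square"
proof -
  have 8: "trace M = 0" "orbit_dim M = 8" using assms by (simp_all add: stratum_iff numeral_eq_enat)
  from 8(1) show ?thesis
    by (cases rule: orbit_dim_classification) (use 8(2) in \<open>auto simp: numeral_eq_enat zero_enat_def\<close>)
qed

lemma poly_curve:
  fixes c :: "'k::{alg_closed_field, field_char_0} \<Rightarrow> 'k^4^4"
  assumes "p \<in> sl4.poly_funs" "\<And>i j. (\<lambda>t. c t $ i $ j) \<in> alg {\<lambda>t. t}"
  shows "(\<lambda>t. p (emb (c t))) \<in> alg {\<lambda>t. t}"
  by (rule alg_subst[OF poly_emb[OF assms(1)]]) (use assms(2) in auto)

text \<open>The stratum is the image of the pairs of nonzero vectors. Two of its points are joined by the image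
  of the line through the two pairs, which leaves the stratum only where one of the vectors becomes
  zero.\<close>

lemma stratum_6_irreducible:
  "irreducible_in sl4.zariski (sl4.orbit_dim_stratum 6 :: (nat \<Rightarrow> nat \<Rightarrow> 'k::{alg_closed_field, field_char_0}) set)"
proof -
  let ?A = "sl4.orbit_dim_stratum 6 :: (nat \<Rightarrow> nat \<Rightarrow> 'k) set"
  define F :: "'k^4 \<Rightarrow> 'k^4 \<Rightarrow> 'k^4^4" where "F v w = outer v w - smat ((\<Sum>i\<in>UNIV. v $ i * w $ i) / 4) (mat 1)" for v w
  have tr: "trace (F v w) = 0" for v w
    by (simp add: F_def trace_sub trace_outer trace_smat trace_one)
  have F_in: "emb (F v w) \<in> ?A" if "v \<noteq> 0" "w \<noteq> 0" for v w
  proof -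
    have "F v w = outer v w + smat (- ((\<Sum>i\<in>UNIV. v $ i * w $ i) / 4)) (mat 1)"
      by (simp add: F_def vec_eq_iff)
    then have "F v w \<in> scalar_plus_rank_one" using that unfolding scalar_plus_rank_one_def by blast
    then show ?thesis unfolding stratum_6 using tr by blast
  qed
  have A_F: "\<exists>v w. v \<noteq> 0 \<and> w \<noteq> 0 \<and> x = emb (F v w)" if x: "x \<in> ?A" for x
  proof -
    obtain v w s where vw: "v \<noteq> 0" "w \<noteq> 0" "x = emb (outer v w + smat s (mat 1))" "trace (outer v w + smat s (mat 1)) = 0"
      using x unfolding stratum_6 scalar_plus_rank_one_def by blast
    then have "s = - ((\<Sum>i\<in>UNIV. v $ i * w $ i) / 4)"
      by (simp add: trace_add trace_outer trace_smat trace_one field_simps eq_neg_iff_add_eq_0)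
    then have "outer v w + smat s (mat 1) = F v w" by (simp add: F_def vec_eq_iff)
    then show ?thesis using vw by auto
  qed
  show ?thesis
    unfolding sl4.irreducible_zariski_iff
  proof (intro conjI ballI impI)
    show "?A \<subseteq> sl4" unfolding sl4.orbit_dim_stratum_def by blast
    have "axis 1 1 \<noteq> (0 :: 'k^4)" by (simp add: axis_eq_0_iff)
    then show "?A \<noteq> {}" using F_in[of "axis 1 1" "axis 1 1"] by blast
    fix p q :: "(nat \<Rightarrow> nat \<Rightarrow> 'k) \<Rightarrow> 'k"
    assume pq: "p \<in> sl4.poly_funs" "q \<in> sl4.poly_funs" "\<forall>x\<in>?A. p x * q x = 0"
    show "(\<forall>x\<in>?A. p x = 0) \<or> (\<forall>x\<in>?A. q x = 0)"
    proof (rule ccontr)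
      assume "\<not> ?thesis"
      then obtain x x' where x: "x \<in> ?A" "p x \<noteq> 0" "x' \<in> ?A" "q x' \<noteq> 0" by blast
      obtain v w where vw: "v \<noteq> 0" "w \<noteq> 0" "x = emb (F v w)" using A_F[OF x(1)] by blast
      obtain v' w' where vw': "x' = emb (F v' w')" using A_F[OF x(3)] by blast
      define V W where "V t = v + t *s (v' - v)" and "W t = w + t *s (w' - w)" for t
      obtain i where i: "v $ i \<noteq> 0" using vw(1) by (auto simp: vec_eq_iff)
      obtain j where j: "w $ j \<noteq> 0" using vw(2) by (auto simp: vec_eq_iff)
      have VW: "(\<lambda>t. V t $ i) \<in> alg {\<lambda>t. t}" "(\<lambda>t. W t $ i) \<in> alg {\<lambda>t. t}" for i
        unfolding V_def W_def vector_add_component vector_smult_component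
        by (intro alg_intros alg_ident_self)+
      have "(\<lambda>t. F (V t) (W t) $ i $ j) \<in> alg {\<lambda>t. t}" for i j
      proof -
        have "(\<lambda>t. F (V t) (W t) $ i $ j)
          = (\<lambda>t. V t $ i * W t $ j - (\<Sum>i\<in>UNIV. V t $ i * W t $ i) * ((1 / 4) * (mat 1) $ i $ j))"
          by (simp add: F_def)
        also have "\<dots> \<in> alg {\<lambda>t. t}" by (intro alg_intros VW)
        finally show ?thesis .
      qed
      from poly_curve[OF pq(1) this] poly_curve[OF pq(2) this]
      have pF: "(\<lambda>t. p (emb (F (V t) (W t)))) \<in> alg {\<lambda>t. t}"
        and qF: "(\<lambda>t. q (emb (F (V t) (W t)))) \<in> alg {\<lambda>t. t}" by auto
      have "\<exists>t. p (emb (F (V t) (W t))) * q (emb (F (V t) (W t))) \<noteq> 0"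
        by (rule alg_ident_nonzero_mult[OF pF qF, of 0 1]) (use x vw vw' in \<open>simp_all add: V_def W_def\<close>)
      then obtain t0 where t0: "p (emb (F (V t0) (W t0))) * q (emb (F (V t0) (W t0))) \<noteq> 0" by blast
      \<comment> \<open>a further polynomial factor keeps both vectors away from 0\<close>
      have "V 0 $ i * W 0 $ j \<noteq> 0" using i j by (simp add: V_def W_def)
      from alg_ident_nonzero_mult[OF alg.mult[OF pF qF] alg.mult[OF VW(1)[of i] VW(2)[of j]] t0 this]
      obtain t where t: "p (emb (F (V t) (W t))) * q (emb (F (V t) (W t))) * (V t $ i * W t $ j) \<noteq> 0" by blast
      then have "V t \<noteq> 0" "W t \<noteq> 0" by auto
      from pq(3)[rule_format, OF F_in[OF this]] t show False by simp
    qed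
  qed
qed

lemma gamma_curve: "(\<lambda>t. gamma t $ i $ j :: 'k::comm_ring_1) \<in> alg {\<lambda>t. t}"
  using alg.const alg_ident_self alg_uminus[OF alg_ident_self]
  unfolding gamma_nth by (cases "i = j"; cases "i = 1"; cases "i = 2"; cases "j = 4"; simp)

abbreviation gamma_line :: "(nat \<Rightarrow> nat \<Rightarrow> 'k::{alg_closed_field, field_char_0}) set" where
  "gamma_line \<equiv> {emb (gamma a) |a. a \<noteq> 0}"

lemma gamma_line_irreducible:
  "irreducible_in sl4.zariski (gamma_line :: (nat \<Rightarrow> nat \<Rightarrow> 'k::{alg_closed_field, field_char_0}) set)"
  unfolding sl4.irreducible_zariski_iff
proof (intro conjI ballI impI)
  show "gamma_line \<subseteq> (sl4 :: (nat \<Rightarrow> nat \<Rightarrow> 'k) set)" by (auto simp: trace_gamma)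
  have "emb (gamma 1) \<in> (gamma_line :: (nat \<Rightarrow> nat \<Rightarrow> 'k) set)" by (intro CollectI exI[of _ 1]) simp
  then show "(gamma_line :: (nat \<Rightarrow> nat \<Rightarrow> 'k) set) \<noteq> {}" by blast
  fix p q :: "(nat \<Rightarrow> nat \<Rightarrow> 'k) \<Rightarrow> 'k"
  assume pq: "p \<in> sl4.poly_funs" "q \<in> sl4.poly_funs" "\<forall>x\<in>gamma_line. p x * q x = 0"
  note curves = poly_curve[OF pq(1) gamma_curve] poly_curve[OF pq(2) gamma_curve]
  show "(\<forall>x\<in>gamma_line. p x = 0) \<or> (\<forall>x\<in>gamma_line. q x = 0)"
  proof (rule ccontr)
    assume "\<not> ?thesis"
    then obtain a b where "p (emb (gamma a)) \<noteq> 0" "q (emb (gamma b)) \<noteq> 0" by blast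
    from alg_ident_nonzero_mult[OF curves this] obtain t where "p (emb (gamma t)) * q (emb (gamma t)) \<noteq> 0" by blast
    from alg_ident_nonzero_mult[OF alg.mult[OF curves] alg_ident_self this, of 1]
    obtain s where "p (emb (gamma s)) * q (emb (gamma s)) * s \<noteq> 0" by auto
    then show False using pq(3) by auto
  qed
qed

lemma gamma_0_in_closure:
  "emb (gamma 0) \<in> sl4.zariski closure_of (gamma_line :: (nat \<Rightarrow> nat \<Rightarrow> 'k::{alg_closed_field, field_char_0}) set)"
proof (rule sl4.in_closure_ofI)
  show "emb (gamma 0) \<in> (sl4 :: (nat \<Rightarrow> nat \<Rightarrow> 'k) set)" by (simp add: trace_gamma)
  show "gamma_line \<subseteq> (sl4 :: (nat \<Rightarrow> nat \<Rightarrow> 'k) set)" by (auto simp: trace_gamma)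
  fix p :: "(nat \<Rightarrow> nat \<Rightarrow> 'k) \<Rightarrow> 'k"
  assume p: "p \<in> sl4.poly_funs" "\<And>y. y \<in> gamma_line \<Longrightarrow> p y = 0"
  have "p (emb (gamma t)) * t = 0" for t using p(2)[of "emb (gamma t)"] by (cases "t = 0") auto
  from alg_ident_mult_eq_0[OF poly_curve[OF p(1) gamma_curve] alg_ident_self this]
  show "p (emb (gamma 0)) = 0" by (metis zero_neq_one)
qed

text \<open>The lower bound is that for two blocks with \<open>b = - 2 a\<close>: the vectors \<open>e\<^sub>2 + e\<^sub>3\<close> and \<open>e\<^sub>4\<close> have a component
  in each of the two eigenspaces of \<open>gamma a\<close>.\<close>

lemma gamma_line_stratum_8:
  "gamma_line \<subseteq> (sl4.orbit_dim_stratum 8 :: (nat \<Rightarrow> nat \<Rightarrow> 'k::{alg_closed_field, field_char_0}) set)"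
proof clarify
  fix a :: 'k assume a: "a \<noteq> 0"
  let ?N = "gamma a - smat a (mat 1)"
  have eq: "?N + smat a (mat 1) = gamma a" by simp
  have "8 \<le> orbit_dim (?N + smat a (mat 1))"
  proof (rule orbit_dim_two_blocks[where b = "- (2 * a)" and v = "axis 2 1 + axis 3 1" and u = "axis 4 1"])
    show "?N ** ?N = smat (- (2 * a)) ?N"
      by (simp add: vec_eq_iff forall_4 mul_nth sum_4 gamma_nth mat_def)
    show "trace (?N + smat a (mat 1)) = 0" unfolding eq by (rule trace_gamma)
    have Nv: "?N *v (axis 2 1 + axis 3 1) = (- 2 * a) *s axis 3 1"
      by (simp add: vec_eq_iff forall_4 matrix_vector_mult_def sum_4 gamma_nth mat_def axis_def)
    have Nu: "?N *v axis 4 1 = axis 1 1 + (- 2 * a) *s axis 4 1"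
      by (simp add: vec_eq_iff forall_4 matrix_vector_mult_def sum_4 gamma_nth mat_def axis_def)
    show "axis 2 1 + axis 3 1 \<noteq> (0 :: 'k^4)" by (simp add: vec_eq_iff forall_4 axis_def)
    show "?N *v (axis 2 1 + axis 3 1) \<notin> vec.span {axis 2 1 + axis 3 1}"
      unfolding Nv span1_iff using a by (auto simp: vec_eq_iff forall_4 axis_def)
    show "axis 4 1 \<notin> vec.span {axis 2 1 + axis 3 1, ?N *v (axis 2 1 + axis 3 1)}"
      unfolding Nv span2_iff by (auto simp: vec_eq_iff forall_4 axis_def)
    show "?N *v axis 4 1 \<notin> vec.span {axis 2 1 + axis 3 1, ?N *v (axis 2 1 + axis 3 1), axis 4 1}"
      unfolding Nv Nu span3_iff by (auto simp: vec_eq_iff forall_4 axis_def)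
  qed
  then have "orbit_dim (gamma a) = 8" using orbit_dim_gamma_le[OF a] unfolding eq by (rule antisym[rotated])
  then show "emb (gamma a) \<in> sl4.orbit_dim_stratum 8" by (simp add: stratum_iff trace_gamma numeral_eq_enat)
qed

theorem mainTheorem9:
  shows "\<exists>(L :: (nat \<Rightarrow> nat \<Rightarrow> 'k::{alg_closed_field, field_char_0}) set) br.
    semisimple_lie_algebra matrix_scale L br \<and>
    (\<exists>S. lie_algebra.sheet matrix_scale L br S \<and>
       \<not> lie_algebra.union_of_sheets matrix_scale L br
            (lie_algebra.zariski matrix_scale L closure_of S))"
proof -
  obtain S :: "(nat \<Rightarrow> nat \<Rightarrow> 'k) set"
    where S: "irreducible_component_of sl4.zariski (sl4.orbit_dim_stratum 8) S" "gamma_line \<subseteq> S"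
    using irreducible_in_subset_component[OF gamma_line_irreducible gamma_line_stratum_8] .
  have S8: "S \<subseteq> sl4.orbit_dim_stratum 8" using S(1) unfolding irreducible_component_of_def by blast
  have SL: "S \<subseteq> sl4" using S8 unfolding sl4.orbit_dim_stratum_def by blast
  have "proj x \<in> scalar_square" if x: "x \<in> S" for x
  proof -
    obtain M where "x = emb M" using x SL sl4_cases by blast
    then show ?thesis using stratum_8_scalar_square[of M] x S8 by auto
  qed
  note closure = scalar_square_closed[OF SL this]
  have "\<not> sl4.union_of_sheets (sl4.zariski closure_of S)"
  proof
    assume "sl4.union_of_sheets (sl4.zariski closure_of S)"
    then obtain T where T: "sl4.sheet T" "emb (gamma 0) \<in> T" "T \<subseteq> sl4.zariski closure_of S"
      using gamma_0_in_closure closure_of_mono[OF S(2), of sl4.zariski]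
      unfolding sl4.union_of_sheets_def by blast
    obtain m where m: "irreducible_component_of sl4.zariski (sl4.orbit_dim_stratum m) T"
      using T(1) unfolding sl4.sheet_def by blast
    have Tm: "T \<subseteq> sl4.orbit_dim_stratum m" using m unfolding irreducible_component_of_def by blast
    have "gamma 0 = outer (axis 1 1) (axis 4 1) + smat 0 (mat 1 :: 'k^4^4)"
      by (simp add: vec_eq_iff forall_4 gamma_nth axis_def)
    moreover have "axis 1 1 \<noteq> (0 :: 'k^4)" "axis 4 1 \<noteq> (0 :: 'k^4)" by (simp_all add: axis_eq_0_iff)
    ultimately have "gamma 0 \<in> (scalar_plus_rank_one :: ('k^4^4) set)"
      unfolding scalar_plus_rank_one_def by blast
    then have "emb (gamma 0) \<in> (sl4.orbit_dim_stratum 6 :: (nat \<Rightarrow> nat \<Rightarrow> 'k) set)"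
      unfolding stratum_6 by (auto simp: trace_gamma)
    then have "m = 6" using T(2) Tm unfolding sl4.orbit_dim_stratum_def by auto
    then have "sl4.orbit_dim_stratum 6 = T"
      using m stratum_6_irreducible unfolding irreducible_component_of_def by blast
    \<comment> \<open>\<open>M = diag(-1, -1, -1, 3)/4\<close>\<close>
    moreover define M :: "'k^4^4" where "M = outer (axis 4 1) (axis 4 1) + smat (- 1 / 4) (mat 1)"
    have "M \<in> scalar_plus_rank_one"
      using \<open>axis 4 1 \<noteq> 0\<close> unfolding scalar_plus_rank_one_def M_def by blast
    moreover have "trace M = 0"
      by (simp add: M_def trace_add trace_smat trace_one trace_outer sum_4 axis_def)
    ultimately have "emb M \<in> T" unfolding stratum_6 by blast
    then have "M \<in> scalar_square" using T(3) closure[of "emb M"] by auto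
    then have "M ** M = smat ((M ** M) $ 1 $ 1) (mat 1)" unfolding scalar_square_def by (rule CollectD)
    from arg_cong[OF this, of "\<lambda>Y. Y $ 4 $ 4"]
    have "(M ** M) $ 4 $ 4 = (M ** M) $ 1 $ 1" unfolding smat_nth by (simp add: mat_def)
    then show False
      by (simp add: mul_nth sum_4 M_def axis_def mat_def)
  qed
  moreover have "sl4.sheet S" using S(1) unfolding sl4.sheet_def by blast
  ultimately show ?thesis using semisimple_sl4 by blast
qed


end
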